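(* Let $k$ be an integer. For $\alpha>0$, let $0<\beta\le\min(\alpha,1)$. (i) If $\alpha$ is not an integer and $0<\alpha<k$, then each of $D_\alpha$, $F_{\alpha,\beta}$, $G_\alpha$, $H_{\alpha,\beta}$ defines a complete probability metric on $\mathcal{P}_\alpha(\mathbb{R}^d)$. (ii) If $k$ is odd and either $\alpha$ is not an integer with $0<\alpha<k+1$, or $\alpha=k$, then each of $G_\alpha$, $H_{\alpha,\beta}$ defines a complete probability metric on $\mathcal{P}_\alpha(\mathbb{R}^d)$.
   Context: Let $d\ge 1$ and let $|\cdot|$ denote the Euclidean norm on $\mathbb{R}^d$. $\mathcal{P}(\mathbb{R}^d)$ is the set of Borel probability measures on $\mathbb{R}^d$ and, for $\alpha>0$, $\mathcal{P}_\alpha(\mathbb{R}^d)=\{\mu\in\mathcal{P}(\mathbb{R}^d):\int_{\mathbb{R}^d}|v|^\alpha d\mu(v)<\infty\}$. The Fourier transform of $\mu$ is $\widehat\mu(\xi)=\int_{\mathbb{R}^d}e^{-i\xi\cdot v}d\mu(v)$. For a scalar function $\phi$ on $\mathbb{R}^d$ and a positive integer $k$, $\Delta_\xi^k(\phi)(0)=\sum_{m=0}^k\binom km(-1)^{k-m}\phi(m\xi)$, $\|\phi\|_{\alpha,k}=\int_{\mathbb{R}^d}\frac{|\Delta_\xi^k(\phi)(0)|}{|\xi|^{d+\alpha}}d\xi$, and $\|\phi\|_\infty=\sup_{\xi\in\mathbb{R}^d}|\phi(\xi)|$. Put $d_\beta(\mu,\nu)=\sup_{\xi\ne 0}\frac{|\widehat\mu(\xi)-\widehat\nu(\xi)|}{|\xi|^\beta}$.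 With $\Re$ the pointwise real part, define (suppressing the dependence on $k$) $$D_\alpha(\mu,\nu)=\|\widehat\mu-\widehat\nu\|_\infty+\|\widehat\mu-\widehat\nu\|_{\alpha,k},\qquad F_{\alpha,\beta}(\mu,\nu)=d_\beta(\mu,\nu)+\|\widehat\mu-\widehat\nu\|_{\alpha,k},$$ $$G_\alpha(\mu,\nu)=\|\widehat\mu-\widehat\nu\|_\infty+\|\Re\,\widehat\mu-\Re\,\widehat\nu\|_{\alpha,k},\qquad H_{\alpha,\beta}(\mu,\nu)=d_\beta(\mu,\nu)+\|\Re\,\widehat\mu-\Re\,\widehat\nu\|_{\alpha,k}.$$ A complete probability metric on a class of probability measures is a metric on it that makes it a complete metric space. *)

theory Defs
  imports "HOL-Probability.Probability"
begin

definition prob_measures :: "'a::euclidean_space measure set"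
  where "prob_measures = {\<mu>. prob_space \<mu> \<and> sets \<mu> = sets borel}"

definition prob_measures_moment :: "real \<Rightarrow> 'a::euclidean_space measure set"
  where "prob_measures_moment \<alpha> =
    {\<mu> \<in> prob_measures. (\<integral>\<^sup>+ v. ennreal (norm v powr \<alpha>) \<partial>\<mu>) < \<infinity>}"

definition fourier :: "'a::euclidean_space measure \<Rightarrow> 'a \<Rightarrow> complex"
  where "fourier \<mu> \<xi> = (CLINT v|\<mu>. exp (- \<i> * complex_of_real (\<xi> \<bullet> v)))"

definition fin_diff :: "nat \<Rightarrow> ('a::euclidean_space \<Rightarrow> 'b::real_normed_field) \<Rightarrow> 'a \<Rightarrow> 'b"
  where "fin_diff k \<phi> \<xi> =
    (\<Sum>m=0..k. of_nat (k choose m) * (- 1) ^ (k - m) * \<phi> (real m *\<^sub>R \<xi>))"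

text \<open>The (semi)norms and distances below take values in \<^typ>\<open>ennreal\<close>, so that an infinite
  integral or supremum is not confused with a finite one. The integrand is \<open>0\<close> at the origin by
  the convention for division by zero; this affects only a null set.\<close>

definition diff_norm ::
    "real \<Rightarrow> nat \<Rightarrow> ('a::euclidean_space \<Rightarrow> 'b::real_normed_field) \<Rightarrow> ennreal"
  where "diff_norm \<alpha> k \<phi> =
    (\<integral>\<^sup>+ \<xi>. ennreal (norm (fin_diff k \<phi> \<xi>) / norm \<xi> powr (real DIM('a) + \<alpha>)) \<partial>lborel)"

definition sup_norm :: "('a::euclidean_space \<Rightarrow> 'b::real_normed_field) \<Rightarrow> ennreal"
  where "sup_norm \<phi> = (SUP \<xi>. ennreal (norm (\<phi> \<xi>)))"

definition fourier_dist ::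
    "real \<Rightarrow> 'a::euclidean_space measure \<Rightarrow> 'a measure \<Rightarrow> ennreal"
  where "fourier_dist \<beta> \<mu> \<nu> =
    (SUP \<xi>\<in>{\<xi>. \<xi> \<noteq> 0}. ennreal (norm (fourier \<mu> \<xi> - fourier \<nu> \<xi>) / norm \<xi> powr \<beta>))"

definition D_dist ::
    "nat \<Rightarrow> real \<Rightarrow> 'a::euclidean_space measure \<Rightarrow> 'a measure \<Rightarrow> ennreal"
  where "D_dist k \<alpha> \<mu> \<nu> =
    sup_norm (\<lambda>\<xi>. fourier \<mu> \<xi> - fourier \<nu> \<xi>)
    + diff_norm \<alpha> k (\<lambda>\<xi>. fourier \<mu> \<xi> - fourier \<nu> \<xi>)"

definition F_dist ::
    "nat \<Rightarrow> real \<Rightarrow> real \<Rightarrow> 'a::euclidean_space measure \<Rightarrow> 'a measure \<Rightarrow> ennreal"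
  where "F_dist k \<alpha> \<beta> \<mu> \<nu> =
    fourier_dist \<beta> \<mu> \<nu>
    + diff_norm \<alpha> k (\<lambda>\<xi>. fourier \<mu> \<xi> - fourier \<nu> \<xi>)"

definition G_dist ::
    "nat \<Rightarrow> real \<Rightarrow> 'a::euclidean_space measure \<Rightarrow> 'a measure \<Rightarrow> ennreal"
  where "G_dist k \<alpha> \<mu> \<nu> =
    sup_norm (\<lambda>\<xi>. fourier \<mu> \<xi> - fourier \<nu> \<xi>)
    + diff_norm \<alpha> k (\<lambda>\<xi>. Re (fourier \<mu> \<xi>) - Re (fourier \<nu> \<xi>))"

definition H_dist ::
    "nat \<Rightarrow> real \<Rightarrow> real \<Rightarrow> 'a::euclidean_space measure \<Rightarrow> 'a measure \<Rightarrow> ennreal"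
  where "H_dist k \<alpha> \<beta> \<mu> \<nu> =
    fourier_dist \<beta> \<mu> \<nu>
    + diff_norm \<alpha> k (\<lambda>\<xi>. Re (fourier \<mu> \<xi>) - Re (fourier \<nu> \<xi>))"

text \<open>Since \<^const>\<open>enn2real\<close> sends \<open>\<infinity>\<close> to \<open>0\<close>, finiteness on \<open>S\<close> has to be required
  explicitly.\<close>

definition complete_metric_on :: "'m set \<Rightarrow> ('m \<Rightarrow> 'm \<Rightarrow> ennreal) \<Rightarrow> bool"
  where "complete_metric_on S d \<longleftrightarrow>
    (\<forall>x\<in>S. \<forall>y\<in>S. d x y < \<infinity>) \<and>
    Metric_space S (\<lambda>x y. enn2real (d x y)) \<and>
    Metric_space.mcomplete S (\<lambda>x y. enn2real (d x y))"

end

theory Submission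
  imports Defs
begin

text \<open>
  Put \<open>b m = (- 1) ^ (k - m) * (k choose m)\<close> and \<open>w u = (\<Sum>m\<le>k. b m * cos (m * u))\<close>. The real part of
  the \<open>k\<close>-th difference of the Fourier transform of \<open>\<mu>\<close> at \<open>0\<close> is \<open>\<integral>v. w (\<xi> \<bullet> v) \<partial>\<mu>\<close>, and by scaling the
  integral of \<open>w (s * u) * s powr (- 1 - \<alpha>)\<close> over \<open>s > 0\<close> equals \<open>c * \<bar>u\<bar> powr \<alpha>\<close>. The theorem holds because
  this integral converges absolutely and its constant \<open>c\<close> does not vanish: the seminorm of a
  difference then controls the difference of the moments of order \<open>\<alpha>\<close>.

  The numbers \<open>\<Sum>m\<le>k. b m * m ^ j\<close> vanish for \<open>j < k\<close>. Hence in \<open>w\<close> the cosine may be replaced by its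
  remainder after the Taylor polynomial with terms of degree \<open>0, 2, \<dots>, 2 * (p - 1)\<close>, provided these
  degrees are below \<open>k\<close>. With \<open>2 * (p - 1) < \<alpha> < 2 * p\<close> that remainder is integrable against
  \<open>s powr (- 1 - \<alpha>)\<close>, and it has constant sign. Therefore \<open>c\<close> is a nonzero multiple of
  \<open>\<Sum>m\<le>k. b m * m powr \<alpha>\<close>, the \<open>k\<close>-th difference of \<open>x powr \<alpha>\<close> at \<open>0\<close>, which by the mean value theorem is
  \<open>\<alpha> * (\<alpha> - 1) * \<dots> * (\<alpha> - k + 1) * x powr (\<alpha> - k)\<close> for some \<open>x > 0\<close>. Only even Taylor degrees occur, so
  for odd \<open>k\<close> the argument reaches up to \<open>\<alpha> < k + 1\<close> and includes \<open>\<alpha> = k\<close>.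

  Averaging over rays (\<open>radial_average\<close>) transports this to \<open>'a\<close> and yields that the distances are finite
  and that a moment is bounded by another one plus the distance (\<open>moment_bound\<close>). A Cauchy sequence
  therefore has bounded moments, is tight and has a weakly convergent subsequence, whose limit again
  has a finite moment. Its Fourier transforms converge pointwise, and each of the four distances is
  lower semicontinuous under pointwise convergence, being a sum of suprema and of integrals to which
  Fatou's lemma applies. So the Cauchy condition passes to the limit
  (\<open>complete_metric_on_fourier_seminorm\<close>).

  Two facts about measures on \<open>'a\<close> are reduced to the real line. Weak compactness of tight sequences
  follows from Helly's theorem, because a space-filling curve has a Borel section that maps bounded
  sets to bounded sets (\<open>tight_imp_weakly_convergent_subsequence\<close>). Uniqueness of the Fourier transform
  follows from Levy's uniqueness theorem, applied to one coordinate after the other with trigonometric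
  weights (\<open>fourier_unique\<close>).
\<close>

section \<open>Finite differences of powers\<close>

lemma fin_diff_0: "fin_diff 0 \<phi> \<xi> = \<phi> 0"
  by (simp add: fin_diff_def)

lemma fin_diff_Suc:
  "fin_diff (Suc k) \<phi> \<xi> = fin_diff k (\<lambda>x. \<phi> (x + \<xi>) - \<phi> x) \<xi>"
proof -
  let ?g = "\<lambda>m. \<phi> (real m *\<^sub>R \<xi>)"
  let ?t = "\<lambda>m. of_nat (k choose m) * (- 1) ^ (Suc k - m) * ?g m"
  have "fin_diff (Suc k) \<phi> \<xi> = (- 1) ^ Suc k * ?g 0 +
      (\<Sum>m\<le>k. of_nat (Suc k choose Suc m) * (- 1) ^ (k - m) * ?g (Suc m))"
    unfolding fin_diff_def atMost_atLeast0[symmetric] by (subst sum.atMost_Suc_shift) simp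
  also have "\<dots> = ?t 0 + (\<Sum>m\<le>k. ?t (Suc m)) +
      (\<Sum>m\<le>k. of_nat (k choose m) * (- 1) ^ (k - m) * ?g (Suc m))"
    by (simp add: sum.distrib[symmetric] algebra_simps)
  also have "?t 0 + (\<Sum>m\<le>k. ?t (Suc m)) = (\<Sum>m\<le>Suc k. ?t m)"
    by (rule sum.atMost_Suc_shift[symmetric])
  also have "\<dots> = (\<Sum>m\<le>k. ?t m)" by simp
  also have "\<dots> = - (\<Sum>m\<le>k. of_nat (k choose m) * (- 1) ^ (k - m) * ?g m)"
    unfolding sum_negf[symmetric] by (intro sum.cong) (auto simp: Suc_diff_le)
  also have "\<dots> + (\<Sum>m\<le>k. of_nat (k choose m) * (- 1) ^ (k - m) * ?g (Suc m)) =
     fin_diff k (\<lambda>x. \<phi> (x + \<xi>) - \<phi> x) \<xi>"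
    unfolding fin_diff_def atMost_atLeast0[symmetric]
    by (simp add: sum_subtractf algebra_simps)
  finally show ?thesis .
qed

text \<open>
  A difference of order \<open>k + 1\<close> of \<open>f\<close> is one of order \<open>k\<close> of \<open>\<lambda>x. f (x + 1) - f x\<close>, so induction reduces the
  claim to the ordinary mean value theorem. Differentiability is asked for in the open interval only,
  because \<open>x powr \<alpha>\<close> is not smooth at \<open>0\<close>.
\<close>

lemma fin_diff_mean_value:
  fixes f :: "nat \<Rightarrow> real \<Rightarrow> real"
  assumes "0 < k" and "continuous_on {a..a + real k} (f 0)"
    and "\<And>n x. n < k \<Longrightarrow> a < x \<Longrightarrow> x < a + real k \<Longrightarrow> (f n has_real_derivative f (Suc n) x) (at x)"
  shows "\<exists>x. a < x \<and> x < a + real k \<and> fin_diff k (\<lambda>x. f 0 (a + x)) (1::real) = f k x"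
  using assms
proof (induction k arbitrary: f rule: nat_induct_non_zero)
  case 1
  have "\<exists>l z. a < z \<and> z < a + 1 \<and> (f 0 has_real_derivative l) (at z)
      \<and> f 0 (a + 1) - f 0 a = (a + 1 - a) * l"
    using 1 by (intro MVT) (auto simp: real_differentiable_def)
  then obtain l z where z: "a < z" "z < a + 1" "(f 0 has_real_derivative l) (at z)"
      "f 0 (a + 1) - f 0 a = l" by auto
  moreover have "l = f 1 z"
    using 1(2)[of 0 z] z by (auto intro: DERIV_unique)
  ultimately show ?case
    by (auto simp: fin_diff_Suc[of 0, simplified] fin_diff_0)
next
  case (Suc k)
  define g where "g = (\<lambda>n x. f n (x + 1) - f n x)"
  have "\<exists>x. a < x \<and> x < a + real k \<and> fin_diff k (\<lambda>x. g 0 (a + x)) (1::real) = g k x"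
  proof (rule Suc.IH)
    have "continuous_on {a..a + real k} (\<lambda>x. f 0 (x + 1))"
      by (rule continuous_on_compose2[OF Suc.prems(1)]) (auto intro!: continuous_intros)
    moreover have "continuous_on {a..a + real k} (f 0)"
      by (rule continuous_on_subset[OF Suc.prems(1)]) auto
    ultimately show "continuous_on {a..a + real k} (g 0)"
      unfolding g_def by (intro continuous_intros)
    fix n x assume n: "n < k" "a < x" "x < a + real k"
    have "(f n has_real_derivative f (Suc n) (x + 1)) (at (x + 1))"
      using n by (intro Suc.prems(2)) auto
    moreover have "(f n has_real_derivative f (Suc n) x) (at x)"
      using n by (intro Suc.prems(2)) auto
    ultimately show "(g n has_real_derivative g (Suc n) x) (at x)"
      unfolding g_def by (intro DERIV_diff) (simp_all add: DERIV_shift)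
  qed
  then obtain x where x: "a < x" "x < a + real k" "fin_diff k (\<lambda>x. g 0 (a + x)) (1::real) = g k x"
    by auto
  have d: "(f k has_real_derivative f (Suc k) y) (at y)" if "x \<le> y" "y \<le> x + 1" for y
    using that x by (intro Suc.prems(2)) auto
  obtain z where z: "x < z" "z < x + 1" "f k (x + 1) - f k x = (x + 1 - x) * f (Suc k) z"
    using MVT2[of x "x + 1" "f k" "f (Suc k)"] d by auto
  have "fin_diff (Suc k) (\<lambda>x. f 0 (a + x)) (1::real) = f (Suc k) z"
    using x z by (simp add: fin_diff_Suc g_def add.assoc)
  then show ?case using x z by (intro exI[of _ z]) auto
qed

definition falling_factorial :: "real \<Rightarrow> nat \<Rightarrow> real"
  where "falling_factorial \<alpha> n = (\<Prod>i<n. \<alpha> - real i)"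

lemma fin_diff_powr:
  fixes \<alpha> :: real
  assumes "0 < \<alpha>" "0 < k"
  shows "\<exists>x>0. fin_diff k (\<lambda>x. x powr \<alpha>) (1::real) = falling_factorial \<alpha> k * x powr (\<alpha> - real k)"
proof -
  let ?f = "\<lambda>n x. falling_factorial \<alpha> n * x powr (\<alpha> - real n)"
  have "\<exists>x. 0 < x \<and> x < 0 + real k \<and> fin_diff k (\<lambda>x. ?f 0 (0 + x)) (1::real) = ?f k x"
  proof (rule fin_diff_mean_value[OF assms(2)])
    show "continuous_on {0..0 + real k} (?f 0)"
      using assms by (auto intro!: continuous_intros continuous_on_powr' simp: falling_factorial_def)
    fix n x assume "(0::real) < x"
    then show "(?f n has_real_derivative ?f (Suc n) x) (at x)"
      by (auto intro!: derivative_eq_intros simp: falling_factorial_def  algebra_simps)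
  qed
  then show ?thesis by (auto simp: falling_factorial_def)
qed

lemma fin_diff_powr_nonzero:
  fixes \<alpha> :: real
  assumes "0 < \<alpha>" "0 < k" "\<And>i. i < k \<Longrightarrow> \<alpha> \<noteq> real i"
  shows "fin_diff k (\<lambda>x. x powr \<alpha>) (1::real) \<noteq> 0"
  using fin_diff_powr[OF assms(1,2)] assms(3) by (auto simp: falling_factorial_def)

lemma fin_diff_power_zero:
  assumes "j < k"
  shows "fin_diff k (\<lambda>x. x ^ j) (1::real) = 0"
proof (cases "j = 0")
  case True
  have "(\<Sum>m\<le>k. of_nat (k choose m) * 1 ^ m * (- 1) ^ (k - m)) = (1 + (- 1) :: real) ^ k"
    by (rule binomial_ring[symmetric])
  then show ?thesis using assms True
    by (simp add: fin_diff_def atMost_atLeast0)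
next
  case False
  then have "fin_diff k (\<lambda>x. x ^ j) (1::real) = fin_diff k (\<lambda>x. x powr real j) (1::real)"
    unfolding fin_diff_def 
    by (intro sum.cong refl) (metis (no_types) mult_cancel_left mult.right_neutral of_nat_0_le_iff powr_realpow' real_scaleR_def)
  also have "\<dots> = 0"
    using fin_diff_powr[of "real j" k] False assms by (auto simp: falling_factorial_def)
  finally show ?thesis .
qed

section \<open>Taylor remainders of the cosine\<close>

text \<open>
  The sign \<open>(- 1) ^ p\<close> makes the remainder nonnegative for \<open>p > 0\<close>.
\<close>

definition cos_rem :: "nat \<Rightarrow> real \<Rightarrow> real"
  where "cos_rem p u = (- 1) ^ p * (cos u - (\<Sum>i<p. (- 1) ^ i * u ^ (2 * i) / fact (2 * i)))"

text \<open>
  The sine remainder serves to prove positivity: it is the derivative of \<open>cos_rem (Suc p)\<close>, and its own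
  derivative is \<open>cos_rem p\<close>.
\<close>

definition sin_rem :: "nat \<Rightarrow> real \<Rightarrow> real"
  where "sin_rem p u = (- 1) ^ p * (sin u - (\<Sum>i<p. (- 1) ^ i * u ^ (2 * i + 1) / fact (2 * i + 1)))"

lemma cos_rem_even [simp]: "cos_rem p \<bar>u\<bar> = cos_rem p u"
  by (simp add: cos_rem_def power_mult)

lemma cos_rem_Suc: "cos_rem (Suc p) u = u ^ (2 * p) / fact (2 * p) - cos_rem p u"
  by (simp add: cos_rem_def algebra_simps flip: power_add)

lemma cos_rem_at_0: "0 < p \<Longrightarrow> cos_rem p 0 = 0"
  by (cases p) (simp_all add: cos_rem_def sum.lessThan_Suc_shift del: sum.lessThan_Suc)

lemma sin_rem_at_0: "sin_rem p 0 = 0"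
  by (simp add: sin_rem_def)

lemma cos_rem_Suc_deriv: "(cos_rem (Suc p) has_real_derivative sin_rem p u) (at u)"
proof -
  have "((\<lambda>u. u ^ (2 * Suc i) / fact (2 * Suc i)) has_real_derivative
      u ^ (2 * i + 1) / fact (2 * i + 1)) (at u)" for i
  proof -
    have "((\<lambda>u. u ^ (2 * Suc i) / fact (2 * Suc i)) has_real_derivative
        real (2 * i + 2) * u ^ (2 * i + 1) / fact (2 * Suc i)) (at u)"
      by (rule derivative_eq_intros refl | simp)+
    also have "fact (2 * Suc i) = real (2 * i + 2) * fact (2 * i + 1)"
      by (simp add: algebra_simps)
    finally show ?thesis
      by (simp only: mult_divide_mult_cancel_left_if) simp
  qed
  then have "((\<lambda>u. (- 1) ^ Suc p *
      (cos u - (1 + (\<Sum>i<p. (- 1) ^ Suc i * (u ^ (2 * Suc i) / fact (2 * Suc i))))))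
    has_real_derivative (- 1) ^ Suc p *
      (- sin u - (0 + (\<Sum>i<p. (- 1) ^ Suc i * (u ^ (2 * i + 1) / fact (2 * i + 1)))))) (at u)"
    by (intro DERIV_cmult DERIV_diff DERIV_cos DERIV_add DERIV_const DERIV_sum)
  moreover have "cos_rem (Suc p) = (\<lambda>u. (- 1) ^ Suc p *
      (cos u - (1 + (\<Sum>i<p. (- 1) ^ Suc i * (u ^ (2 * Suc i) / fact (2 * Suc i))))))"
    unfolding cos_rem_def sum.lessThan_Suc_shift by simp
  moreover have "sin_rem p u = (- 1) ^ Suc p *
      (- sin u - (0 + (\<Sum>i<p. (- 1) ^ Suc i * (u ^ (2 * i + 1) / fact (2 * i + 1)))))"
    by (simp add: sin_rem_def sum_negf algebra_simps)
  ultimately show ?thesis by simp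
qed

lemma sin_rem_deriv: "(sin_rem p has_real_derivative cos_rem p u) (at u)"
proof -
  show ?thesis
    unfolding cos_rem_def sin_rem_def
    apply (rule derivative_eq_intros refl | simp)+
    by (simp add:  field_simps)
qed

lemma cos_rem_nonneg_aux:
  assumes "0 < p"
  shows "0 \<le> u \<Longrightarrow> 0 \<le> cos_rem p u"
  using assms
proof (induction p arbitrary: u rule: nat_induct_non_zero)
  case 1
  then show ?case by (simp add: cos_rem_def)
next
  case (Suc p)
  have s: "0 \<le> sin_rem p x" if "0 \<le> x" for x
    using DERIV_nonneg_imp_nondecreasing[of 0 x "sin_rem p"] that Suc.IH sin_rem_deriv sin_rem_at_0
    by (metis)
  then show ?case
    using DERIV_nonneg_imp_nondecreasing[of 0 u "cos_rem (Suc p)"] Suc.prems cos_rem_Suc_deriv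
      cos_rem_at_0[of "Suc p"] by (metis zero_less_Suc)
qed

lemma cos_rem_nonneg: "0 < p \<Longrightarrow> 0 \<le> cos_rem p u"
  using cos_rem_nonneg_aux[of p "\<bar>u\<bar>"] by simp

text \<open>
  Two consecutive remainders add up to the omitted Taylor term, and both are nonnegative.
\<close>

lemma cos_rem_le: "0 < p \<Longrightarrow> cos_rem p u \<le> u ^ (2 * p) / fact (2 * p)"
  using cos_rem_Suc[of p u] cos_rem_nonneg[of "Suc p" u] by simp

text \<open>
  The bound that is effective for large \<open>u\<close>; for \<open>p = 1\<close> it is the trivial \<open>1 - cos u \<le> 2\<close>.
\<close>

lemma cos_rem_le_lower:
  assumes "0 < p" shows "cos_rem p u \<le> 2 * u ^ (2 * (p - 1))"
proof -
  obtain q where q: "p = Suc q" using assms by (cases p) auto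
  have f: "u ^ (2 * q) / fact (2 * q) \<le> u ^ (2 * q) / 1"
    by (intro divide_left_mono fact_ge_1) auto
  have "- cos_rem q u \<le> u ^ (2 * q)"
  proof (cases "q = 0")
    case True
    then show ?thesis using cos_ge_minus_one[of u] by (simp add: cos_rem_def minus_le_iff del: cos_ge_minus_one)
  next
    case False
    then have "0 \<le> cos_rem q u" by (simp add: cos_rem_nonneg)
    moreover have "0 \<le> u ^ (2 * q)" by simp
    ultimately show ?thesis by linarith
  qed
  then show ?thesis using f q cos_rem_Suc[of q u] by simp
qed

lemma cos_rem_pos:
  assumes "0 < p" "0 < u" "u < 1" shows "0 < cos_rem p u"
proof -
  have "cos_rem (Suc p) u \<le> u ^ (2 * Suc p) / fact (2 * Suc p)" by (rule cos_rem_le) simp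
  also have "\<dots> < u ^ (2 * p) / fact (2 * p)"
  proof (rule frac_less)
    show "u ^ (2 * Suc p) < u ^ (2 * p)"
      using assms by (intro power_strict_decreasing) auto
    show "fact (2 * p) \<le> (fact (2 * Suc p) :: real)" by (intro fact_mono) simp
  qed (use assms in auto)
  finally show ?thesis by (simp add: cos_rem_Suc[of p])
qed

lemma cos_rem_measurable [measurable]: "cos_rem p \<in> borel_measurable borel"
  unfolding cos_rem_def by measurable

text \<open>
  The Taylor polynomial of degree below \<open>2 * p\<close> is annihilated by the difference, since all its exponents
  are smaller than \<open>k\<close>.
\<close>

lemma fin_diff_cos:
  assumes "\<And>i. i < p \<Longrightarrow> 2 * i < k"
  shows "fin_diff k (\<lambda>m. cos (m * u)) (1::real) =
    (- 1) ^ p * fin_diff k (\<lambda>m. cos_rem p (m * u)) (1::real)"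
proof -
  have c: "cos x = (- 1) ^ p * cos_rem p x + (\<Sum>i<p. (- 1) ^ i * x ^ (2 * i) / fact (2 * i))" for x
    by (simp add: cos_rem_def mult.assoc[symmetric] power_mult_distrib[symmetric])
  have "fin_diff k (\<lambda>m. cos (m * u)) (1::real) =
    (- 1) ^ p * fin_diff k (\<lambda>m. cos_rem p (m * u)) (1::real) +
    fin_diff k (\<lambda>m. \<Sum>i<p. (- 1) ^ i * (m * u) ^ (2 * i) / fact (2 * i)) 1"
    unfolding fin_diff_def c
    by (simp add: sum.distrib[symmetric] sum_distrib_left algebra_simps del: sum.distrib )
  also have "fin_diff k (\<lambda>m. \<Sum>i<p. (- 1) ^ i * (m * u) ^ (2 * i) / fact (2 * i)) (1::real) =
     (\<Sum>i<p. (- 1) ^ i * u ^ (2 * i) / fact (2 * i) * fin_diff k (\<lambda>m. m ^ (2 * i)) (1::real))"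
    unfolding fin_diff_def sum_distrib_left
    by (subst sum.swap) (simp add: power_mult_distrib mult_ac)
  also have "\<dots> = 0"
    using assms by (intro sum.neutral) (simp add: fin_diff_power_zero)
  finally show ?thesis by simp
qed

section \<open>Integrals against power kernels on the half-line\<close>

lemma power_kernel_finite:
  fixes \<gamma> q :: real
  assumes "0 < \<gamma>" "\<gamma> < q"
  shows "(\<integral>\<^sup>+s\<in>{0<..}. ennreal (min 1 (s powr q) * s powr (- 1 - \<gamma>)) \<partial>lborel) < \<infinity>"
proof -
  have 1: "(\<integral>\<^sup>+s. ennreal (indicator {0..1} s * (s powr (q - 1 - \<gamma>))) \<partial>lborel) = 
      ennreal (1 powr (q - 1 - \<gamma> + 1) / (q - 1 - \<gamma> + 1))"
    using assms by (intro nn_integral_has_integral_lebesgue has_integral_powr_from_0) auto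
  have 2: "(\<integral>\<^sup>+s. ennreal (indicator {1..} s * (s powr (- 1 - \<gamma>))) \<partial>lborel) = 
      ennreal (- (1 powr (- 1 - \<gamma> + 1)) / (- 1 - \<gamma> + 1))"
    using assms by (intro nn_integral_has_integral_lebesgue has_integral_powr_to_inf) auto
  have "(\<integral>\<^sup>+s\<in>{0<..}. ennreal (min 1 (s powr q) * s powr (- 1 - \<gamma>)) \<partial>lborel) \<le>
    (\<integral>\<^sup>+s. ennreal (indicator {0..1} s * (s powr (q - 1 - \<gamma>))) +
      ennreal (indicator {1..} s * (s powr (- 1 - \<gamma>))) \<partial>lborel)"
  proof (rule nn_integral_mono)
    fix s :: real
    show "ennreal (min 1 (s powr q) * s powr (- 1 - \<gamma>)) * indicator {0<..} s \<le>
      ennreal (indicator {0..1} s * (s powr (q - 1 - \<gamma>))) +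
      ennreal (indicator {1..} s * (s powr (- 1 - \<gamma>)))"
    proof (cases "0 < s \<and> s \<le> 1")
      case True
      then have "min 1 (s powr q) * s powr (- 1 - \<gamma>) \<le> s powr q * s powr (- 1 - \<gamma>)"
        by (intro mult_right_mono) auto
      also have "\<dots> = s powr (q - 1 - \<gamma>)"
        by (simp add: powr_add[symmetric] algebra_simps)
      finally have "ennreal (min 1 (s powr q) * s powr (- 1 - \<gamma>)) \<le> ennreal (s powr (q - 1 - \<gamma>))"
        by (rule ennreal_leI)
      then show ?thesis using True by (simp add: add_increasing2)
    next
      case False
      have "min 1 (s powr q) * s powr (- 1 - \<gamma>) \<le> 1 * s powr (- 1 - \<gamma>)"
        by (intro mult_right_mono) auto
      then have "ennreal (min 1 (s powr q) * s powr (- 1 - \<gamma>)) \<le> ennreal (1 * s powr (- 1 - \<gamma>))"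
        by (rule ennreal_leI)
      then show ?thesis using False by (cases "0 < s") (simp_all add: not_le)
    qed
  qed
  also have "\<dots> < \<infinity>"
    by (subst nn_integral_add) (simp_all add: 1 2)
  finally show ?thesis .
qed

lemma nn_integral_scale_kernel:
  fixes h :: "real \<Rightarrow> real"
  assumes [measurable]: "h \<in> borel_measurable borel" and h: "\<And>s. 0 \<le> h s" and x: "0 < x"
  shows "(\<integral>\<^sup>+s\<in>{0<..}. ennreal (h (s * x) * s powr (- 1 - \<alpha>)) \<partial>lborel) =
    ennreal (x powr \<alpha>) * (\<integral>\<^sup>+s\<in>{0<..}. ennreal (h s * s powr (- 1 - \<alpha>)) \<partial>lborel)"
proof -
  have "(\<integral>\<^sup>+s\<in>{0<..}. ennreal (h (s * x) * s powr (- 1 - \<alpha>)) \<partial>lborel) =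
     ennreal \<bar>1 / x\<bar> * (\<integral>\<^sup>+s. ennreal (h ((0 + 1 / x * s) * x) * (0 + 1 / x * s) powr (- 1 - \<alpha>)) *
        indicator {0<..} (0 + 1 / x * s) \<partial>lborel)"
    using x by (intro nn_integral_real_affine) auto
  also have "\<dots> = (\<integral>\<^sup>+s. ennreal \<bar>1 / x\<bar> * (ennreal (h ((0 + 1 / x * s) * x) * (0 + 1 / x * s) powr (- 1 - \<alpha>)) *
        indicator {0<..} (0 + 1 / x * s)) \<partial>lborel)"
    by (rule nn_integral_cmult[symmetric]) simp
  also have "\<dots> = (\<integral>\<^sup>+s. ennreal (x powr \<alpha>) * (ennreal (h s * s powr (- 1 - \<alpha>)) * indicator {0<..} s) \<partial>lborel)"
  proof (rule nn_integral_cong)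
    fix s :: real
    have "1 / x * (h s * (s / x) powr (- 1 - \<alpha>)) = x powr \<alpha> * (h s * s powr (- 1 - \<alpha>))" if "0 < s"
      using x that by (simp add: powr_divide powr_diff powr_minus field_simps)
    then show "ennreal \<bar>1 / x\<bar> * (ennreal (h ((0 + 1 / x * s) * x) * (0 + 1 / x * s) powr (- 1 - \<alpha>)) *
        indicator {0<..} (0 + 1 / x * s)) = 
        ennreal (x powr \<alpha>) * (ennreal (h s * s powr (- 1 - \<alpha>)) * indicator {0<..} s)"
      using x h by (auto simp: indicator_def ennreal_mult[symmetric] zero_less_divide_iff simp del: ennreal_mult')
  qed
  also have "\<dots> = ennreal (x powr \<alpha>) * (\<integral>\<^sup>+s\<in>{0<..}. ennreal (h s * s powr (- 1 - \<alpha>)) \<partial>lborel)"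
    by (rule nn_integral_cmult) simp
  finally show ?thesis .
qed

definition cos_rem_const :: "nat \<Rightarrow> real \<Rightarrow> real"
  where "cos_rem_const p \<alpha> =
    enn2real (\<integral>\<^sup>+s\<in>{0<..}. ennreal (cos_rem p s * s powr (- 1 - \<alpha>)) \<partial>lborel)"

text \<open>
  The remainder is of order \<open>s ^ (2 * p)\<close> at \<open>0\<close> and of order \<open>s ^ (2 * (p - 1))\<close> at infinity, which is exactly the
  room that the bounds on \<open>\<alpha>\<close> leave. The integral does not vanish since the remainder is positive on
  the unit interval.
\<close>

lemma cos_rem_integral:
  assumes p: "0 < p" and \<alpha>: "2 * (real p - 1) < \<alpha>" "\<alpha> < 2 * real p"
  shows "(\<integral>\<^sup>+s\<in>{0<..}. ennreal (cos_rem p s * s powr (- 1 - \<alpha>)) \<partial>lborel) = ennreal (cos_rem_const p \<alpha>)"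
    and "0 < cos_rem_const p \<alpha>"
proof -
  let ?I = "\<integral>\<^sup>+s\<in>{0<..}. ennreal (cos_rem p s * s powr (- 1 - \<alpha>)) \<partial>lborel"
  \<comment> \<open>After the factor of order \<open>2 * (p - 1)\<close> is absorbed, an exponent strictly between 0 and 2 remains.\<close>
  define \<gamma> where "\<gamma> = \<alpha> - 2 * (real p - 1)"
  have "?I \<le> (\<integral>\<^sup>+s. ennreal 2 * (ennreal (min 1 (s powr 2) * s powr (- 1 - \<gamma>)) * indicator {0<..} s) \<partial>lborel)"
  proof (rule nn_integral_mono)
    fix s :: real
    have "ennreal (cos_rem p s * s powr (- 1 - \<alpha>)) \<le>
        ennreal 2 * ennreal (min 1 (s powr 2) * s powr (- 1 - \<gamma>))" if s: "0 < s"
    proof -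
      have "cos_rem p s \<le> s ^ (2 * p) / 1"
        by (rule order_trans[OF cos_rem_le[OF p] divide_left_mono[OF fact_ge_1]]) auto
      also have "\<dots> = s ^ (2 * (p - 1)) * s\<^sup>2"
        using p by (cases p) (simp_all add: power2_eq_square)
      also have "\<dots> \<le> 2 * s ^ (2 * (p - 1)) * s\<^sup>2"
        by (intro mult_right_mono) auto
      finally have "cos_rem p s \<le> 2 * s ^ (2 * (p - 1)) * min 1 (s\<^sup>2)"
        using cos_rem_le_lower[OF p, of s] by (auto simp: min_def)
      also have "\<dots> = 2 * s powr (2 * (real p - 1)) * min 1 (s powr 2)"
        using s p powr_realpow[OF s, of "2 * (p - 1)"] by (simp add: of_nat_diff)
      finally have "cos_rem p s * s powr (- 1 - \<alpha>) \<le>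
          2 * s powr (2 * (real p - 1)) * min 1 (s powr 2) * s powr (- 1 - \<alpha>)"
        by (intro mult_right_mono) auto
      also have "\<dots> = 2 * (min 1 (s powr 2) * (s powr (2 * (real p - 1)) * s powr (- 1 - \<alpha>)))"
        by simp
      also have "s powr (2 * (real p - 1)) * s powr (- 1 - \<alpha>) = s powr (- 1 - \<gamma>)"
        unfolding powr_add[symmetric] \<gamma>_def by (simp add: algebra_simps)
      finally have "ennreal (cos_rem p s * s powr (- 1 - \<alpha>)) \<le>
          ennreal (2 * (min 1 (s powr 2) * s powr (- 1 - \<gamma>)))"
        by (rule ennreal_leI)
      then show ?thesis by (subst (asm) ennreal_mult) auto
    qed
    then show "ennreal (cos_rem p s * s powr (- 1 - \<alpha>)) * indicator {0<..} s \<le>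
       ennreal 2 * (ennreal (min 1 (s powr 2) * s powr (- 1 - \<gamma>)) * indicator {0<..} s)"
      by (cases "0 < s") (simp_all add: indicator_def)
  qed
  also have "\<dots> = ennreal 2 * (\<integral>\<^sup>+s\<in>{0<..}. ennreal (min 1 (s powr 2) * s powr (- 1 - \<gamma>)) \<partial>lborel)"
    by (rule nn_integral_cmult) simp
  also have "\<dots> < \<infinity>"
    using power_kernel_finite[of \<gamma> 2] \<alpha>
    by (simp add: ennreal_mult_less_top \<gamma>_def)
  finally have fin: "?I < \<infinity>" .
  then show "?I = ennreal (cos_rem_const p \<alpha>)"
    by (simp add: cos_rem_const_def)
  have "?I \<noteq> 0"
  proof
    assume "?I = 0"
    then have "AE s in lborel. ennreal (cos_rem p s * s powr (- 1 - \<alpha>)) * indicator {0<..} s = 0"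
      by (subst (asm) nn_integral_0_iff_AE) auto
    then have "AE s in lborel. s \<notin> {0<..<1::real}"
    proof eventually_elim
      case (elim s)
      show ?case
      proof
        assume s: "s \<in> {0<..<1}"
        then have "0 < cos_rem p s * s powr (- 1 - \<alpha>)"
          using cos_rem_pos[OF p, of s] by simp
        then show False using elim s by (simp add: ennreal_eq_0_iff)
      qed
    qed
    then have "emeasure lborel {x. 0 < x \<and> x < (1::real)} = 0"
      by (subst (asm) AE_iff_measurable[OF _ refl]) auto
    moreover have "{x. 0 < x \<and> x < 1} = {0<..<1::real}" by auto
    ultimately have "emeasure lborel {0<..<1::real} = 0" by simp
    then show False by (subst (asm) emeasure_lborel_Ioo) simp_all
  qed
  then show "0 < cos_rem_const p \<alpha>"
    using fin by (simp add: cos_rem_const_def enn2real_positive_iff zero_less_iff_neq_zero)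
qed

lemma cos_rem_integral_scale:
  assumes p: "0 < p" and \<alpha>: "2 * (real p - 1) < \<alpha>" "\<alpha> < 2 * real p"
  shows "(\<integral>\<^sup>+s\<in>{0<..}. ennreal (cos_rem p (s * x) * s powr (- 1 - \<alpha>)) \<partial>lborel) =
    ennreal (\<bar>x\<bar> powr \<alpha> * cos_rem_const p \<alpha>)"
proof (cases "x = 0")
  case True
  then show ?thesis using p by (simp add: cos_rem_at_0)
next
  case False
  have "cos_rem p (s * x) = cos_rem p (s * \<bar>x\<bar>)" for s
    by (metis abs_mult abs_abs cos_rem_even)
  then show ?thesis
    using nn_integral_scale_kernel[of "cos_rem p" "\<bar>x\<bar>" \<alpha>] False cos_rem_integral[OF assms]
    by (simp add: cos_rem_nonneg[OF p] ennreal_mult)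
qed

section \<open>Averaging over rays\<close>

lemma nn_integral_scaleR_lborel:
  fixes f :: "'a::euclidean_space \<Rightarrow> ennreal"
  assumes [measurable]: "f \<in> borel_measurable borel" and "0 < c"
  shows "(\<integral>\<^sup>+x. f x \<partial>lborel) = ennreal (c ^ DIM('a)) * (\<integral>\<^sup>+x. f (c *\<^sub>R x) \<partial>lborel)"
proof -
  have "(\<integral>\<^sup>+x. f x \<partial>lborel) = (\<integral>\<^sup>+x. f x \<partial>density (distr lborel borel (\<lambda>x::'a. 0 + c *\<^sub>R x)) (\<lambda>_. ennreal (\<bar>c\<bar> ^ DIM('a))))"
    using assms by (subst (1) lborel_affine[of c "0::'a"]) auto
  also have "\<dots> = ennreal (c ^ DIM('a)) * (\<integral>\<^sup>+x. f (c *\<^sub>R x) \<partial>lborel)"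
    using assms by (subst nn_integral_density) (auto simp: nn_integral_distr nn_integral_cmult)
  finally show ?thesis .
qed

lemma nn_integral_inverse_dyadic:
  fixes r :: real
  assumes "0 < r"
  shows "(\<integral>\<^sup>+s. ennreal (1 / s) * indicator {r / 2..r} s \<partial>lborel) = ennreal (ln 2)"
proof -
  have "(\<integral>\<^sup>+s. ennreal (1 / s) * indicator {r / 2..r} s \<partial>lborel) = ennreal (ln r - ln (r / 2))"
    using assms by (intro nn_integral_FTC_Icc) (auto intro!: derivative_eq_intros)
  then show ?thesis using assms by (simp add: ln_div)
qed

definition shell_weight :: "real \<Rightarrow> 'a::euclidean_space \<Rightarrow> ennreal"
  where "shell_weight \<alpha> \<eta> =
    ennreal (norm \<eta> powr - (real DIM('a) + \<alpha>)) * indicator {1..2} (norm \<eta>)"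

lemma shell_weight_measurable [measurable]: "shell_weight \<alpha> \<in> borel_measurable borel"
  unfolding shell_weight_def by measurable

text \<open>
  A substitute for polar coordinates that avoids the surface measure of the sphere: whatever its
  direction, a ray meets the shell \<open>1 \<le> norm \<eta> \<le> 2\<close> in a segment of logarithmic length \<open>ln 2\<close>. Substituting
  \<open>\<xi> = s *\<^sub>R \<eta>\<close> for fixed \<open>s\<close> and exchanging the integrals, every point \<open>\<xi>\<close> is counted with the total weight
  \<open>\<integral>s. 1 / s\<close> over \<open>norm \<xi> / 2 \<le> s \<le> norm \<xi>\<close>.
\<close>

lemma radial_average:
  fixes g :: "'a::euclidean_space \<Rightarrow> real"
  assumes [measurable]: "g \<in> borel_measurable borel" and g: "\<And>\<xi>. 0 \<le> g \<xi>"
  shows "ennreal (ln 2) * (\<integral>\<^sup>+\<xi>. ennreal (g \<xi> / norm \<xi> powr (real DIM('a) + \<alpha>)) \<partial>lborel) =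
    (\<integral>\<^sup>+\<eta>. shell_weight \<alpha> \<eta> *
      (\<integral>\<^sup>+s\<in>{0<..}. ennreal (g (s *\<^sub>R \<eta>) * s powr (- 1 - \<alpha>)) \<partial>lborel) \<partial>lborel)"
proof -
  let ?d = "real DIM('a)"
  let ?G = "\<lambda>\<xi>. ennreal (g \<xi> / norm \<xi> powr (?d + \<alpha>))"
  have "(\<integral>\<^sup>+\<eta>. shell_weight \<alpha> \<eta> *
      (\<integral>\<^sup>+s\<in>{0<..}. ennreal (g (s *\<^sub>R \<eta>) * s powr (- 1 - \<alpha>)) \<partial>lborel) \<partial>(lborel::'a measure)) =
    (\<integral>\<^sup>+\<eta>. (\<integral>\<^sup>+s. shell_weight \<alpha> \<eta> *
      (ennreal (g (s *\<^sub>R \<eta>) * s powr (- 1 - \<alpha>)) * indicator {0<..} s) \<partial>lborel) \<partial>(lborel::'a measure))"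
    by (intro nn_integral_cong nn_integral_cmult[symmetric]) measurable
  also have "\<dots> = (\<integral>\<^sup>+s. (\<integral>\<^sup>+\<eta>. shell_weight \<alpha> \<eta> *
      (ennreal (g (s *\<^sub>R \<eta>) * s powr (- 1 - \<alpha>)) * indicator {0<..} s) \<partial>(lborel::'a measure)) \<partial>lborel)"
    by (rule lborel_pair.Fubini') measurable
  also have "\<dots> = (\<integral>\<^sup>+s. (\<integral>\<^sup>+\<xi>. ?G \<xi> * (ennreal (1 / s) * indicator {1..2} (norm \<xi> / s) * indicator {0<..} s) \<partial>lborel) \<partial>lborel)"
  proof (rule nn_integral_cong)
    fix s :: real
    show "(\<integral>\<^sup>+\<eta>. shell_weight \<alpha> \<eta> *
        (ennreal (g (s *\<^sub>R \<eta>) * s powr (- 1 - \<alpha>)) * indicator {0<..} s) \<partial>(lborel::'a measure)) =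
      (\<integral>\<^sup>+\<xi>. ?G \<xi> * (ennreal (1 / s) * indicator {1..2} (norm \<xi> / s) * indicator {0<..} s) \<partial>lborel)"
    proof (cases "0 < s")
      case True
      have "(\<integral>\<^sup>+\<xi>. ?G \<xi> * (ennreal (1 / s) * indicator {1..2} (norm \<xi> / s) * indicator {0<..} s) \<partial>lborel)
        = ennreal (s ^ DIM('a)) * (\<integral>\<^sup>+\<eta>. ?G (s *\<^sub>R \<eta>) * (ennreal (1 / s) * 
            indicator {1..2} (norm (s *\<^sub>R \<eta>) / s) * indicator {0<..} s) \<partial>(lborel::'a measure))"
        using True by (intro nn_integral_scaleR_lborel) measurable
      also have "\<dots> = (\<integral>\<^sup>+\<eta>. ennreal (s ^ DIM('a)) * (?G (s *\<^sub>R \<eta>) * (ennreal (1 / s) * 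
            indicator {1..2} (norm (s *\<^sub>R \<eta>) / s) * indicator {0<..} s)) \<partial>(lborel::'a measure))"
        by (intro nn_integral_cmult[symmetric]) measurable
      also have "\<dots> = (\<integral>\<^sup>+\<eta>. shell_weight \<alpha> \<eta> *
        (ennreal (g (s *\<^sub>R \<eta>) * s powr (- 1 - \<alpha>)) * indicator {0<..} s) \<partial>(lborel::'a measure))"
      proof (rule nn_integral_cong)
        fix \<eta> :: 'a
        have mem: "norm (s *\<^sub>R \<eta>) / s = norm \<eta>"
          using True by auto
        have "s ^ DIM('a) * (g (s *\<^sub>R \<eta>) / norm (s *\<^sub>R \<eta>) powr (?d + \<alpha>) * (1 / s)) =
          norm \<eta> powr - (?d + \<alpha>) * (g (s *\<^sub>R \<eta>) * s powr (- 1 - \<alpha>))" if "norm \<eta> \<in> {1..2}"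
          using True that
          by (simp add: powr_mult powr_minus powr_add powr_diff powr_realpow field_simps)
        then show "ennreal (s ^ DIM('a)) * (?G (s *\<^sub>R \<eta>) * (ennreal (1 / s) * 
            indicator {1..2} (norm (s *\<^sub>R \<eta>) / s) * indicator {0<..} s)) =
          shell_weight \<alpha> \<eta> * (ennreal (g (s *\<^sub>R \<eta>) * s powr (- 1 - \<alpha>)) * indicator {0<..} s)"
          using True g unfolding shell_weight_def indicator_def mem
          by (auto simp: ennreal_mult[symmetric])
      qed
      finally show ?thesis by simp
    qed simp
  qed
  also have "\<dots> = (\<integral>\<^sup>+\<xi>. (\<integral>\<^sup>+s. ?G \<xi> * (ennreal (1 / s) * indicator {1..2} (norm \<xi> / s) * indicator {0<..} s) \<partial>lborel) \<partial>lborel)"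
    by (rule lborel_pair.Fubini') measurable
  also have "\<dots> = (\<integral>\<^sup>+\<xi>. ennreal (ln 2) * ?G \<xi> \<partial>lborel)"
  proof (rule nn_integral_cong)
    fix \<xi> :: 'a
    show "(\<integral>\<^sup>+s. ?G \<xi> * (ennreal (1 / s) * indicator {1..2} (norm \<xi> / s) * indicator {0<..} s) \<partial>lborel) =
       ennreal (ln 2) * ?G \<xi>"
    proof (cases "\<xi> = 0")
      case False
      have "(\<integral>\<^sup>+s. ?G \<xi> * (ennreal (1 / s) * indicator {1..2} (norm \<xi> / s) * indicator {0<..} s) \<partial>lborel)
        = (\<integral>\<^sup>+s. ?G \<xi> * (ennreal (1 / s) * indicator {norm \<xi> / 2..norm \<xi>} s) \<partial>lborel)"
      proof (intro nn_integral_cong arg_cong[where f="\<lambda>x. ?G \<xi> * x"])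
        fix s :: real
        have "0 < norm \<xi>" using False by simp
        then show "ennreal (1 / s) * indicator {1..2} (norm \<xi> / s) * indicator {0<..} s =
            ennreal (1 / s) * indicator {norm \<xi> / 2..norm \<xi>} s"
          by (auto simp: indicator_def field_simps simp del: zero_less_norm_iff)
      qed
      also have "\<dots> = ?G \<xi> * ennreal (ln 2)"
        using False by (subst nn_integral_cmult) (simp_all add: nn_integral_inverse_dyadic)
      finally show ?thesis by (simp add: mult.commute)
    qed simp
  qed
  also have "\<dots> = ennreal (ln 2) * (\<integral>\<^sup>+\<xi>. ?G \<xi> \<partial>lborel)"
    by (rule nn_integral_cmult) measurable
  finally show ?thesis by simp
qed

text \<open>
  By rotation invariance this is a multiple of \<open>norm v powr \<alpha>\<close>; the two bounds below are all that is
  required of it and need no rotations.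
\<close>

definition shell_moment :: "real \<Rightarrow> 'a::euclidean_space \<Rightarrow> ennreal"
  where "shell_moment \<alpha> v = (\<integral>\<^sup>+\<eta>. shell_weight \<alpha> \<eta> * ennreal (\<bar>\<eta> \<bullet> v\<bar> powr \<alpha>) \<partial>lborel)"

lemma shell_moment_le:
  assumes "0 < \<alpha>"
  shows "shell_moment \<alpha> (v::'a::euclidean_space) \<le>
    ennreal (2 powr \<alpha> * measure lborel (cball (0::'a) 2)) * ennreal (norm v powr \<alpha>)"
proof -
  have "shell_moment \<alpha> v \<le> (\<integral>\<^sup>+\<eta>. ennreal (2 powr \<alpha> * norm v powr \<alpha>) * indicator (cball (0::'a) 2) \<eta> \<partial>lborel)"
    unfolding shell_moment_def
  proof (rule nn_integral_mono)
    fix \<eta> :: 'a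
    show "shell_weight \<alpha> \<eta> * ennreal (\<bar>\<eta> \<bullet> v\<bar> powr \<alpha>) \<le>
      ennreal (2 powr \<alpha> * norm v powr \<alpha>) * indicator (cball (0::'a) 2) \<eta>"
    proof (cases "norm \<eta> \<in> {1..2}")
      case True
      have "\<bar>\<eta> \<bullet> v\<bar> \<le> norm \<eta> * norm v" by (rule Cauchy_Schwarz_ineq2)
      also have "\<dots> \<le> 2 * norm v" using True by (intro mult_right_mono) auto
      finally have "\<bar>\<eta> \<bullet> v\<bar> powr \<alpha> \<le> (2 * norm v) powr \<alpha>"
        using assms by (intro powr_mono2) auto
      also have "\<dots> = 2 powr \<alpha> * norm v powr \<alpha>" by (simp add: powr_mult)
      finally have "norm \<eta> powr - (real DIM('a) + \<alpha>) * \<bar>\<eta> \<bullet> v\<bar> powr \<alpha> \<le> 1 * (2 powr \<alpha> * norm v powr \<alpha>)"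
        using True assms powr_mono[of "- (real DIM('a) + \<alpha>)" 0 "norm \<eta>"]
        by (intro mult_mono) (auto split: if_splits)
      then show ?thesis
        using True by (simp add: shell_weight_def ennreal_mult[symmetric] ennreal_leI)
    qed (simp add: shell_weight_def)
  qed
  also have "\<dots> = ennreal (2 powr \<alpha> * norm v powr \<alpha>) * emeasure lborel (cball (0::'a) 2)"
    by (rule nn_integral_cmult_indicator) simp
  also have "emeasure lborel (cball (0::'a) 2) = ennreal (measure lborel (cball (0::'a) 2))"
    using emeasure_lborel_cball_finite[of "0::'a" 2]
    by (intro emeasure_eq_ennreal_measure) simp
  finally show ?thesis
    by (simp add: ennreal_mult[symmetric] mult_ac)
qed

text \<open>
  The ball of radius \<open>1 / 2\<close> about the point at distance \<open>3 / 2\<close> in the direction of \<open>v\<close> lies in the shell, and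
  its points \<open>\<eta>\<close> satisfy \<open>\<eta> \<bullet> v \<ge> norm v\<close>.
\<close>

lemma shell_moment_ge:
  assumes "0 < \<alpha>"
  shows "ennreal (2 powr - (real DIM('a) + \<alpha>) * measure lborel (ball (0::'a) (1 / 2))) * ennreal (norm v powr \<alpha>)
    \<le> shell_moment \<alpha> (v::'a::euclidean_space)"
proof (cases "v = 0")
  case False
  define B where "B = ball ((3 / 2 / norm v) *\<^sub>R v) (1 / 2 :: real)"
  have em: "emeasure lborel B = ennreal (measure lborel (ball (0::'a) (1 / 2)))"
  proof -
    have "emeasure lborel B = emeasure lborel (ball (0::'a) (1 / 2))"
      by (simp add: B_def emeasure_ball)
    also have "\<dots> = ennreal (measure lborel (ball (0::'a) (1 / 2)))"
      using emeasure_lborel_ball_finite[of "0::'a" "1 / 2"]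
      by (intro emeasure_eq_ennreal_measure) simp
    finally show ?thesis .
  qed
  have "ennreal (2 powr - (real DIM('a) + \<alpha>) * measure lborel (ball (0::'a) (1 / 2))) * ennreal (norm v powr \<alpha>)
     = ennreal (2 powr - (real DIM('a) + \<alpha>) * norm v powr \<alpha>) * emeasure lborel B"
    unfolding em by (simp add: ennreal_mult[symmetric] mult_ac)
  also have "\<dots> = (\<integral>\<^sup>+\<eta>. ennreal (2 powr - (real DIM('a) + \<alpha>) * norm v powr \<alpha>) * indicator B \<eta> \<partial>lborel)"
    by (rule nn_integral_cmult_indicator[symmetric]) (simp add: B_def)
  also have "\<dots> \<le> shell_moment \<alpha> v"
    unfolding shell_moment_def
  proof (rule nn_integral_mono)
    fix \<eta> :: 'a
    show "ennreal (2 powr - (real DIM('a) + \<alpha>) * norm v powr \<alpha>) * indicator B \<eta> \<le>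
      shell_weight \<alpha> \<eta> * ennreal (\<bar>\<eta> \<bullet> v\<bar> powr \<alpha>)"
    proof (cases "\<eta> \<in> B")
      case True
      define c where "c = (3 / 2 / norm v) *\<^sub>R v"
      have d: "norm (\<eta> - c) < 1 / 2" using True by (simp add: B_def c_def dist_norm norm_minus_commute)
      have nc: "norm c = 3 / 2" using False by (simp add: c_def)
      have n: "1 \<le> norm \<eta>" "norm \<eta> \<le> 2"
        using d nc norm_triangle_ineq2[of c \<eta>] norm_triangle_ineq2[of \<eta> c] by (auto simp: norm_minus_commute)
      have "\<bar>(\<eta> - c) \<bullet> v\<bar> \<le> norm (\<eta> - c) * norm v" by (rule Cauchy_Schwarz_ineq2)
      also have "\<dots> \<le> 1 / 2 * norm v" using d by (intro mult_right_mono) auto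
      finally have "\<bar>\<eta> \<bullet> v - 3 / 2 * norm v\<bar> \<le> 1 / 2 * norm v"
        using False by (simp add: inner_diff_left c_def dot_square_norm power2_eq_square)
      then have "norm v \<le> \<eta> \<bullet> v" by linarith
      then have "norm v powr \<alpha> \<le> \<bar>\<eta> \<bullet> v\<bar> powr \<alpha>" using assms by (intro powr_mono2) auto
      moreover have "2 powr - (real DIM('a) + \<alpha>) \<le> norm \<eta> powr - (real DIM('a) + \<alpha>)"
        using n assms by (intro powr_mono2') auto
      ultimately show ?thesis
        using True n by (simp add: shell_weight_def ennreal_mult[symmetric] ennreal_leI mult_mono)
    qed simp
  qed
  finally show ?thesis .
qed simp

section \<open>Fourier transforms and their differences\<close>

lemma prob_measuresD:
  assumes "\<mu> \<in> prob_measures"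
  shows "prob_space \<mu>" "sets \<mu> = sets borel" "space \<mu> = UNIV"
proof -
  show "prob_space \<mu>" and s: "sets \<mu> = sets borel"
    using assms by (auto simp: prob_measures_def)
  show "space \<mu> = UNIV" using sets_eq_imp_space_eq[OF s] by simp
qed

lemma prob_integrable_bounded:
  fixes f :: "'a::euclidean_space \<Rightarrow> 'b::{banach, second_countable_topology}"
  assumes "\<mu> \<in> prob_measures" "f \<in> borel_measurable borel" "\<And>v. norm (f v) \<le> B"
  shows "integrable \<mu> f"
proof -
  interpret prob_space \<mu> using assms(1) by (rule prob_measuresD)
  show ?thesis
    using assms prob_measuresD(2)[OF assms(1)]
    by (intro integrable_const_bound[of _ B]) (auto cong: measurable_cong_sets)
qed

lemma integrable_fourier_kernel:
  assumes "\<mu> \<in> prob_measures"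
  shows "integrable \<mu> (\<lambda>v. exp (- \<i> * complex_of_real (\<xi> \<bullet> v)))"
  using assms by (rule prob_integrable_bounded[where B=1]) (auto simp: norm_exp_eq_Re)

lemma Re_fourier:
  assumes "\<mu> \<in> prob_measures"
  shows "Re (fourier \<mu> \<xi>) = (\<integral>v. cos (\<xi> \<bullet> v) \<partial>\<mu>)"
proof -
  have "Re (fourier \<mu> \<xi>) = (\<integral>v. Re (exp (- \<i> * complex_of_real (\<xi> \<bullet> v))) \<partial>\<mu>)"
    unfolding fourier_def by (rule integral_Re[symmetric]) (rule integrable_fourier_kernel[OF assms])
  then show ?thesis by (simp add: Re_exp)
qed

lemma Im_fourier:
  assumes "\<mu> \<in> prob_measures"
  shows "Im (fourier \<mu> \<xi>) = - (\<integral>v. sin (\<xi> \<bullet> v) \<partial>\<mu>)"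
proof -
  have "Im (fourier \<mu> \<xi>) = (\<integral>v. Im (exp (- \<i> * complex_of_real (\<xi> \<bullet> v))) \<partial>\<mu>)"
    unfolding fourier_def by (rule integral_Im[symmetric]) (rule integrable_fourier_kernel[OF assms])
  then show ?thesis by (simp add: Im_exp)
qed

lemma fourier_0: "\<mu> \<in> prob_measures \<Longrightarrow> fourier \<mu> 0 = 1"
  using prob_measuresD(1)[of \<mu>] by (simp add: fourier_def prob_space.prob_space)

lemma norm_fourier_le_1:
  assumes "\<mu> \<in> prob_measures"
  shows "norm (fourier \<mu> \<xi>) \<le> 1"
proof -
  interpret prob_space \<mu> using assms by (rule prob_measuresD)
  have "norm (fourier \<mu> \<xi>) \<le> (\<integral>v. norm (exp (- \<i> * complex_of_real (\<xi> \<bullet> v))) \<partial>\<mu>)"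
    unfolding fourier_def by (rule integral_norm_bound)
  also have "\<dots> = 1" by (simp add: norm_exp_eq_Re prob_space)
  finally show ?thesis .
qed

lemma fourier_measurable [measurable]:
  assumes "\<mu> \<in> prob_measures"
  shows "fourier \<mu> \<in> borel_measurable borel"
proof -
  interpret prob_space \<mu> using assms by (rule prob_measuresD)
  have [measurable_cong]: "sets \<mu> = sets borel" using assms by (rule prob_measuresD)
  show ?thesis unfolding fourier_def by measurable
qed

lemma fin_diff_measurable [measurable]:
  fixes \<phi> :: "'a::euclidean_space \<Rightarrow> 'b::{real_normed_field, second_countable_topology}"
  assumes [measurable]: "\<phi> \<in> borel_measurable borel"
  shows "fin_diff k \<phi> \<in> borel_measurable borel"
  unfolding fin_diff_def by measurable

definition cos_diff :: "nat \<Rightarrow> real \<Rightarrow> real"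
  where "cos_diff k u = fin_diff k (\<lambda>m. cos (m * u)) 1"

lemma cos_diff_measurable [measurable]: "cos_diff k \<in> borel_measurable borel"
  unfolding cos_diff_def fin_diff_def by measurable

lemma abs_cos_diff_le: "\<bar>cos_diff k u\<bar> \<le> (\<Sum>m=0..k. real (k choose m))"
proof -
  have "\<bar>cos_diff k u\<bar> \<le> (\<Sum>m=0..k. \<bar>real (k choose m) * (- 1) ^ (k - m) * cos (real m * u)\<bar>)"
    unfolding cos_diff_def fin_diff_def by (simp add: sum_abs)
  also have "\<dots> \<le> (\<Sum>m=0..k. real (k choose m))"
    by (intro sum_mono) (auto simp: abs_mult intro!: mult_left_le)
  finally show ?thesis .
qed

lemma fin_diff_Re_fourier:
  assumes "\<mu> \<in> prob_measures"
  shows "fin_diff k (\<lambda>\<xi>. Re (fourier \<mu> \<xi>)) \<xi> = (\<integral>v. cos_diff k (\<xi> \<bullet> v) \<partial>\<mu>)"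
proof -
  have i: "integrable \<mu> (\<lambda>v. real (k choose m) * (- 1) ^ (k - m) * cos (real m * (\<xi> \<bullet> v)))" for m
    by (intro integrable_mult_right prob_integrable_bounded[OF assms, where B=1]) auto
  show ?thesis
    unfolding fin_diff_def cos_diff_def
    by (simp add: Re_fourier[OF assms] Bochner_Integration.integral_sum[OF i])
qed

lemma fin_diff_fourier:
  assumes "\<mu> \<in> prob_measures"
  shows "fin_diff k (fourier \<mu>) \<xi> = (CLINT v|\<mu>. (exp (- \<i> * complex_of_real (\<xi> \<bullet> v)) - 1) ^ k)"
proof -
  have i: "integrable \<mu> (\<lambda>v. of_nat (k choose m) * (- 1) ^ (k - m) *
      exp (- \<i> * complex_of_real (real m *\<^sub>R \<xi> \<bullet> v)))" for m
    by (intro integrable_mult_right integrable_fourier_kernel assms)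
  have "(exp (- \<i> * complex_of_real (\<xi> \<bullet> v)) - 1) ^ k =
    (\<Sum>m=0..k. of_nat (k choose m) * (- 1) ^ (k - m) *
      exp (- \<i> * complex_of_real (real m *\<^sub>R \<xi> \<bullet> v)))" for v
  proof -
    have e: "exp (- \<i> * complex_of_real (real m *\<^sub>R \<xi> \<bullet> v)) = exp (- \<i> * complex_of_real (\<xi> \<bullet> v)) ^ m" for m
      by (simp add: exp_of_nat_mult[symmetric] algebra_simps)
    show ?thesis
      unfolding e diff_conv_add_uminus by (subst binomial_ring) (simp add: atMost_atLeast0 mult_ac)
  qed
  then have "(CLINT v|\<mu>. (exp (- \<i> * complex_of_real (\<xi> \<bullet> v)) - 1) ^ k) =
    (CLINT v|\<mu>. (\<Sum>m=0..k. of_nat (k choose m) * (- 1) ^ (k - m) *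
      exp (- \<i> * complex_of_real (real m *\<^sub>R \<xi> \<bullet> v))))" by simp
  also have "\<dots> = fin_diff k (fourier \<mu>) \<xi>"
    unfolding fin_diff_def fourier_def
    by (subst Bochner_Integration.integral_sum[OF i]) simp
  finally show ?thesis by simp
qed

text \<open>
  The constant in \<open>cos_diff_integral\<close>. For the admissible \<open>p\<close> the middle factor is the only one that can vanish.
\<close>

definition cos_diff_const :: "nat \<Rightarrow> nat \<Rightarrow> real \<Rightarrow> real"
  where "cos_diff_const k p \<alpha> = (- 1) ^ p * fin_diff k (\<lambda>m. m powr \<alpha>) 1 * cos_rem_const p \<alpha>"

text \<open>
  By \<open>fin_diff_cos\<close> the integrand is a linear combination of remainders \<open>cos_rem p (s * (m * x))\<close>, each of
  which is absolutely integrable and homogeneous of degree \<open>\<alpha>\<close> in \<open>m * x\<close>.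
\<close>

lemma cos_diff_integral:
  assumes p: "0 < p" and \<alpha>: "0 < \<alpha>" "2 * (real p - 1) < \<alpha>" "\<alpha> < 2 * real p" and k: "\<And>i. i < p \<Longrightarrow> 2 * i < k"
  shows "has_bochner_integral lborel (\<lambda>s. indicator {0<..} s *\<^sub>R (cos_diff k (s * x) * s powr (- 1 - \<alpha>)))
      (cos_diff_const k p \<alpha> * \<bar>x\<bar> powr \<alpha>)"
proof -
  let ?b = "\<lambda>m. (- 1) ^ p * (real (k choose m) * (- 1) ^ (k - m))"
  have t: "has_bochner_integral lborel (\<lambda>s. indicator {0<..} s *\<^sub>R (cos_rem p (s * y) * s powr (- 1 - \<alpha>)))
      (\<bar>y\<bar> powr \<alpha> * cos_rem_const p \<alpha>)" for y
  proof (rule has_bochner_integral_nn_integral)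
    have "(\<integral>\<^sup>+s. ennreal (indicator {0<..} s *\<^sub>R (cos_rem p (s * y) * s powr (- 1 - \<alpha>))) \<partial>lborel) =
       (\<integral>\<^sup>+s\<in>{0<..}. ennreal (cos_rem p (s * y) * s powr (- 1 - \<alpha>)) \<partial>lborel)"
      by (intro nn_integral_cong) (simp add: indicator_def)
    then show "(\<integral>\<^sup>+s. ennreal (indicator {0<..} s *\<^sub>R (cos_rem p (s * y) * s powr (- 1 - \<alpha>))) \<partial>lborel) =
       ennreal (\<bar>y\<bar> powr \<alpha> * cos_rem_const p \<alpha>)"
      by (simp add: cos_rem_integral_scale[OF p \<alpha>(2,3)])
    show "0 \<le> \<bar>y\<bar> powr \<alpha> * cos_rem_const p \<alpha>"
      using cos_rem_integral(2)[OF p \<alpha>(2,3)] by simp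
  qed (auto simp: cos_rem_nonneg[OF p])
  have "has_bochner_integral lborel
      (\<lambda>s. \<Sum>m=0..k. ?b m * (indicator {0<..} s *\<^sub>R (cos_rem p (s * (real m * x)) * s powr (- 1 - \<alpha>))))
      (\<Sum>m=0..k. ?b m * (\<bar>real m * x\<bar> powr \<alpha> * cos_rem_const p \<alpha>))"
    by (intro has_bochner_integral_sum has_bochner_integral_mult_right t)
  also have "(\<lambda>s. \<Sum>m=0..k. ?b m * (indicator {0<..} s *\<^sub>R (cos_rem p (s * (real m * x)) * s powr (- 1 - \<alpha>)))) =
      (\<lambda>s. indicator {0<..} s *\<^sub>R (cos_diff k (s * x) * s powr (- 1 - \<alpha>)))"
  proof -
    have "cos_diff k u = (- 1) ^ p * fin_diff k (\<lambda>m. cos_rem p (m * u)) 1" for u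
      unfolding cos_diff_def by (rule fin_diff_cos) (rule k)
    then show ?thesis
      unfolding fin_diff_def by (simp add: sum_distrib_left sum_distrib_right mult_ac)
  qed
  also have "(\<Sum>m=0..k. ?b m * (\<bar>real m * x\<bar> powr \<alpha> * cos_rem_const p \<alpha>)) = cos_diff_const k p \<alpha> * \<bar>x\<bar> powr \<alpha>"
    unfolding cos_diff_const_def fin_diff_def
    by (simp add: sum_distrib_left sum_distrib_right abs_mult powr_mult mult_ac)
  finally show ?thesis .
qed

lemma cos_diff_abs_integral:
  assumes p: "0 < p" and \<alpha>: "0 < \<alpha>" "2 * (real p - 1) < \<alpha>" "\<alpha> < 2 * real p" and k: "\<And>i. i < p \<Longrightarrow> 2 * i < k"
  shows "\<exists>C\<ge>0. \<forall>x. (\<integral>\<^sup>+s\<in>{0<..}. ennreal (\<bar>cos_diff k (s * x)\<bar> * s powr (- 1 - \<alpha>)) \<partial>lborel) \<le>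
      ennreal (C * \<bar>x\<bar> powr \<alpha>)"
proof -
  define C where "C = enn2real (\<integral>\<^sup>+s\<in>{0<..}. ennreal (\<bar>cos_diff k s\<bar> * s powr (- 1 - \<alpha>)) \<partial>lborel)"
  have "integrable lborel (\<lambda>s. indicator {0<..} s *\<^sub>R (cos_diff k (s * 1) * s powr (- 1 - \<alpha>)))"
    using cos_diff_integral[OF assms, of 1] by (simp add: has_bochner_integral_iff)
  then have "(\<integral>\<^sup>+s. ennreal (norm (indicator {0<..} s *\<^sub>R (cos_diff k (s * 1) * s powr (- 1 - \<alpha>)))) \<partial>lborel) < \<infinity>"
    by (simp add: integrable_iff_bounded)
  also have "(\<integral>\<^sup>+s. ennreal (norm (indicator {0<..} s *\<^sub>R (cos_diff k (s * 1) * s powr (- 1 - \<alpha>)))) \<partial>lborel)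
     = (\<integral>\<^sup>+s\<in>{0<..}. ennreal (\<bar>cos_diff k s\<bar> * s powr (- 1 - \<alpha>)) \<partial>lborel)"
    by (intro nn_integral_cong) (simp add: indicator_def abs_mult)
  finally have C: "(\<integral>\<^sup>+s\<in>{0<..}. ennreal (\<bar>cos_diff k s\<bar> * s powr (- 1 - \<alpha>)) \<partial>lborel) = ennreal C"
    by (simp add: C_def)
  have even: "\<bar>cos_diff k (s * x)\<bar> = \<bar>cos_diff k (s * \<bar>x\<bar>)\<bar>" for s x
  proof -
    have "cos (m * (s * x)) = cos (m * (s * \<bar>x\<bar>))" for m by (cases "0 \<le> x") auto
    then show ?thesis by (simp add: cos_diff_def)
  qed
  have z: "cos_diff k 0 = 0"
    using k[OF p] fin_diff_power_zero[of 0 k] by (simp add: cos_diff_def)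
  have "(\<integral>\<^sup>+s\<in>{0<..}. ennreal (\<bar>cos_diff k (s * x)\<bar> * s powr (- 1 - \<alpha>)) \<partial>lborel) =
      ennreal (C * \<bar>x\<bar> powr \<alpha>)" for x
  proof (cases "x = 0")
    case False
    then have "(\<integral>\<^sup>+s\<in>{0<..}. ennreal (\<bar>cos_diff k (s * x)\<bar> * s powr (- 1 - \<alpha>)) \<partial>lborel) =
        ennreal (\<bar>x\<bar> powr \<alpha>) * ennreal C"
      unfolding even[of _ x] C[symmetric] by (intro nn_integral_scale_kernel) auto
    also have "\<dots> = ennreal (C * \<bar>x\<bar> powr \<alpha>)"
      by (simp add: ennreal_mult[symmetric] mult.commute C_def)
    finally show ?thesis .
  qed (simp add: z)
  then show ?thesis by (intro exI[of _ C]) (simp add: C_def)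
qed

section \<open>Difference norms and moments\<close>

definition moment :: "real \<Rightarrow> 'a::euclidean_space measure \<Rightarrow> ennreal"
  where "moment \<alpha> \<mu> = (\<integral>\<^sup>+v. ennreal (norm v powr \<alpha>) \<partial>\<mu>)"

lemma prob_measures_momentD:
  assumes "\<mu> \<in> prob_measures_moment \<alpha>"
  shows "\<mu> \<in> prob_measures" "moment \<alpha> \<mu> < \<infinity>"
  using assms by (auto simp: prob_measures_moment_def moment_def)

lemma pair_sigma_finite_lborel_prob:
  assumes "\<mu> \<in> prob_measures"
  shows "pair_sigma_finite lborel \<mu>"
proof -
  interpret prob_space \<mu> using assms by (rule prob_measuresD)
  show ?thesis by unfold_locales
qed

lemma Fubini_lborel_prob:
  fixes f :: "'a::euclidean_space \<Rightarrow> 'b::euclidean_space \<Rightarrow> ennreal"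
  assumes "\<mu> \<in> prob_measures" "case_prod f \<in> borel_measurable (borel \<Otimes>\<^sub>M borel)"
  shows "(\<integral>\<^sup>+x. (\<integral>\<^sup>+v. f x v \<partial>\<mu>) \<partial>lborel) = (\<integral>\<^sup>+v. (\<integral>\<^sup>+x. f x v \<partial>lborel) \<partial>\<mu>)"
proof -
  interpret pair_sigma_finite lborel \<mu> using assms(1) by (rule pair_sigma_finite_lborel_prob)
  have [measurable_cong]: "sets \<mu> = sets borel" using assms(1) by (rule prob_measuresD)
  have "sets (lborel \<Otimes>\<^sub>M \<mu>) = sets (borel \<Otimes>\<^sub>M borel)"
    by (intro sets_pair_measure_cong) (simp_all add: prob_measuresD(2)[OF assms(1)])
  then have "case_prod f \<in> borel_measurable (lborel \<Otimes>\<^sub>M \<mu>)"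
    using assms(2) by (simp cong: measurable_cong_sets)
  then show ?thesis by (rule Fubini'[symmetric])
qed

text \<open>
  Along a ray, Fubini and the homogeneous bound on \<open>h\<close> leave the moment of \<open>\<eta> \<bullet> v\<close>; integrating over the shell
  gives a multiple of \<open>moment \<alpha> \<mu>\<close>. The function \<open>h\<close> will be \<open>\<bar>cos_diff k u\<bar>\<close> for real parts and \<open>min 2 \<bar>u\<bar> ^ k\<close> for the
  complex transform.
\<close>

lemma diff_norm_finite:
  fixes \<mu> :: "'a::euclidean_space measure"
    and \<phi> :: "'a \<Rightarrow> 'b::{real_normed_field, second_countable_topology}"
  assumes \<alpha>: "0 < \<alpha>" and \<mu>: "\<mu> \<in> prob_measures_moment \<alpha>"
    and h[measurable]: "h \<in> borel_measurable borel" and h0: "\<And>u. 0 \<le> h u"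
    and C: "0 \<le> C" "\<And>x. (\<integral>\<^sup>+s\<in>{0<..}. ennreal (h (s * x) * s powr (- 1 - \<alpha>)) \<partial>lborel) \<le> ennreal (C * \<bar>x\<bar> powr \<alpha>)"
    and \<phi>[measurable]: "\<phi> \<in> borel_measurable borel"
    and le: "\<And>\<xi>. ennreal (norm (fin_diff k \<phi> \<xi>)) \<le> (\<integral>\<^sup>+v. ennreal (h (\<xi> \<bullet> v)) \<partial>\<mu>)"
  shows "diff_norm \<alpha> k \<phi> < \<infinity>"
proof -
  have P: "\<mu> \<in> prob_measures" using \<mu> by (rule prob_measures_momentD)
  have [measurable_cong]: "sets \<mu> = sets borel" using P by (rule prob_measuresD)
  let ?c = "2 powr \<alpha> * measure lborel (cball (0::'a) 2)"
  have "ennreal (ln 2) * diff_norm \<alpha> k \<phi> = (\<integral>\<^sup>+\<eta>. shell_weight \<alpha> \<eta> *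
      (\<integral>\<^sup>+s\<in>{0<..}. ennreal (norm (fin_diff k \<phi> (s *\<^sub>R \<eta>)) * s powr (- 1 - \<alpha>)) \<partial>lborel) \<partial>lborel)"
    unfolding diff_norm_def by (rule radial_average) auto
  also have "\<dots> \<le> (\<integral>\<^sup>+\<eta>. ennreal C * (\<integral>\<^sup>+v. shell_weight \<alpha> \<eta> * ennreal (\<bar>\<eta> \<bullet> v\<bar> powr \<alpha>) \<partial>\<mu>) \<partial>lborel)"
  proof (rule nn_integral_mono)
    fix \<eta> :: 'a
    have "(\<integral>\<^sup>+s\<in>{0<..}. ennreal (norm (fin_diff k \<phi> (s *\<^sub>R \<eta>)) * s powr (- 1 - \<alpha>)) \<partial>lborel) \<le>
      (\<integral>\<^sup>+s. (\<integral>\<^sup>+v. ennreal (h (s * (\<eta> \<bullet> v)) * s powr (- 1 - \<alpha>)) * indicator {0<..} s \<partial>\<mu>) \<partial>lborel)"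
    proof (rule nn_integral_mono)
      fix s :: real
      have "ennreal (norm (fin_diff k \<phi> (s *\<^sub>R \<eta>)) * s powr (- 1 - \<alpha>)) * indicator {0<..} s =
         ennreal (norm (fin_diff k \<phi> (s *\<^sub>R \<eta>))) * (ennreal (s powr (- 1 - \<alpha>)) * indicator {0<..} s)"
        by (simp add: ennreal_mult mult_ac)
      also have "\<dots> \<le> (\<integral>\<^sup>+v. ennreal (h ((s *\<^sub>R \<eta>) \<bullet> v)) \<partial>\<mu>) * (ennreal (s powr (- 1 - \<alpha>)) * indicator {0<..} s)"
        by (intro mult_right_mono le) simp
      also have "\<dots> = (\<integral>\<^sup>+v. ennreal (h ((s *\<^sub>R \<eta>) \<bullet> v)) * (ennreal (s powr (- 1 - \<alpha>)) * indicator {0<..} s) \<partial>\<mu>)"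
        by (rule nn_integral_multc[symmetric]) measurable
      also have "\<dots> = (\<integral>\<^sup>+v. ennreal (h (s * (\<eta> \<bullet> v)) * s powr (- 1 - \<alpha>)) * indicator {0<..} s \<partial>\<mu>)"
        by (simp add: ennreal_mult h0 mult_ac)
      finally show "ennreal (norm (fin_diff k \<phi> (s *\<^sub>R \<eta>)) * s powr (- 1 - \<alpha>)) * indicator {0<..} s \<le>
        (\<integral>\<^sup>+v. ennreal (h (s * (\<eta> \<bullet> v)) * s powr (- 1 - \<alpha>)) * indicator {0<..} s \<partial>\<mu>)" .
    qed
    also have "\<dots> = (\<integral>\<^sup>+v. (\<integral>\<^sup>+s\<in>{0<..}. ennreal (h (s * (\<eta> \<bullet> v)) * s powr (- 1 - \<alpha>)) \<partial>lborel) \<partial>\<mu>)"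
      by (rule Fubini_lborel_prob[OF P]) measurable
    also have "\<dots> \<le> (\<integral>\<^sup>+v. ennreal (C * \<bar>\<eta> \<bullet> v\<bar> powr \<alpha>) \<partial>\<mu>)"
      by (intro nn_integral_mono C)
    finally have "shell_weight \<alpha> \<eta> * (\<integral>\<^sup>+s\<in>{0<..}. ennreal (norm (fin_diff k \<phi> (s *\<^sub>R \<eta>)) * s powr (- 1 - \<alpha>)) \<partial>lborel)
        \<le> shell_weight \<alpha> \<eta> * (\<integral>\<^sup>+v. ennreal (C * \<bar>\<eta> \<bullet> v\<bar> powr \<alpha>) \<partial>\<mu>)"
      by (rule mult_left_mono) simp
    also have "\<dots> = ennreal C * (\<integral>\<^sup>+v. shell_weight \<alpha> \<eta> * ennreal (\<bar>\<eta> \<bullet> v\<bar> powr \<alpha>) \<partial>\<mu>)"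
      using C(1) by (simp add: ennreal_mult nn_integral_cmult mult_ac)
    finally show "shell_weight \<alpha> \<eta> * (\<integral>\<^sup>+s\<in>{0<..}. ennreal (norm (fin_diff k \<phi> (s *\<^sub>R \<eta>)) * s powr (- 1 - \<alpha>)) \<partial>lborel)
        \<le> ennreal C * (\<integral>\<^sup>+v. shell_weight \<alpha> \<eta> * ennreal (\<bar>\<eta> \<bullet> v\<bar> powr \<alpha>) \<partial>\<mu>)" .
  qed
  also have "\<dots> = ennreal C * (\<integral>\<^sup>+\<eta>. (\<integral>\<^sup>+v. shell_weight \<alpha> \<eta> * ennreal (\<bar>\<eta> \<bullet> v\<bar> powr \<alpha>) \<partial>\<mu>) \<partial>lborel)"
  proof (rule nn_integral_cmult)
    interpret prob_space \<mu> using P by (rule prob_measuresD)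
    show "(\<lambda>\<eta>. \<integral>\<^sup>+v. shell_weight \<alpha> \<eta> * ennreal (\<bar>\<eta> \<bullet> v\<bar> powr \<alpha>) \<partial>\<mu>) \<in> borel_measurable lborel"
      by measurable
  qed
  also have "(\<integral>\<^sup>+\<eta>. (\<integral>\<^sup>+v. shell_weight \<alpha> \<eta> * ennreal (\<bar>\<eta> \<bullet> v\<bar> powr \<alpha>) \<partial>\<mu>) \<partial>lborel) =
      (\<integral>\<^sup>+v. shell_moment \<alpha> v \<partial>\<mu>)"
    unfolding shell_moment_def by (rule Fubini_lborel_prob[OF P]) measurable
  also have "\<dots> \<le> (\<integral>\<^sup>+v. ennreal ?c * ennreal (norm v powr \<alpha>) \<partial>\<mu>)"
    by (intro nn_integral_mono shell_moment_le \<alpha>)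
  also have "\<dots> = ennreal ?c * moment \<alpha> \<mu>"
    unfolding moment_def by (rule nn_integral_cmult) measurable
  finally have "ennreal (ln 2) * diff_norm \<alpha> k \<phi> \<le> ennreal C * (ennreal ?c * moment \<alpha> \<mu>)"
    by (simp add: mult_left_mono)
  also have "\<dots> < \<infinity>"
    using prob_measures_momentD(2)[OF \<mu>] by (simp add: ennreal_mult_less_top)
  finally show ?thesis by (auto simp: ennreal_mult_less_top)
qed

text \<open>
  The integral along the ray through \<open>\<eta>\<close> recovers the moment of the projection \<open>\<eta> \<bullet> v\<close>. Fubini applies by
  \<open>cos_diff_abs_integral\<close>.
\<close>

lemma cos_diff_pairing:
  fixes \<mu> :: "'a::euclidean_space measure"
  assumes p: "0 < p" and \<alpha>: "0 < \<alpha>" "2 * (real p - 1) < \<alpha>" "\<alpha> < 2 * real p" and k: "\<And>i. i < p \<Longrightarrow> 2 * i < k"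
    and \<mu>: "\<mu> \<in> prob_measures_moment \<alpha>"
  shows "has_bochner_integral lborel
      (\<lambda>s. indicator {0<..} s *\<^sub>R (fin_diff k (\<lambda>\<xi>. Re (fourier \<mu> \<xi>)) (s *\<^sub>R \<eta>) * s powr (- 1 - \<alpha>)))
      (cos_diff_const k p \<alpha> * (\<integral>v. \<bar>\<eta> \<bullet> v\<bar> powr \<alpha> \<partial>\<mu>))"
    and "integrable \<mu> (\<lambda>v. \<bar>\<eta> \<bullet> v\<bar> powr \<alpha>)"
proof -
  have P: "\<mu> \<in> prob_measures" using \<mu> by (rule prob_measures_momentD)
  have [measurable_cong]: "sets \<mu> = sets borel" using P by (rule prob_measuresD)
  interpret pair_sigma_finite lborel \<mu> using P by (rule pair_sigma_finite_lborel_prob)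
  obtain C where C: "0 \<le> C" "\<And>x. (\<integral>\<^sup>+s\<in>{0<..}. ennreal (\<bar>cos_diff k (s * x)\<bar> * s powr (- 1 - \<alpha>)) \<partial>lborel) \<le>
      ennreal (C * \<bar>x\<bar> powr \<alpha>)"
    using cos_diff_abs_integral[OF p \<alpha> k] by blast
  let ?f = "\<lambda>(s, v). indicator {0<..} s *\<^sub>R (cos_diff k (s * (\<eta> \<bullet> v)) * s powr (- 1 - \<alpha>))"
  have fin: "(\<integral>\<^sup>+v. ennreal (\<bar>\<eta> \<bullet> v\<bar> powr \<alpha>) \<partial>\<mu>) < \<infinity>"
  proof -
    have "(\<integral>\<^sup>+v. ennreal (\<bar>\<eta> \<bullet> v\<bar> powr \<alpha>) \<partial>\<mu>) \<le> (\<integral>\<^sup>+v. ennreal (norm \<eta> powr \<alpha>) * ennreal (norm v powr \<alpha>) \<partial>\<mu>)"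
    proof (rule nn_integral_mono)
      fix v
      have "\<bar>\<eta> \<bullet> v\<bar> powr \<alpha> \<le> (norm \<eta> * norm v) powr \<alpha>"
        using \<alpha> by (intro powr_mono2 Cauchy_Schwarz_ineq2) auto
      then show "ennreal (\<bar>\<eta> \<bullet> v\<bar> powr \<alpha>) \<le> ennreal (norm \<eta> powr \<alpha>) * ennreal (norm v powr \<alpha>)"
        by (simp add: powr_mult ennreal_mult[symmetric] ennreal_leI)
    qed
    also have "\<dots> = ennreal (norm \<eta> powr \<alpha>) * moment \<alpha> \<mu>"
      unfolding moment_def by (rule nn_integral_cmult) measurable
    also have "\<dots> < \<infinity>"
      using prob_measures_momentD(2)[OF \<mu>] by (simp add: ennreal_mult_less_top)
    finally show ?thesis .
  qed
  show "integrable \<mu> (\<lambda>v. \<bar>\<eta> \<bullet> v\<bar> powr \<alpha>)"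
    using fin by (intro integrableI_bounded) auto
  have i: "integrable (lborel \<Otimes>\<^sub>M \<mu>) ?f"
  proof (rule integrableI_bounded)
    show "?f \<in> borel_measurable (lborel \<Otimes>\<^sub>M \<mu>)" by measurable
    have "(\<integral>\<^sup>+x. ennreal (norm (?f x)) \<partial>(lborel \<Otimes>\<^sub>M \<mu>)) =
       (\<integral>\<^sup>+v. (\<integral>\<^sup>+s. ennreal (norm (?f (s, v))) \<partial>lborel) \<partial>\<mu>)"
      by (rule nn_integral_snd[symmetric]) measurable
    also have "\<dots> \<le> (\<integral>\<^sup>+v. ennreal (C * \<bar>\<eta> \<bullet> v\<bar> powr \<alpha>) \<partial>\<mu>)"
    proof (rule nn_integral_mono)
      fix v
      have "(\<integral>\<^sup>+s. ennreal (norm (?f (s, v))) \<partial>lborel) =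
         (\<integral>\<^sup>+s\<in>{0<..}. ennreal (\<bar>cos_diff k (s * (\<eta> \<bullet> v))\<bar> * s powr (- 1 - \<alpha>)) \<partial>lborel)"
        by (intro nn_integral_cong) (simp add: indicator_def abs_mult)
      then show "(\<integral>\<^sup>+s. ennreal (norm (?f (s, v))) \<partial>lborel) \<le> ennreal (C * \<bar>\<eta> \<bullet> v\<bar> powr \<alpha>)"
        using C(2) by simp
    qed
    also have "\<dots> = ennreal C * (\<integral>\<^sup>+v. ennreal (\<bar>\<eta> \<bullet> v\<bar> powr \<alpha>) \<partial>\<mu>)"
      using C(1) by (simp add: ennreal_mult nn_integral_cmult)
    also have "\<dots> < \<infinity>" using fin by (simp add: ennreal_mult_less_top)
    finally show "(\<integral>\<^sup>+x. ennreal (norm (?f x)) \<partial>(lborel \<Otimes>\<^sub>M \<mu>)) < \<infinity>" .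
  qed
  have "has_bochner_integral lborel (\<lambda>s. \<integral>v. ?f (s, v) \<partial>\<mu>) (integral\<^sup>L (lborel \<Otimes>\<^sub>M \<mu>) ?f)"
    using integrable_fst'[OF i] integral_fst'[OF i] by (simp add: has_bochner_integral_iff)
  also have "(\<lambda>s. \<integral>v. ?f (s, v) \<partial>\<mu>) =
      (\<lambda>s. indicator {0<..} s *\<^sub>R (fin_diff k (\<lambda>\<xi>. Re (fourier \<mu> \<xi>)) (s *\<^sub>R \<eta>) * s powr (- 1 - \<alpha>)))"
    by (simp add: fin_diff_Re_fourier[OF P])
  also have "integral\<^sup>L (lborel \<Otimes>\<^sub>M \<mu>) ?f = (\<integral>v. (\<integral>s. ?f (s, v) \<partial>lborel) \<partial>\<mu>)"
    using integral_snd[of "\<lambda>s v. ?f (s, v)"] i by simp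
  also have "\<dots> = (\<integral>v. cos_diff_const k p \<alpha> * \<bar>\<eta> \<bullet> v\<bar> powr \<alpha> \<partial>\<mu>)"
    using cos_diff_integral[OF p \<alpha> k] by (simp add: has_bochner_integral_iff)
  also have "\<dots> = cos_diff_const k p \<alpha> * (\<integral>v. \<bar>\<eta> \<bullet> v\<bar> powr \<alpha> \<partial>\<mu>)" by simp
  finally show "has_bochner_integral lborel
      (\<lambda>s. indicator {0<..} s *\<^sub>R (fin_diff k (\<lambda>\<xi>. Re (fourier \<mu> \<xi>)) (s *\<^sub>R \<eta>) * s powr (- 1 - \<alpha>)))
      (cos_diff_const k p \<alpha> * (\<integral>v. \<bar>\<eta> \<bullet> v\<bar> powr \<alpha> \<partial>\<mu>))" .
qed

lemma fin_diff_diff: "fin_diff k (\<lambda>\<xi>. \<phi> \<xi> - \<psi> \<xi>) \<xi> = fin_diff k \<phi> \<xi> - fin_diff k \<psi> \<xi>"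
  by (simp add: fin_diff_def sum_subtractf right_diff_distrib)

lemma cos_diff_const_nonzero:
  assumes p: "0 < p" and \<alpha>: "0 < \<alpha>" "2 * (real p - 1) < \<alpha>" "\<alpha> < 2 * real p" and k: "0 < k"
    and nz: "\<And>i. i < k \<Longrightarrow> \<alpha> \<noteq> real i"
  shows "cos_diff_const k p \<alpha> \<noteq> 0"
  using fin_diff_powr_nonzero[OF \<alpha>(1) k nz] cos_rem_integral(2)[OF p \<alpha>(2,3)]
  by (simp add: cos_diff_const_def)

lemma shell_moment_bound:
  fixes \<mu> :: "'a::euclidean_space measure"
  assumes "0 < \<alpha>" and P: "\<mu> \<in> prob_measures"
  defines "S \<equiv> \<integral>\<^sup>+\<eta>. shell_weight \<alpha> \<eta> * (\<integral>\<^sup>+v. ennreal (\<bar>\<eta> \<bullet> v\<bar> powr \<alpha>) \<partial>\<mu>) \<partial>lborel"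
  shows "ennreal (2 powr - (real DIM('a) + \<alpha>) * measure lborel (ball (0::'a) (1 / 2))) * moment \<alpha> \<mu> \<le> S"
    and "S \<le> ennreal (2 powr \<alpha> * measure lborel (cball (0::'a) 2)) * moment \<alpha> \<mu>"
proof -
  have [measurable_cong]: "sets \<mu> = sets borel" using P by (rule prob_measuresD)
  have "S = (\<integral>\<^sup>+\<eta>. (\<integral>\<^sup>+v. shell_weight \<alpha> \<eta> * ennreal (\<bar>\<eta> \<bullet> v\<bar> powr \<alpha>) \<partial>\<mu>) \<partial>lborel)"
    unfolding S_def by (intro nn_integral_cong nn_integral_cmult[symmetric]) measurable
  also have "\<dots> = (\<integral>\<^sup>+v. shell_moment \<alpha> v \<partial>\<mu>)"
    unfolding shell_moment_def by (rule Fubini_lborel_prob[OF P]) measurable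
  finally have S: "S = (\<integral>\<^sup>+v. shell_moment \<alpha> v \<partial>\<mu>)" .
  have m: "ennreal c * moment \<alpha> \<mu> = (\<integral>\<^sup>+v. ennreal c * ennreal (norm v powr \<alpha>) \<partial>\<mu>)" for c
    unfolding moment_def by (rule nn_integral_cmult[symmetric]) measurable
  show "ennreal (2 powr - (real DIM('a) + \<alpha>) * measure lborel (ball (0::'a) (1 / 2))) * moment \<alpha> \<mu> \<le> S"
    unfolding S m by (intro nn_integral_mono shell_moment_ge assms)
  show "S \<le> ennreal (2 powr \<alpha> * measure lborel (cball (0::'a) 2)) * moment \<alpha> \<mu>"
    unfolding S m by (intro nn_integral_mono shell_moment_le assms)
qed

text \<open>
  Along each ray the integral of the absolute value of the difference dominates the absolute value of
  the integral, which is \<open>\<bar>c\<bar>\<close> times the difference of two projected moments. Integrating over the shell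
  turns projected moments into quantities comparable to \<open>moment \<alpha>\<close>. The estimate is kept additive, as
  moments have values in \<open>[0, \<infinity>]\<close>, where differences are not available; \<open>A > 0\<close> expresses that \<open>c\<close> does
  not vanish.
\<close>

lemma moment_bound:
  assumes p: "0 < p" and \<alpha>: "0 < \<alpha>" "2 * (real p - 1) < \<alpha>" "\<alpha> < 2 * real p" and k: "\<And>i. i < p \<Longrightarrow> 2 * i < k"
    and nz: "\<And>i. i < k \<Longrightarrow> \<alpha> \<noteq> real i"
  shows "\<exists>A>0. \<exists>B\<ge>0. \<forall>\<mu>\<in>prob_measures_moment \<alpha>. \<forall>\<nu>\<in>prob_measures_moment \<alpha>.
    ennreal A * moment \<alpha> (\<mu>::'a::euclidean_space measure) \<le> ennreal B * (moment \<alpha> \<nu> +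
      diff_norm \<alpha> k (\<lambda>\<xi>. Re (fourier \<mu> \<xi>) - Re (fourier \<nu> \<xi>)))"
proof -
  define c where "c = cos_diff_const k p \<alpha>"
  have "0 < k" using k[OF p] by simp
  then have c: "c \<noteq> 0" unfolding c_def using p \<alpha> nz by (intro cos_diff_const_nonzero) auto
  define a where "a = 2 powr - (real DIM('a) + \<alpha>) * measure lborel (ball (0::'a) (1 / 2))"
  define a' where "a' = 2 powr \<alpha> * measure lborel (cball (0::'a) 2)"
  define S where "S = (\<lambda>\<mu>::'a measure. \<integral>\<^sup>+\<eta>. shell_weight \<alpha> \<eta> * (\<integral>\<^sup>+v. ennreal (\<bar>\<eta> \<bullet> v\<bar> powr \<alpha>) \<partial>\<mu>) \<partial>lborel)"
  have a: "0 < a" by (simp add: a_def content_ball_pos)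
  have a': "0 \<le> a'" by (simp add: a'_def)
  \<comment> \<open>One constant for both terms; \<open>ln 2\<close> is the factor of the difference norm in \<open>radial_average\<close>.\<close>
  define B where "B = max (\<bar>c\<bar> * a') (ln 2)"
  have "ennreal (\<bar>c\<bar> * a) * moment \<alpha> \<mu> \<le> ennreal B * (moment \<alpha> \<nu> +
      diff_norm \<alpha> k (\<lambda>\<xi>. Re (fourier \<mu> \<xi>) - Re (fourier \<nu> \<xi>)))"
    if \<mu>: "\<mu> \<in> prob_measures_moment \<alpha>" and \<nu>: "\<nu> \<in> prob_measures_moment \<alpha>" for \<mu> \<nu> :: "'a measure"
  proof -
    note P = prob_measures_momentD(1)[OF \<mu>] prob_measures_momentD(1)[OF \<nu>]
    have [measurable_cong]: "sets \<mu> = sets borel" "sets \<nu> = sets borel" using P by (simp_all add: prob_measuresD(2))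
    define \<psi> where "\<psi> = (\<lambda>\<xi>. Re (fourier \<mu> \<xi>) - Re (fourier \<nu> \<xi>))"
    have [measurable]: "\<psi> \<in> borel_measurable borel"
      using P unfolding \<psi>_def by measurable
    define R where "R = (\<lambda>\<eta>. \<integral>\<^sup>+s\<in>{0<..}. ennreal (norm (fin_diff k \<psi> (s *\<^sub>R \<eta>)) * s powr (- 1 - \<alpha>)) \<partial>lborel)"
    have [measurable]: "R \<in> borel_measurable borel" unfolding R_def by measurable
    have key: "ennreal \<bar>c\<bar> * (\<integral>\<^sup>+v. ennreal (\<bar>\<eta> \<bullet> v\<bar> powr \<alpha>) \<partial>\<mu>) \<le>
       ennreal \<bar>c\<bar> * (\<integral>\<^sup>+v. ennreal (\<bar>\<eta> \<bullet> v\<bar> powr \<alpha>) \<partial>\<nu>) + R \<eta>" for \<eta>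
    proof -
      let ?m = "\<lambda>\<mu>. \<integral>v. \<bar>\<eta> \<bullet> v\<bar> powr \<alpha> \<partial>\<mu>"
      note h = cos_diff_pairing[OF p \<alpha> k \<mu>, of \<eta>] cos_diff_pairing[OF p \<alpha> k \<nu>, of \<eta>]
      let ?f = "\<lambda>s. indicator {0<..} s *\<^sub>R (fin_diff k \<psi> (s *\<^sub>R \<eta>) * s powr (- 1 - \<alpha>))"
      have "has_bochner_integral lborel ?f (c * ?m \<mu> - c * ?m \<nu>)"
        using has_bochner_integral_diff[OF h(1) h(3)]
        by (simp add: \<psi>_def fin_diff_diff c_def algebra_simps)
      then have "ennreal \<bar>c * ?m \<mu> - c * ?m \<nu>\<bar> \<le> (\<integral>\<^sup>+s. ennreal (norm (?f s)) \<partial>lborel)"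
        using integral_norm_bound_ennreal[of lborel ?f] by (simp add: has_bochner_integral_iff)
      also have "\<dots> = R \<eta>"
        unfolding R_def by (intro nn_integral_cong) (simp add: indicator_def abs_mult)
      finally have *: "ennreal \<bar>c * ?m \<mu> - c * ?m \<nu>\<bar> \<le> R \<eta>" .
      have "\<bar>c\<bar> * ?m \<mu> \<le> \<bar>c\<bar> * ?m \<nu> + \<bar>c * ?m \<mu> - c * ?m \<nu>\<bar>"
        unfolding right_diff_distrib[symmetric] abs_mult distrib_left[symmetric]
        by (intro mult_left_mono) auto
      then have "ennreal (\<bar>c\<bar> * ?m \<mu>) \<le> ennreal (\<bar>c\<bar> * ?m \<nu> + \<bar>c * ?m \<mu> - c * ?m \<nu>\<bar>)"
        by (rule ennreal_leI)
      also have "\<dots> = ennreal (\<bar>c\<bar> * ?m \<nu>) + ennreal \<bar>c * ?m \<mu> - c * ?m \<nu>\<bar>"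
        by (intro ennreal_plus) auto
      also have "\<dots> \<le> ennreal (\<bar>c\<bar> * ?m \<nu>) + R \<eta>"
        using * by (rule add_left_mono)
      finally show ?thesis
        using h by (simp add: nn_integral_eq_integral ennreal_mult)
    qed
    have [measurable]: "(\<lambda>\<eta>. \<integral>\<^sup>+v. ennreal (\<bar>\<eta> \<bullet> v\<bar> powr \<alpha>) \<partial>\<mu>) \<in> borel_measurable borel"
        "(\<lambda>\<eta>. \<integral>\<^sup>+v. ennreal (\<bar>\<eta> \<bullet> v\<bar> powr \<alpha>) \<partial>\<nu>) \<in> borel_measurable borel"
    proof -
      interpret \<mu>: prob_space \<mu> using P(1) by (rule prob_measuresD)
      interpret \<nu>: prob_space \<nu> using P(2) by (rule prob_measuresD)
      show "(\<lambda>\<eta>. \<integral>\<^sup>+v. ennreal (\<bar>\<eta> \<bullet> v\<bar> powr \<alpha>) \<partial>\<mu>) \<in> borel_measurable borel"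
        "(\<lambda>\<eta>. \<integral>\<^sup>+v. ennreal (\<bar>\<eta> \<bullet> v\<bar> powr \<alpha>) \<partial>\<nu>) \<in> borel_measurable borel"
        by measurable
    qed
    have "ennreal \<bar>c\<bar> * S \<mu> = (\<integral>\<^sup>+\<eta>. shell_weight \<alpha> \<eta> * (ennreal \<bar>c\<bar> * (\<integral>\<^sup>+v. ennreal (\<bar>\<eta> \<bullet> v\<bar> powr \<alpha>) \<partial>\<mu>)) \<partial>lborel)"
      unfolding S_def by (subst nn_integral_cmult[symmetric]) (auto simp: mult_ac)
    also have "\<dots> \<le> (\<integral>\<^sup>+\<eta>. shell_weight \<alpha> \<eta> * (ennreal \<bar>c\<bar> * (\<integral>\<^sup>+v. ennreal (\<bar>\<eta> \<bullet> v\<bar> powr \<alpha>) \<partial>\<nu>) + R \<eta>) \<partial>lborel)"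
      by (intro nn_integral_mono mult_left_mono key) auto
    also have "\<dots> = (\<integral>\<^sup>+\<eta>. ennreal \<bar>c\<bar> * (shell_weight \<alpha> \<eta> * (\<integral>\<^sup>+v. ennreal (\<bar>\<eta> \<bullet> v\<bar> powr \<alpha>) \<partial>\<nu>)) + shell_weight \<alpha> \<eta> * R \<eta> \<partial>lborel)"
      by (simp add: distrib_left mult_ac)
    also have "\<dots> = ennreal \<bar>c\<bar> * S \<nu> + (\<integral>\<^sup>+\<eta>. shell_weight \<alpha> \<eta> * R \<eta> \<partial>lborel)"
      unfolding S_def by (subst nn_integral_add) (auto simp: nn_integral_cmult)
    also have "(\<integral>\<^sup>+\<eta>. shell_weight \<alpha> \<eta> * R \<eta> \<partial>lborel) = ennreal (ln 2) * diff_norm \<alpha> k \<psi>"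
      unfolding R_def diff_norm_def by (rule radial_average[symmetric]) auto
    finally have S: "ennreal \<bar>c\<bar> * S \<mu> \<le> ennreal \<bar>c\<bar> * S \<nu> + ennreal (ln 2) * diff_norm \<alpha> k \<psi>" .
    have "ennreal (\<bar>c\<bar> * a) * moment \<alpha> \<mu> = ennreal \<bar>c\<bar> * (ennreal a * moment \<alpha> \<mu>)"
      using a by (simp add: ennreal_mult mult.assoc)
    also have "\<dots> \<le> ennreal \<bar>c\<bar> * S \<mu>"
      unfolding a_def S_def using shell_moment_bound(1)[OF \<alpha>(1) P(1)] by (rule mult_left_mono) simp
    also note S
    also have "ennreal \<bar>c\<bar> * S \<nu> \<le> ennreal \<bar>c\<bar> * (ennreal a' * moment \<alpha> \<nu>)"
      unfolding a'_def S_def using shell_moment_bound(2)[OF \<alpha>(1) P(2)] by (rule mult_left_mono) simp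
    also have "\<dots> = ennreal (\<bar>c\<bar> * a') * moment \<alpha> \<nu>"
      using a' by (simp add: ennreal_mult mult.assoc)
    also have "\<dots> \<le> ennreal B * moment \<alpha> \<nu>"
      by (intro mult_right_mono ennreal_leI) (auto simp: B_def)
    also have "ennreal (ln 2) * diff_norm \<alpha> k \<psi> \<le> ennreal B * diff_norm \<alpha> k \<psi>"
      by (intro mult_right_mono ennreal_leI) (auto simp: B_def)
    finally show ?thesis by (simp add: distrib_left \<psi>_def add_right_mono)
  qed
  moreover have "0 < \<bar>c\<bar> * a" "0 \<le> B" using c a a' by (auto simp: B_def max_def)
  ultimately show ?thesis by blast
qed

lemma diff_norm_diff_le:
  fixes \<phi> \<psi> :: "'a::euclidean_space \<Rightarrow> 'b::{real_normed_field, second_countable_topology}"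
  assumes [measurable]: "\<phi> \<in> borel_measurable borel" "\<psi> \<in> borel_measurable borel"
  shows "diff_norm \<alpha> k (\<lambda>\<xi>. \<phi> \<xi> - \<psi> \<xi>) \<le> diff_norm \<alpha> k \<phi> + diff_norm \<alpha> k \<psi>"
proof -
  let ?w = "\<lambda>\<xi>::'a. norm \<xi> powr (real DIM('a) + \<alpha>)"
  have "diff_norm \<alpha> k (\<lambda>\<xi>. \<phi> \<xi> - \<psi> \<xi>) \<le>
    (\<integral>\<^sup>+\<xi>. ennreal (norm (fin_diff k \<phi> \<xi>) / ?w \<xi>) + ennreal (norm (fin_diff k \<psi> \<xi>) / ?w \<xi>) \<partial>lborel)"
    unfolding diff_norm_def fin_diff_diff
  proof (rule nn_integral_mono)
    fix \<xi> :: 'a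
    have "norm (fin_diff k \<phi> \<xi> - fin_diff k \<psi> \<xi>) / ?w \<xi> \<le>
        norm (fin_diff k \<phi> \<xi>) / ?w \<xi> + norm (fin_diff k \<psi> \<xi>) / ?w \<xi>"
      unfolding add_divide_distrib[symmetric] by (intro divide_right_mono norm_triangle_ineq4) simp
    then show "ennreal (norm (fin_diff k \<phi> \<xi> - fin_diff k \<psi> \<xi>) / ?w \<xi>) \<le>
        ennreal (norm (fin_diff k \<phi> \<xi>) / ?w \<xi>) + ennreal (norm (fin_diff k \<psi> \<xi>) / ?w \<xi>)"
      by (subst ennreal_plus[symmetric]) (simp_all add: ennreal_leI del: ennreal_plus)
  qed
  also have "\<dots> = diff_norm \<alpha> k \<phi> + diff_norm \<alpha> k \<psi>"
    unfolding diff_norm_def by (rule nn_integral_add) auto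
  finally show ?thesis .
qed

lemma diff_norm_Re_fourier_finite:
  fixes \<mu> :: "'a::euclidean_space measure"
  assumes p: "0 < p" and \<alpha>: "0 < \<alpha>" "2 * (real p - 1) < \<alpha>" "\<alpha> < 2 * real p" and k: "\<And>i. i < p \<Longrightarrow> 2 * i < k"
    and \<mu>: "\<mu> \<in> prob_measures_moment \<alpha>"
  shows "diff_norm \<alpha> k (\<lambda>\<xi>. Re (fourier \<mu> \<xi>)) < \<infinity>"
proof -
  note P = prob_measures_momentD(1)[OF \<mu>]
  obtain C where C: "0 \<le> C" "\<And>x. (\<integral>\<^sup>+s\<in>{0<..}. ennreal (\<bar>cos_diff k (s * x)\<bar> * s powr (- 1 - \<alpha>)) \<partial>lborel) \<le>
      ennreal (C * \<bar>x\<bar> powr \<alpha>)"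
    using cos_diff_abs_integral[OF p \<alpha> k] by blast
  show ?thesis
  proof (rule diff_norm_finite[OF \<alpha>(1) \<mu> _ _ C])
    show "(\<lambda>\<xi>. Re (fourier \<mu> \<xi>)) \<in> borel_measurable borel" using P by measurable
    fix \<xi>
    have "integrable \<mu> (\<lambda>v. cos_diff k (\<xi> \<bullet> v))"
      by (rule prob_integrable_bounded[OF P, where B="\<Sum>m=0..k. real (k choose m)"])
        (auto intro: abs_cos_diff_le)
    then show "ennreal (norm (fin_diff k (\<lambda>\<xi>. Re (fourier \<mu> \<xi>)) \<xi>)) \<le> (\<integral>\<^sup>+v. ennreal \<bar>cos_diff k (\<xi> \<bullet> v)\<bar> \<partial>\<mu>)"
      unfolding fin_diff_Re_fourier[OF P] using integral_norm_bound_ennreal by fastforce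
  qed auto
qed

lemma norm_exp_diff_1_le: "cmod (exp (- \<i> * complex_of_real u) - 1) \<le> min 2 \<bar>u\<bar>"
proof -
  have "cmod (exp (- \<i> * complex_of_real u) - 1) \<le> cmod (exp (- \<i> * complex_of_real u)) + cmod 1"
    by (rule norm_triangle_ineq4)
  also have "\<dots> = 2" by (simp add: norm_exp_eq_Re)
  finally show ?thesis using iexp_approx1[of "- u" 0] by simp
qed

lemma diff_norm_fourier_finite:
  fixes \<mu> :: "'a::euclidean_space measure"
  assumes \<alpha>: "0 < \<alpha>" "\<alpha> < real k" and \<mu>: "\<mu> \<in> prob_measures_moment \<alpha>"
  shows "diff_norm \<alpha> k (fourier \<mu>) < \<infinity>"
proof -
  note P = prob_measures_momentD(1)[OF \<mu>]
  have k: "0 < k" using \<alpha> by (cases k) auto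
  define h where "h = (\<lambda>u::real. min 2 \<bar>u\<bar> ^ k)"
  have hm[measurable]: "h \<in> borel_measurable borel" unfolding h_def by measurable
  have h0: "0 \<le> h u" for u by (simp add: h_def)
  define C where "C = enn2real (\<integral>\<^sup>+s\<in>{0<..}. ennreal (h s * s powr (- 1 - \<alpha>)) \<partial>lborel)"
  have "(\<integral>\<^sup>+s\<in>{0<..}. ennreal (h s * s powr (- 1 - \<alpha>)) \<partial>lborel) \<le>
    (\<integral>\<^sup>+s. ennreal (2 ^ k) * (ennreal (min 1 (s powr real k) * s powr (- 1 - \<alpha>)) * indicator {0<..} s) \<partial>lborel)"
  proof (rule nn_integral_mono)
    fix s :: real
    have "ennreal (h s * s powr (- 1 - \<alpha>)) \<le> ennreal (2 ^ k) * ennreal (min 1 (s powr real k) * s powr (- 1 - \<alpha>))"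
      if s: "0 < s"
    proof -
      have "h s \<le> (2 * min 1 s) ^ k"
        unfolding h_def using s by (intro power_mono) auto
      also have "\<dots> = 2 ^ k * min 1 (s powr real k)"
      proof -
        have "min 1 s ^ k = min 1 (s ^ k)"
          using s power_le_one[of s k] one_le_power[of s k] by (auto simp: min_def)
        then show ?thesis using s by (simp add: power_mult_distrib powr_realpow)
      qed
      finally have "h s * s powr (- 1 - \<alpha>) \<le> 2 ^ k * min 1 (s powr real k) * s powr (- 1 - \<alpha>)"
        by (rule mult_right_mono) simp
      then have "ennreal (h s * s powr (- 1 - \<alpha>)) \<le> ennreal (2 ^ k * (min 1 (s powr real k) * s powr (- 1 - \<alpha>)))"
        unfolding mult.assoc by (rule ennreal_leI)
      also have "\<dots> = ennreal (2 ^ k) * ennreal (min 1 (s powr real k) * s powr (- 1 - \<alpha>))"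
        by (rule ennreal_mult) auto
      finally show ?thesis .
    qed
    then show "ennreal (h s * s powr (- 1 - \<alpha>)) * indicator {0<..} s \<le>
      ennreal (2 ^ k) * (ennreal (min 1 (s powr real k) * s powr (- 1 - \<alpha>)) * indicator {0<..} s)"
      by (cases "0 < s") (simp_all add: indicator_def)
  qed
  also have "\<dots> = ennreal (2 ^ k) * (\<integral>\<^sup>+s\<in>{0<..}. ennreal (min 1 (s powr real k) * s powr (- 1 - \<alpha>)) \<partial>lborel)"
    by (rule nn_integral_cmult) measurable
  also have "\<dots> < \<infinity>"
    using power_kernel_finite[OF \<alpha>] by (simp add: ennreal_mult_less_top)
  finally have C: "(\<integral>\<^sup>+s\<in>{0<..}. ennreal (h s * s powr (- 1 - \<alpha>)) \<partial>lborel) = ennreal C"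
    by (simp add: C_def)
  have hC: "(\<integral>\<^sup>+s\<in>{0<..}. ennreal (h (s * x) * s powr (- 1 - \<alpha>)) \<partial>lborel) \<le> ennreal (C * \<bar>x\<bar> powr \<alpha>)" for x
  proof (cases "x = 0")
    case True
    then show ?thesis using k by (simp add: h_def zero_power)
  next
    case False
    have "h (s * x) = h (s * \<bar>x\<bar>)" for s by (simp add: h_def abs_mult)
    then have "(\<integral>\<^sup>+s\<in>{0<..}. ennreal (h (s * x) * s powr (- 1 - \<alpha>)) \<partial>lborel) =
        (\<integral>\<^sup>+s\<in>{0<..}. ennreal (h (s * \<bar>x\<bar>) * s powr (- 1 - \<alpha>)) \<partial>lborel)" by simp
    also have "\<dots> = ennreal (\<bar>x\<bar> powr \<alpha>) * ennreal C"
      unfolding C[symmetric] using False by (intro nn_integral_scale_kernel hm h0) auto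
    also have "\<dots> = ennreal (C * \<bar>x\<bar> powr \<alpha>)"
      by (simp add: ennreal_mult[symmetric] mult.commute C_def)
    finally show ?thesis by simp
  qed
  have C0: "0 \<le> C" by (simp add: C_def)
  show ?thesis
  proof (rule diff_norm_finite[OF \<alpha>(1) \<mu> hm h0 C0 hC])
    show "fourier \<mu> \<in> borel_measurable borel" using P by measurable
    fix \<xi> :: 'a
    let ?g = "\<lambda>v::'a. (exp (- \<i> * complex_of_real (\<xi> \<bullet> v)) - 1) ^ k"
    have g: "cmod (?g v) \<le> h (\<xi> \<bullet> v)" for v
      unfolding h_def norm_power by (intro power_mono norm_exp_diff_1_le) simp
    have "integrable \<mu> ?g"
    proof (rule prob_integrable_bounded[OF P, where B="2 ^ k"])
      fix v
      have "h (\<xi> \<bullet> v) \<le> 2 ^ k" unfolding h_def by (intro power_mono) auto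
      then show "cmod (?g v) \<le> 2 ^ k" using g[of v] by linarith
    qed measurable
    then have "ennreal (norm (fin_diff k (fourier \<mu>) \<xi>)) \<le> (\<integral>\<^sup>+v. ennreal (cmod (?g v)) \<partial>\<mu>)"
      unfolding fin_diff_fourier[OF P] by (rule integral_norm_bound_ennreal)
    also have "\<dots> \<le> (\<integral>\<^sup>+v. ennreal (h (\<xi> \<bullet> v)) \<partial>\<mu>)"
      by (intro nn_integral_mono ennreal_leI g)
    finally show "ennreal (norm (fin_diff k (fourier \<mu>) \<xi>)) \<le> (\<integral>\<^sup>+v. ennreal (h (\<xi> \<bullet> v)) \<partial>\<mu>)" .
  qed
qed

text \<open>
  Interpolation between \<open>\<bar>exp (\<i> * x) - 1\<bar> \<le> \<bar>x\<bar>\<close> and \<open>\<bar>exp (\<i> * x) - 1\<bar> \<le> 2\<close>; a moment of order \<open>\<beta>\<close> is bounded by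
  one of order \<open>\<alpha> \<ge> \<beta>\<close>.
\<close>

lemma fourier_minus_1_le:
  fixes \<mu> :: "'a::euclidean_space measure"
  assumes \<beta>: "0 < \<beta>" "\<beta> \<le> 1" "\<beta> \<le> \<alpha>" and P: "\<mu> \<in> prob_measures"
  shows "ennreal (norm (fourier \<mu> \<xi> - 1)) \<le> ennreal (2 * norm \<xi> powr \<beta>) * (1 + moment \<alpha> \<mu>)"
proof -
  interpret prob_space \<mu> using P by (rule prob_measuresD)
  have [measurable_cong]: "sets \<mu> = sets borel" using P by (rule prob_measuresD)
  let ?e = "\<lambda>v. exp (- \<i> * complex_of_real (\<xi> \<bullet> v))"
  have i: "integrable \<mu> (\<lambda>v. ?e v - 1)"
    by (intro Bochner_Integration.integrable_diff integrable_fourier_kernel[OF P]) simp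
  have "fourier \<mu> \<xi> - 1 = (CLINT v|\<mu>. ?e v - 1)"
    unfolding fourier_def by (subst Bochner_Integration.integral_diff) (auto simp: integrable_fourier_kernel[OF P, simplified] prob_space)
  then have "ennreal (norm (fourier \<mu> \<xi> - 1)) \<le> (\<integral>\<^sup>+v. ennreal (norm (?e v - 1)) \<partial>\<mu>)"
    using integral_norm_bound_ennreal[OF i] by simp
  also have "\<dots> \<le> (\<integral>\<^sup>+v. ennreal (2 * norm \<xi> powr \<beta>) * (1 + ennreal (norm v powr \<alpha>)) \<partial>\<mu>)"
  proof (rule nn_integral_mono)
    fix v
    have "norm (?e v - 1) \<le> min 2 \<bar>\<xi> \<bullet> v\<bar>" by (rule norm_exp_diff_1_le)
    also have "\<dots> \<le> 2 * \<bar>\<xi> \<bullet> v\<bar> powr \<beta>"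
    proof (cases "\<bar>\<xi> \<bullet> v\<bar> \<le> 1")
      case True
      then have "\<bar>\<xi> \<bullet> v\<bar> powr 1 \<le> \<bar>\<xi> \<bullet> v\<bar> powr \<beta>"
        using \<beta> by (intro powr_mono') auto
      moreover have "0 \<le> \<bar>\<xi> \<bullet> v\<bar> powr \<beta>" by simp
      ultimately show ?thesis by (simp only: min_def) (use True in simp)
    next
      case False
      then have "1 \<le> \<bar>\<xi> \<bullet> v\<bar> powr \<beta>" using \<beta> by (intro ge_one_powr_ge_zero) auto
      then show ?thesis by simp
    qed
    also have "\<bar>\<xi> \<bullet> v\<bar> powr \<beta> \<le> (norm \<xi> * norm v) powr \<beta>"
      using \<beta> by (intro powr_mono2 Cauchy_Schwarz_ineq2) auto
    also have "\<dots> = norm \<xi> powr \<beta> * norm v powr \<beta>" by (simp add: powr_mult)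
    also have "norm v powr \<beta> \<le> 1 + norm v powr \<alpha>"
    proof (cases "norm v \<le> 1")
      case True
      then have "norm v powr \<beta> \<le> 1 powr \<beta>" using \<beta> by (intro powr_mono2) auto
      then show ?thesis by (simp add: add_increasing2)
    next
      case False
      then have "norm v powr \<beta> \<le> norm v powr \<alpha>" using \<beta> by (intro powr_mono) auto
      then show ?thesis by simp
    qed
    finally have "norm (?e v - 1) \<le> 2 * norm \<xi> powr \<beta> * (1 + norm v powr \<alpha>)"
      by (simp add: mult_left_mono)
    then have "ennreal (norm (?e v - 1)) \<le> ennreal (2 * norm \<xi> powr \<beta> * (1 + norm v powr \<alpha>))"
      by (rule ennreal_leI)
    also have "\<dots> = ennreal (2 * norm \<xi> powr \<beta>) * (1 + ennreal (norm v powr \<alpha>))"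
      using ennreal_plus[of 1 "norm v powr \<alpha>"] by (subst ennreal_mult) simp_all
    finally show "ennreal (norm (?e v - 1)) \<le> ennreal (2 * norm \<xi> powr \<beta>) * (1 + ennreal (norm v powr \<alpha>))" .
  qed
  also have "\<dots> = ennreal (2 * norm \<xi> powr \<beta>) * (\<integral>\<^sup>+v. 1 + ennreal (norm v powr \<alpha>) \<partial>\<mu>)"
    by (rule nn_integral_cmult) measurable
  also have "(\<integral>\<^sup>+v. 1 + ennreal (norm v powr \<alpha>) \<partial>\<mu>) = 1 + moment \<alpha> \<mu>"
    unfolding moment_def by (subst nn_integral_add) (auto simp: emeasure_space_1)
  finally show ?thesis .
qed

lemma fourier_dist_finite:
  fixes \<mu> \<nu> :: "'a::euclidean_space measure"
  assumes \<beta>: "0 < \<beta>" "\<beta> \<le> 1" "\<beta> \<le> \<alpha>"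
    and \<mu>: "\<mu> \<in> prob_measures_moment \<alpha>" and \<nu>: "\<nu> \<in> prob_measures_moment \<alpha>"
  shows "fourier_dist \<beta> \<mu> \<nu> < \<infinity>"
proof -
  have "fourier_dist \<beta> \<mu> \<nu> \<le> 2 * (1 + moment \<alpha> \<mu>) + 2 * (1 + moment \<alpha> \<nu>)"
    unfolding fourier_dist_def
  proof (rule SUP_least)
    fix \<xi> :: 'a assume "\<xi> \<in> {\<xi>. \<xi> \<noteq> 0}"
    then have n: "0 < norm \<xi> powr \<beta>" by simp
    have "norm (fourier \<mu> \<xi> - fourier \<nu> \<xi>) \<le> norm (fourier \<mu> \<xi> - 1) + norm (fourier \<nu> \<xi> - 1)"
      using norm_triangle_ineq4[of "fourier \<mu> \<xi> - 1" "fourier \<nu> \<xi> - 1"] by simp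
    then have "ennreal (norm (fourier \<mu> \<xi> - fourier \<nu> \<xi>)) \<le> ennreal (norm (fourier \<mu> \<xi> - 1)) + ennreal (norm (fourier \<nu> \<xi> - 1))"
      by (simp add: ennreal_leI ennreal_plus[symmetric] del: ennreal_plus)
    also have "\<dots> \<le> ennreal (2 * norm \<xi> powr \<beta>) * (1 + moment \<alpha> \<mu>) + ennreal (2 * norm \<xi> powr \<beta>) * (1 + moment \<alpha> \<nu>)"
      using \<mu> \<nu> by (intro add_mono fourier_minus_1_le \<beta> prob_measures_momentD)
    also have "\<dots> = ennreal (norm \<xi> powr \<beta>) * (2 * (1 + moment \<alpha> \<mu>) + 2 * (1 + moment \<alpha> \<nu>))"
      by (simp add: ennreal_mult distrib_left mult_ac)
    finally have "ennreal (1 / norm \<xi> powr \<beta>) * ennreal (norm (fourier \<mu> \<xi> - fourier \<nu> \<xi>)) \<le>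
      ennreal (1 / norm \<xi> powr \<beta>) * (ennreal (norm \<xi> powr \<beta>) * (2 * (1 + moment \<alpha> \<mu>) + 2 * (1 + moment \<alpha> \<nu>)))"
      by (rule mult_left_mono) simp
    moreover have "ennreal (1 / norm \<xi> powr \<beta>) * ennreal (norm \<xi> powr \<beta>) = 1"
      using n by (simp add: ennreal_mult[symmetric])
    ultimately show "ennreal (norm (fourier \<mu> \<xi> - fourier \<nu> \<xi>) / norm \<xi> powr \<beta>) \<le> 2 * (1 + moment \<alpha> \<mu>) + 2 * (1 + moment \<alpha> \<nu>)"
      by (simp add: mult.assoc[symmetric] ennreal_mult[symmetric])
  qed
  also have "\<dots> < \<infinity>"
    using prob_measures_momentD(2)[OF \<mu>] prob_measures_momentD(2)[OF \<nu>] by (simp add: ennreal_mult_less_top)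
  finally show ?thesis .
qed

section \<open>A space-filling curve with a Borel section\<close>

text \<open>
  The distance from \<open>t\<close> to the nearest even integer, in a form whose continuity and periodicity are
  evident.
\<close>

definition tri :: "real \<Rightarrow> real"
  where "tri t = arccos (cos (pi * t)) / pi"

lemma tri_eq: "0 \<le> t \<Longrightarrow> t \<le> 1 \<Longrightarrow> tri t = t"
  by (simp add: tri_def arccos_cos)

lemma tri_period: "tri (t + 2 * of_int j) = tri t"
proof -
  have "cos (pi * (t + 2 * of_int j)) = cos (pi * t + 2 * pi * of_int j)"
    by (simp add: algebra_simps)
  also have "\<dots> = cos (pi * t)"
    by (simp add: cos_add cos_int_2pin sin_int_2pin)
  finally show ?thesis by (simp add: tri_def)
qed

lemma continuous_tri: "continuous_on A tri"
  unfolding tri_def by (intro continuous_intros continuous_on_arccos) auto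

text \<open>
  Schoenberg's function reads off a ternary digit: it is \<open>0\<close> on \<open>{0..1/3}\<close>, \<open>1\<close> on \<open>{2/3..1}\<close> and linear in
  between.
\<close>

definition schoenberg :: "real \<Rightarrow> real"
  where "schoenberg t = max 0 (min 1 (3 * tri t - 1))"

lemma continuous_schoenberg: "continuous_on A schoenberg"
  unfolding schoenberg_def by (intro continuous_intros continuous_tri)

lemma schoenberg_period: "schoenberg (t + 2 * of_int j) = schoenberg t"
  by (simp add: schoenberg_def tri_period)

lemma schoenberg_bounds: "0 \<le> schoenberg t" "schoenberg t \<le> 1"
  by (auto simp: schoenberg_def)

text \<open>
  Ternary digits \<open>0\<close> and \<open>2\<close> only, so that the code never falls into the gap on which \<open>schoenberg\<close>
  interpolates.
\<close>

definition cantor_code :: "(nat \<Rightarrow> real) \<Rightarrow> real"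
  where "cantor_code a = (\<Sum>n. 2 * a n / 3 ^ Suc n)"

lemma summable_cantor_code:
  assumes "\<And>n. a n \<in> {0, 1::real}"
  shows "summable (\<lambda>n. 2 * a n / 3 ^ Suc n)"
proof (rule summable_comparison_test')
  show "summable (\<lambda>n. 2 / 3 * (1 / 3 :: real) ^ n)"
    by (intro summable_mult summable_geometric) simp
  fix n show "norm (2 * a n / 3 ^ Suc n) \<le> 2 / 3 * (1 / 3) ^ n"
    using assms[of n] by (auto simp: power_one_over field_simps)
qed

lemma cantor_code_bounds:
  assumes "\<And>n. a n \<in> {0, 1::real}"
  shows "0 \<le> cantor_code a" "cantor_code a \<le> 1"
proof -
  have a: "0 \<le> a n \<and> a n \<le> 1" for n using assms[of n] by auto
  show "0 \<le> cantor_code a"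
    unfolding cantor_code_def using a by (intro suminf_nonneg summable_cantor_code assms) auto
  have "(\<lambda>n. 2 / 3 * (1 / 3 :: real) ^ n) sums (2 / 3 * (1 / (1 - 1 / 3)))"
    by (intro sums_mult geometric_sums) simp
  then have s: "(\<lambda>n. 2 / 3 * (1 / 3 :: real) ^ n) sums 1" by simp
  have "cantor_code a \<le> (\<Sum>n. 2 / 3 * (1 / 3 :: real) ^ n)"
    unfolding cantor_code_def
    using a s by (intro suminf_le summable_cantor_code assms sums_summable[OF s])
      (auto simp: power_one_over field_simps)
  then show "cantor_code a \<le> 1" using s by (simp add: sums_unique[symmetric])
qed

lemma cantor_code_shift:
  assumes "\<And>n. a n \<in> {0, 1::real}"
  shows "cantor_code a = (2 * a 0 + cantor_code (\<lambda>n. a (Suc n))) / 3"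
proof -
  have "cantor_code a = 2 * a 0 / 3 + (\<Sum>n. 2 * a (Suc n) / 3 ^ Suc (Suc n))"
    unfolding cantor_code_def
    using suminf_split_head[OF summable_cantor_code[of a, OF assms]] by simp
  also have "(\<Sum>n. 2 * a (Suc n) / 3 ^ Suc (Suc n)) = (\<Sum>n. 2 * a (Suc n) / 3 ^ Suc n / 3)"
    by (simp add: field_simps)
  also have "\<dots> = cantor_code (\<lambda>n. a (Suc n)) / 3"
    unfolding cantor_code_def by (intro suminf_divide summable_cantor_code assms)
  finally show ?thesis by simp
qed

text \<open>
  Multiplication by \<open>3\<close> shifts the digits of the code, up to an even integer, which the period of
  \<open>schoenberg\<close> absorbs.
\<close>

lemma schoenberg_cantor_code:
  assumes "\<And>n. a n \<in> {0, 1::real}"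
  shows "schoenberg (3 ^ m * (2 * of_int j + cantor_code a)) = a m"
  using assms
proof (induction m arbitrary: a j)
  case 0
  let ?y = "cantor_code (\<lambda>n. a (Suc n))"
  have y: "0 \<le> ?y" "?y \<le> 1" using cantor_code_bounds[of "\<lambda>n. a (Suc n)"] 0 by auto
  have c: "cantor_code a = (2 * a 0 + ?y) / 3" by (rule cantor_code_shift) (rule 0)
  have "tri (cantor_code a) = cantor_code a"
    using cantor_code_bounds[of a] 0 by (intro tri_eq) auto
  then have "schoenberg (cantor_code a) = a 0"
    using 0[of 0] y unfolding schoenberg_def c by auto
  then show ?case using schoenberg_period[of "cantor_code a" j] by (simp add: add.commute)
next
  case (Suc m)
  obtain i :: int where i: "a 0 = of_int i" using Suc.prems[of 0] by (metis insertE of_int_0 of_int_1 singletonD)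
  have shift: "3 ^ Suc m * (2 * of_int j + cantor_code a) =
      3 ^ m * (2 * of_int (3 * j + i) + cantor_code (\<lambda>n. a (Suc n)))"
    unfolding cantor_code_shift[of a, OF Suc.prems] i by (simp add: algebra_simps)
  show ?case
    unfolding shift using Suc.prems by (intro Suc.IH[of "\<lambda>n. a (Suc n)" "3 * j + i"]) simp
qed

definition binary_digit :: "nat \<Rightarrow> real \<Rightarrow> real"
  where "binary_digit n y = of_int (\<lfloor>2 ^ Suc n * y\<rfloor> mod 2)"

lemma binary_digit_01: "binary_digit n y \<in> {0, 1}"
proof -
  have "\<lfloor>2 ^ Suc n * y\<rfloor> mod 2 = 0 \<or> \<lfloor>2 ^ Suc n * y\<rfloor> mod 2 = 1" by presburger
  then show ?thesis by (auto simp: binary_digit_def)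
qed

lemma binary_digit_measurable [measurable]: "binary_digit n \<in> borel_measurable borel"
  unfolding binary_digit_def by measurable

lemma binary_digit_sums:
  assumes "0 \<le> y" "y < 1"
  shows "(\<lambda>n. binary_digit n y / 2 ^ Suc n) sums y"
proof -
  have partial: "(\<Sum>n<N. binary_digit n y / 2 ^ Suc n) = of_int \<lfloor>2 ^ N * y\<rfloor> / 2 ^ N" for N
  proof (induction N)
    case 0
    have "\<lfloor>y\<rfloor> = 0" using assms by linarith
    then show ?case by simp
  next
    case (Suc N)
    have "\<lfloor>2 ^ Suc N * y\<rfloor> div 2 = \<lfloor>2 ^ N * y\<rfloor>"
      using floor_divide_real_eq_div[of 2 "2 ^ Suc N * y"] by simp
    then have "\<lfloor>2 ^ Suc N * y\<rfloor> = 2 * \<lfloor>2 ^ N * y\<rfloor> + \<lfloor>2 ^ Suc N * y\<rfloor> mod 2"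
      by (metis mult_div_mod_eq)
    then have "of_int \<lfloor>2 ^ Suc N * y\<rfloor> = 2 * of_int \<lfloor>2 ^ N * y\<rfloor> + binary_digit N y"
      unfolding binary_digit_def by (metis of_int_add of_int_mult of_int_numeral)
    then show ?case using Suc by (simp add: field_simps)
  qed
  have "(\<lambda>N. of_int \<lfloor>2 ^ N * y\<rfloor> / 2 ^ N) \<longlonglongrightarrow> y"
  proof (rule tendsto_sandwich)
    show "\<forall>\<^sub>F N in sequentially. y - (1 / 2) ^ N \<le> of_int \<lfloor>2 ^ N * y\<rfloor> / 2 ^ N"
    proof (intro always_eventually allI)
      fix N :: nat
      have "2 ^ N * y - 1 \<le> of_int \<lfloor>2 ^ N * y\<rfloor>" by linarith
      then have "(2 ^ N * y - 1) / 2 ^ N \<le> of_int \<lfloor>2 ^ N * y\<rfloor> / 2 ^ N"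
        by (rule divide_right_mono) simp
      then show "y - (1 / 2) ^ N \<le> of_int \<lfloor>2 ^ N * y\<rfloor> / 2 ^ N"
        by (simp add: power_one_over diff_divide_distrib)
    qed
    show "\<forall>\<^sub>F N in sequentially. of_int \<lfloor>2 ^ N * y\<rfloor> / 2 ^ N \<le> y"
      by (intro always_eventually allI) (simp add: divide_le_eq mult.commute)
    have "(\<lambda>N. y - (1 / 2) ^ N) \<longlonglongrightarrow> y - 0"
      by (intro tendsto_intros LIMSEQ_realpow_zero) auto
    then show "(\<lambda>N. y - (1 / 2) ^ N) \<longlonglongrightarrow> y" by simp
  qed simp
  then show ?thesis unfolding sums_def partial .
qed

text \<open>
  The binary digits of all coordinates are interleaved into one sequence.
\<close>

definition digit_index :: "'a::euclidean_space \<Rightarrow> nat \<Rightarrow> nat"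
  where "digit_index b n = prod_encode (to_nat_on Basis b, n)"

text \<open>
  At an index that belongs to no coordinate the value is some binary digit without significance.
\<close>

definition digit_seq :: "'a::euclidean_space \<Rightarrow> nat \<Rightarrow> real"
  where "digit_seq x j = (case prod_decode j of (i, n) \<Rightarrow> binary_digit n (x \<bullet> from_nat_into Basis i))"

lemma digit_seq_index: "b \<in> Basis \<Longrightarrow> digit_seq x (digit_index b n) = binary_digit n (x \<bullet> b)"
  by (simp add: digit_seq_def digit_index_def from_nat_into_to_nat_on countable_finite)

lemma digit_seq_measurable [measurable]: "(\<lambda>x. digit_seq x j) \<in> borel_measurable borel"
  by (cases "prod_decode j") (simp add: digit_seq_def)

definition cube_curve :: "real \<Rightarrow> 'a::euclidean_space"
  where "cube_curve t = (\<Sum>b\<in>Basis. (\<Sum>n. schoenberg (3 ^ digit_index b n * t) / 2 ^ Suc n) *\<^sub>R b)"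

lemma continuous_cube_curve: "continuous_on UNIV (cube_curve :: real \<Rightarrow> 'a::euclidean_space)"
proof -
  have "continuous_on UNIV (\<lambda>t. \<Sum>n. schoenberg (3 ^ digit_index b n * t) / 2 ^ Suc n)" for b :: 'a
  proof (rule uniform_limit_theorem)
    show "uniform_limit UNIV (\<lambda>N t. \<Sum>n<N. schoenberg (3 ^ digit_index b n * t) / 2 ^ Suc n)
        (\<lambda>t. \<Sum>n. schoenberg (3 ^ digit_index b n * t) / 2 ^ Suc n) sequentially"
    proof (rule Weierstrass_m_test)
      show "norm (schoenberg (3 ^ digit_index b n * t) / 2 ^ Suc n) \<le> 1 / 2 * (1 / 2) ^ n" for n t
        using schoenberg_bounds[of "3 ^ digit_index b n * t"] by (auto simp: power_one_over field_simps)
      show "summable (\<lambda>n. 1 / 2 * (1 / 2 :: real) ^ n)"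
        by (intro summable_mult summable_geometric) simp
    qed
    show "\<forall>\<^sub>F N in sequentially. continuous_on UNIV (\<lambda>t. \<Sum>n<N. schoenberg (3 ^ digit_index b n * t) / 2 ^ Suc n)"
      by (intro always_eventually allI continuous_intros continuous_on_compose2[OF continuous_schoenberg[of UNIV]]) auto
  qed simp
  then show ?thesis
    unfolding cube_curve_def by (intro continuous_intros)
qed

text \<open>
  The curve of Schoenberg passes through every point of the half-open unit cube, and it does so again in
  every interval that starts at an even integer.
\<close>

lemma cube_curve_code:
  fixes x :: "'a::euclidean_space"
  assumes "\<And>b. b \<in> Basis \<Longrightarrow> 0 \<le> x \<bullet> b \<and> x \<bullet> b < 1"
  shows "cube_curve (2 * of_int j + cantor_code (digit_seq x)) = x"
proof -
  have d: "digit_seq x n \<in> {0, 1}" for n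
    using binary_digit_01 by (auto simp: digit_seq_def split: prod.split)
  have "(\<Sum>n. schoenberg (3 ^ digit_index b n * (2 * of_int j + cantor_code (digit_seq x))) / 2 ^ Suc n) = x \<bullet> b"
    if b: "b \<in> Basis" for b
    using binary_digit_sums[of "x \<bullet> b"] assms[OF b]
    by (simp add: schoenberg_cantor_code[of "digit_seq x", OF d] digit_seq_index[OF b] sums_unique[symmetric])
  then show ?thesis unfolding cube_curve_def by (simp add: euclidean_representation)
qed

text \<open>
  The scalar factor is continuous and has the constant value \<open>j\<close> on the interval from \<open>2 * j\<close> to \<open>2 * j + 1\<close>,
  where the curve consequently fills the cube with side \<open>2 * j\<close> centred at the origin.
\<close>

definition space_curve :: "real \<Rightarrow> 'a::euclidean_space"
  where "space_curve t = ((t - tri t) / 2) *\<^sub>R (2 *\<^sub>R cube_curve t - One)"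

lemma continuous_space_curve: "continuous_on UNIV (space_curve :: real \<Rightarrow> 'a::euclidean_space)"
  unfolding space_curve_def by (intro continuous_intros continuous_tri continuous_cube_curve) simp

text \<open>
  The parameter is chosen in the interval that starts at \<open>2 * j\<close> for the first integer \<open>j > norm v\<close>. Thus
  points of bounded norm get bounded parameters, which is what carries tightness over to the line.
\<close>

definition space_code :: "'a::euclidean_space \<Rightarrow> real"
  where "space_code v = (let j = \<lfloor>norm v\<rfloor> + 1 in
    2 * of_int j + cantor_code (digit_seq ((1 / 2) *\<^sub>R (v /\<^sub>R of_int j + One))))"

lemma space_curve_code: "space_curve (space_code v) = (v :: 'a::euclidean_space)"
proof -
  define j where "j = \<lfloor>norm v\<rfloor> + 1"
  define x where "x = (1 / 2) *\<^sub>R (v /\<^sub>R of_int j + One)"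
  have j: "norm v < of_int j" "0 < (of_int j :: real)"
    unfolding j_def using norm_ge_zero[of v] by linarith+
  have d: "digit_seq x n \<in> {0, 1}" for n
    using binary_digit_01 by (auto simp: digit_seq_def split: prod.split)
  have s: "space_code v = 2 * of_int j + cantor_code (digit_seq x)"
    by (simp add: space_code_def j_def x_def Let_def)
  have "cube_curve (space_code v) = x"
    unfolding s
  proof (rule cube_curve_code)
    fix b :: 'a assume b: "b \<in> Basis"
    have "\<bar>v \<bullet> b\<bar> < of_int j" using Basis_le_norm[OF b, of v] j by simp
    then have "\<bar>v \<bullet> b / of_int j\<bar> < 1"
      unfolding abs_divide abs_of_pos[OF j(2)] using j(2) by (simp only: divide_less_eq_1_pos)
    moreover have "One \<bullet> b = 1"
      using b by (simp add: inner_sum_left sum.If_cases inner_Basis)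
    then have "x \<bullet> b = (v \<bullet> b / of_int j + 1) / 2"
      by (simp only: x_def inner_add_left inner_scaleR_left) (simp add: field_simps)
    moreover have "0 \<le> y \<and> y < 1" if "\<bar>t\<bar> < 1" "y = (t + 1) / 2" for t y :: real
      using that by auto
    ultimately show "0 \<le> x \<bullet> b \<and> x \<bullet> b < 1" by blast
  qed
  moreover have "tri (space_code v) = cantor_code (digit_seq x)"
    unfolding s using cantor_code_bounds[of "digit_seq x", OF d]
    by (subst add.commute, subst tri_period) (rule tri_eq)
  ultimately have "space_curve (space_code v) = (of_int j :: real) *\<^sub>R (2 *\<^sub>R x - One)"
    by (simp add: space_curve_def s)
  also have "2 *\<^sub>R x - One = v /\<^sub>R of_int j"
    unfolding x_def scaleR_scaleR by simp
  also have "(of_int j :: real) *\<^sub>R (v /\<^sub>R of_int j) = v"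
    using j by (simp only: scaleR_scaleR) simp
  finally show ?thesis .
qed

lemma space_code_bounds: "\<bar>space_code (v :: 'a::euclidean_space)\<bar> \<le> 2 * norm v + 3"
proof -
  let ?x = "(1 / 2) *\<^sub>R (v /\<^sub>R of_int (\<lfloor>norm v\<rfloor> + 1) + One)"
  have d: "digit_seq ?x n \<in> {0, 1}" for n
    using binary_digit_01 by (auto simp: digit_seq_def split: prod.split)
  have "space_code v = 2 * (of_int \<lfloor>norm v\<rfloor> + 1) + cantor_code (digit_seq ?x)"
    by (simp add: space_code_def Let_def)
  moreover have "0 \<le> of_int \<lfloor>norm v\<rfloor> + (1::real)" "of_int \<lfloor>norm v\<rfloor> + (1::real) \<le> norm v + 1"
    using norm_ge_zero[of v] by linarith+
  moreover have "\<bar>s\<bar> \<le> 2 * n + 3"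
    if "s = 2 * (a + 1) + c" "0 \<le> a + 1" "a + 1 \<le> n + 1" "0 \<le> c" "c \<le> 1" for a c n s :: real
    using that by auto
  ultimately show ?thesis
    using cantor_code_bounds[of "digit_seq ?x", OF d] by blast
qed

lemma space_code_measurable [measurable]: "space_code \<in> borel_measurable borel"
  unfolding space_code_def Let_def cantor_code_def by measurable

section \<open>Weak compactness of tight sequences\<close>

text \<open>
  The images of the measures under \<open>space_code\<close> are tight on the line, and Helly's theorem provides a weak
  limit there; its image under the continuous \<open>space_curve\<close> is the limit sought, because
  \<open>space_curve (space_code v) = v\<close> turns integrals of \<open>f\<close> into integrals of \<open>f \<circ> space_curve\<close>.
\<close>

lemma tight_imp_weakly_convergent_subsequence:
  fixes M :: "nat \<Rightarrow> 'a::euclidean_space measure"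
  assumes P: "\<And>n. M n \<in> prob_measures"
    and tight: "\<And>\<epsilon>. 0 < \<epsilon> \<Longrightarrow> \<exists>R. \<forall>n. measure (M n) {v. R < norm v} < \<epsilon>"
  shows "\<exists>r N. strict_mono r \<and> N \<in> prob_measures \<and>
    (\<forall>f::'a \<Rightarrow> complex. \<forall>B. continuous_on UNIV f \<longrightarrow> (\<forall>v. norm (f v) \<le> B) \<longrightarrow>
      (\<lambda>j. \<integral>v. f v \<partial>M (r j)) \<longlonglongrightarrow> (\<integral>v. f v \<partial>N))"
proof -
  define L where "L = (\<lambda>n. distr (M n) borel space_code)"
  have sets_M [measurable_cong]: "sets (M n) = sets borel" for n using P by (rule prob_measuresD)
  have code_m[measurable]: "space_code \<in> borel_measurable (M n)" for n by measurable
  have L: "real_distribution (L n)" for n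
  proof -
    interpret prob_space "M n" using P by (rule prob_measuresD)
    show ?thesis
      unfolding L_def by (intro real_distribution.intro prob_space_distr code_m real_distribution_axioms.intro) simp
  qed
  have "tight L"
    unfolding tight_def
  proof (intro conjI allI impI L)
    fix \<epsilon> :: real assume "0 < \<epsilon>"
    then obtain R where R: "\<And>n. measure (M n) {v. R < norm v} < \<epsilon>" using tight by blast
    \<comment> \<open>Strictly larger than every \<open>\<bar>space_code v\<bar>\<close> with \<open>norm v \<le> R\<close>.\<close>
    define b where "b = 2 * \<bar>R\<bar> + 4"
    have "1 - \<epsilon> < measure (L n) {- b<..b}" for n
    proof -
      interpret prob_space "M n" using P by (rule prob_measuresD)
      have sp: "space (M n) = UNIV" using P by (rule prob_measuresD)
      have "1 - \<epsilon> < 1 - prob {v. R < norm v}" using R[of n] by simp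
      also have "\<dots> = prob (space (M n) - {v. R < norm v})"
        by (rule prob_compl[symmetric]) measurable
      also have "\<dots> \<le> prob (space_code -` {- b<..b} \<inter> space (M n))"
      proof (rule finite_measure_mono)
        have "- b < space_code v \<and> space_code v \<le> b" if "norm v \<le> R" for v :: 'a
        proof -
          have "\<bar>space_code v\<bar> \<le> 2 * norm v + 3" by (rule space_code_bounds)
          also have "\<dots> < b" using that by (simp add: b_def)
          finally show ?thesis by auto
        qed
        then show "space (M n) - {v. R < norm v} \<subseteq> space_code -` {- b<..b} \<inter> space (M n)"
          by (auto simp: not_less)
      qed measurable
      also have "\<dots> = measure (L n) {- b<..b}"
        unfolding L_def by (rule measure_distr[symmetric]) auto
      finally show ?thesis .
    qed
    then show "\<exists>a b. a < b \<and> (\<forall>n. 1 - \<epsilon> < measure (L n) {a<..b})"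
      by (intro exI[of _ "- b"] exI[of _ b]) (simp add: b_def)
  qed
  then obtain r K where r: "strict_mono (r :: nat \<Rightarrow> nat)" and K: "real_distribution K"
    and conv: "weak_conv_m (L \<circ> id \<circ> r) K"
    using tight_imp_convergent_subsubsequence[of L id] strict_mono_id by blast
  interpret K: real_distribution K by fact
  have curve_m[measurable]: "(space_curve :: real \<Rightarrow> 'a) \<in> borel_measurable borel"
    by (rule borel_measurable_continuous_onI) (rule continuous_space_curve)
  define N where "N = distr K borel (space_curve :: real \<Rightarrow> 'a)"
  have "N \<in> prob_measures"
    unfolding prob_measures_def N_def by (auto intro!: K.prob_space_distr)
  moreover have "(\<lambda>j. \<integral>v. f v \<partial>M (r j)) \<longlonglongrightarrow> (\<integral>v. f v \<partial>N)"
    if f: "continuous_on UNIV f" and B: "\<And>v. norm (f v) \<le> B" for f :: "'a \<Rightarrow> complex" and B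
  proof -
    have [measurable]: "f \<in> borel_measurable borel"
      by (rule borel_measurable_continuous_onI) (rule f)
    have "(\<lambda>j. \<integral>t. f (space_curve t) \<partial>((L \<circ> id \<circ> r) j)) \<longlonglongrightarrow> (\<integral>t. f (space_curve t) \<partial>K)"
    proof (rule weak_conv_imp_integral_bdd_continuous_conv)
      show "isCont (\<lambda>t. f (space_curve t)) t" for t
        using continuous_on_compose2[OF f continuous_space_curve]
        by (simp add: continuous_on_eq_continuous_at)
    qed (use L K conv B in \<open>auto simp: o_def\<close>)
    moreover have "(\<integral>t. f (space_curve t) \<partial>((L \<circ> id \<circ> r) j)) = (\<integral>v. f v \<partial>M (r j))" for j
      unfolding L_def by (simp add: integral_distr space_curve_code)
    moreover have "(\<integral>t. f (space_curve t) \<partial>K) = (\<integral>v. f v \<partial>N)"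
      unfolding N_def by (simp add: integral_distr)
    ultimately show ?thesis by simp
  qed
  ultimately show ?thesis using r by blast
qed

section \<open>Uniqueness of the Fourier transform\<close>

text \<open>
  Levy's uniqueness theorem for the law of \<open>v \<bullet> c\<close> under the probability measures with density \<open>w / Z\<close>.
  The lower bound on \<open>w\<close> keeps the normalising constant \<open>Z\<close> positive.
\<close>

lemma weighted_marginal_eq_aux:
  fixes \<mu> \<nu> :: "'a::euclidean_space measure" and w :: "'a \<Rightarrow> real"
  assumes P: "\<mu> \<in> prob_measures" "\<nu> \<in> prob_measures"
    and w[measurable]: "w \<in> borel_measurable borel" and w_bounds: "\<And>v. 1 \<le> w v" "\<And>v. w v \<le> 3"
    and cos_eq: "\<And>t. (\<integral>v. w v * cos (t * (v \<bullet> c)) \<partial>\<mu>) = (\<integral>v. w v * cos (t * (v \<bullet> c)) \<partial>\<nu>)"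
    and sin_eq: "\<And>t. (\<integral>v. w v * sin (t * (v \<bullet> c)) \<partial>\<mu>) = (\<integral>v. w v * sin (t * (v \<bullet> c)) \<partial>\<nu>)"
    and A[measurable]: "A \<in> sets borel"
  shows "(\<integral>v. w v * indicator A (v \<bullet> c) \<partial>\<mu>) = (\<integral>v. w v * indicator A (v \<bullet> c) \<partial>\<nu>)"
proof -
  define Z where "Z = (\<integral>v. w v \<partial>\<mu>)"
  have Z_eq: "Z = (\<integral>v. w v \<partial>\<nu>)" using cos_eq[of 0] by (simp add: Z_def)
  define N where "N = (\<lambda>\<rho>. distr (density \<rho> (\<lambda>v. ennreal (w v / Z))) borel (\<lambda>v. v \<bullet> c))"
  have *: "real_distribution (N \<rho>) \<and> 0 < Z \<and>
      char (N \<rho>) t = Complex ((\<integral>v. w v * cos (t * (v \<bullet> c)) \<partial>\<rho>) / Z) ((\<integral>v. w v * sin (t * (v \<bullet> c)) \<partial>\<rho>) / Z) \<and>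
      measure (N \<rho>) A = (\<integral>v. w v * indicator A (v \<bullet> c) \<partial>\<rho>) / Z"
    if \<rho>: "\<rho> \<in> prob_measures" and Z: "Z = (\<integral>v. w v \<partial>\<rho>)" for \<rho> t
  proof -
    interpret prob_space \<rho> using \<rho> by (rule prob_measuresD)
    have [measurable_cong]: "sets \<rho> = sets borel" using \<rho> by (rule prob_measuresD)
    have int: "integrable \<rho> (\<lambda>v. w v * g v)" if [measurable]: "g \<in> borel_measurable borel"
      and g: "\<And>v. \<bar>g v\<bar> \<le> 1" for g
    proof (rule prob_integrable_bounded[OF \<rho>, where B=3])
      fix v
      have "\<bar>w v\<bar> * \<bar>g v\<bar> \<le> 3 * 1"
        using w_bounds[of v] g[of v] by (intro mult_mono) auto
      then show "norm (w v * g v) \<le> 3" by (simp add: abs_mult)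
    qed measurable
    have int_w: "integrable \<rho> w" using int[of "\<lambda>_. 1"] by simp
    have "1 = (\<integral>v. (1::real) \<partial>\<rho>)" by (simp add: prob_space)
    also have "\<dots> \<le> Z" unfolding Z using w_bounds int_w by (intro integral_mono) auto
    finally have Z0: "0 < Z" by simp
    have w0: "0 \<le> w v / Z" for v using w_bounds(1)[of v] Z0 by simp
    have "prob_space (density \<rho> (\<lambda>v. ennreal (w v / Z)))"
    proof (rule prob_spaceI)
      have "emeasure (density \<rho> (\<lambda>v. ennreal (w v / Z))) (space (density \<rho> (\<lambda>v. ennreal (w v / Z)))) =
         (\<integral>\<^sup>+v. ennreal (w v / Z) \<partial>\<rho>)"
        by (subst emeasure_density) (auto intro!: nn_integral_cong simp: indicator_def)
      also have "\<dots> = ennreal (\<integral>v. w v / Z \<partial>\<rho>)"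
        using int_w w0 by (intro nn_integral_eq_integral) auto
      also have "(\<integral>v. w v / Z \<partial>\<rho>) = 1" using Z0 by (simp add: Z[symmetric])
      finally show "emeasure (density \<rho> (\<lambda>v. ennreal (w v / Z))) (space (density \<rho> (\<lambda>v. ennreal (w v / Z)))) = 1"
        by simp
    qed
    then have rd: "real_distribution (N \<rho>)"
      unfolding N_def by (intro real_distribution.intro prob_space.prob_space_distr real_distribution_axioms.intro) auto
    interpret N: real_distribution "N \<rho>" by (rule rd)
    have ci: "integrable \<rho> (\<lambda>v. (w v / Z) *\<^sub>R iexp (t * (v \<bullet> c)))"
    proof (rule prob_integrable_bounded[OF \<rho>, where B="3 / Z"])
      show "norm ((w v / Z) *\<^sub>R iexp (t * (v \<bullet> c))) \<le> 3 / Z" for v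
        using w0[of v] w_bounds[of v] Z0 by (simp add: divide_right_mono)
    qed measurable
    have ch: "char (N \<rho>) t = (CLINT v|\<rho>. (w v / Z) *\<^sub>R iexp (t * (v \<bullet> c)))"
      unfolding char_def N_def using w0
      by (subst integral_distr) (auto simp: integral_density)
    have "char (N \<rho>) t = Complex ((\<integral>v. w v * cos (t * (v \<bullet> c)) \<partial>\<rho>) / Z) ((\<integral>v. w v * sin (t * (v \<bullet> c)) \<partial>\<rho>) / Z)"
    proof (rule complex_eqI)
      have "Re (char (N \<rho>) t) = (\<integral>v. Re ((w v / Z) *\<^sub>R iexp (t * (v \<bullet> c))) \<partial>\<rho>)"
        unfolding ch by (rule integral_Re[symmetric, OF ci])
      then show "Re (char (N \<rho>) t) = Re (Complex ((\<integral>v. w v * cos (t * (v \<bullet> c)) \<partial>\<rho>) / Z) ((\<integral>v. w v * sin (t * (v \<bullet> c)) \<partial>\<rho>) / Z))"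
        by (simp add: Re_exp)
      have "Im (char (N \<rho>) t) = (\<integral>v. Im ((w v / Z) *\<^sub>R iexp (t * (v \<bullet> c))) \<partial>\<rho>)"
        unfolding ch by (rule integral_Im[symmetric, OF ci])
      then show "Im (char (N \<rho>) t) = Im (Complex ((\<integral>v. w v * cos (t * (v \<bullet> c)) \<partial>\<rho>) / Z) ((\<integral>v. w v * sin (t * (v \<bullet> c)) \<partial>\<rho>) / Z))"
        by (simp add: Im_exp)
    qed
    moreover have "measure (N \<rho>) A = (\<integral>v. w v * indicator A (v \<bullet> c) \<partial>\<rho>) / Z"
    proof -
      have "measure (N \<rho>) A = (\<integral>x. indicator A x \<partial>N \<rho>)" by simp
      also have "\<dots> = (\<integral>v. (w v / Z) *\<^sub>R indicator A (v \<bullet> c) \<partial>\<rho>)"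
        unfolding N_def using w0 by (subst integral_distr) (auto simp: integral_density)
      also have "\<dots> = (\<integral>v. w v * indicator A (v \<bullet> c) \<partial>\<rho>) / Z" by simp
      finally show ?thesis .
    qed
    ultimately show ?thesis using rd Z0 by simp
  qed
  note \<mu> = *[OF P(1) Z_def] and \<nu> = *[OF P(2) Z_eq]
  have "char (N \<mu>) = char (N \<nu>)"
    using \<mu> \<nu> by (intro ext) (simp add: cos_eq sin_eq)
  then have "N \<mu> = N \<nu>" using \<mu> \<nu> by (intro Levy_uniqueness) auto
  then show ?thesis using \<mu>[of 0] \<nu>[of 0] by simp
qed

text \<open>
  Since \<open>h\<close> may change sign, \<open>2 + h\<close> is taken as the weight, and the contribution of the constant weight is
  subtracted.
\<close>

lemma weighted_marginal_eq:
  fixes \<mu> \<nu> :: "'a::euclidean_space measure" and h :: "'a \<Rightarrow> real"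
  assumes P: "\<mu> \<in> prob_measures" "\<nu> \<in> prob_measures"
    and h[measurable]: "h \<in> borel_measurable borel" and h_bound: "\<And>v. \<bar>h v\<bar> \<le> 1"
    and cos_eq: "\<And>t. (\<integral>v. cos (t * (v \<bullet> c)) \<partial>\<mu>) = (\<integral>v. cos (t * (v \<bullet> c)) \<partial>\<nu>)"
    and sin_eq: "\<And>t. (\<integral>v. sin (t * (v \<bullet> c)) \<partial>\<mu>) = (\<integral>v. sin (t * (v \<bullet> c)) \<partial>\<nu>)"
    and h_cos_eq: "\<And>t. (\<integral>v. h v * cos (t * (v \<bullet> c)) \<partial>\<mu>) = (\<integral>v. h v * cos (t * (v \<bullet> c)) \<partial>\<nu>)"
    and h_sin_eq: "\<And>t. (\<integral>v. h v * sin (t * (v \<bullet> c)) \<partial>\<mu>) = (\<integral>v. h v * sin (t * (v \<bullet> c)) \<partial>\<nu>)"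
    and A[measurable]: "A \<in> sets borel"
  shows "(\<integral>v. h v * indicator A (v \<bullet> c) \<partial>\<mu>) = (\<integral>v. h v * indicator A (v \<bullet> c) \<partial>\<nu>)"
proof -
  have split: "(\<integral>v. (2 + h v) * g v \<partial>\<rho>) = 2 * (\<integral>v. g v \<partial>\<rho>) + (\<integral>v. h v * g v \<partial>\<rho>)"
    if \<rho>: "\<rho> \<in> prob_measures" and [measurable]: "g \<in> borel_measurable borel" and g: "\<And>v. \<bar>g v\<bar> \<le> 1"
    for \<rho> and g :: "'a \<Rightarrow> real"
  proof -
    have "integrable \<rho> g" using g by (intro prob_integrable_bounded[OF \<rho>, where B=1]) auto
    moreover have "integrable \<rho> (\<lambda>v. h v * g v)"
      using g h_bound by (intro prob_integrable_bounded[OF \<rho>, where B=1]) (auto simp: abs_mult intro!: mult_le_one)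
    ultimately show ?thesis by (simp add: distrib_right)
  qed
  have "(\<integral>v. (2 + h v) * indicator A (v \<bullet> c) \<partial>\<mu>) = (\<integral>v. (2 + h v) * indicator A (v \<bullet> c) \<partial>\<nu>)"
  proof (rule weighted_marginal_eq_aux[OF P])
    show "1 \<le> 2 + h v" "2 + h v \<le> 3" for v using h_bound[of v] by auto
  qed (use P in \<open>auto simp: split cos_eq sin_eq h_cos_eq h_sin_eq\<close>)
  moreover have "(\<integral>v. (1::real) * indicator A (v \<bullet> c) \<partial>\<mu>) = (\<integral>v. 1 * indicator A (v \<bullet> c) \<partial>\<nu>)"
    by (rule weighted_marginal_eq_aux[OF P, where w="\<lambda>_. 1"]) (auto simp: cos_eq sin_eq)
  ultimately show ?thesis
    using P by (simp add: split indicator_def[abs_def] del: integral_indicator)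
qed

lemma fourier_eq_imp_integral_cos_eq:
  fixes \<mu> \<nu> :: "'a::euclidean_space measure"
  assumes P: "\<mu> \<in> prob_measures" "\<nu> \<in> prob_measures" and eq: "\<And>\<xi>. fourier \<mu> \<xi> = fourier \<nu> \<xi>"
  shows "(\<integral>v. cos (\<xi> \<bullet> v + \<theta>) \<partial>\<mu>) = (\<integral>v. cos (\<xi> \<bullet> v + \<theta>) \<partial>\<nu>)"
proof -
  have "(\<integral>v. cos (\<xi> \<bullet> v + \<theta>) \<partial>\<rho>) = cos \<theta> * Re (fourier \<rho> \<xi>) + sin \<theta> * Im (fourier \<rho> \<xi>)"
    if \<rho>: "\<rho> \<in> prob_measures" for \<rho>
  proof -
    have "integrable \<rho> (\<lambda>v. cos (\<xi> \<bullet> v))" "integrable \<rho> (\<lambda>v. sin (\<xi> \<bullet> v))"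
      by (auto intro!: prob_integrable_bounded[OF \<rho>, where B=1])
    then show ?thesis
      unfolding Re_fourier[OF \<rho>] Im_fourier[OF \<rho>] by (simp add: cos_add mult.commute)
  qed
  then show ?thesis using P eq by simp
qed

text \<open>
  Induction on the number of coordinates. Keeping a cosine with arbitrary frequency and phase in the
  statement makes the induction work: its product with \<open>cos (t * (v \<bullet> c))\<close> or \<open>sin (t * (v \<bullet> c))\<close> is again a sum of
  such cosines, so the induction hypothesis provides the premises of \<open>weighted_marginal_eq\<close>.
\<close>

lemma fourier_eq_imp_integral_rectangle_eq:
  fixes \<mu> \<nu> :: "'a::euclidean_space measure" and A :: "'a \<Rightarrow> real set"
  assumes P: "\<mu> \<in> prob_measures" "\<nu> \<in> prob_measures" and eq: "\<And>\<xi>. fourier \<mu> \<xi> = fourier \<nu> \<xi>"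
    and "finite B" and A: "\<And>b. A b \<in> sets borel"
  shows "(\<integral>v. (\<Prod>b\<in>B. indicator (A b) (v \<bullet> b)) * cos (\<xi> \<bullet> v + \<theta>) \<partial>\<mu>) =
    (\<integral>v. (\<Prod>b\<in>B. indicator (A b) (v \<bullet> b)) * cos (\<xi> \<bullet> v + \<theta>) \<partial>\<nu>)"
  using \<open>finite B\<close>
proof (induction B arbitrary: \<xi> \<theta> rule: finite_induct)
  case empty
  show ?case using fourier_eq_imp_integral_cos_eq[OF P eq] by simp
next
  case (insert c B)
  note [measurable] = A
  define q where "q = (\<lambda>v::'a. \<Prod>b\<in>B. indicator (A b) (v \<bullet> b) :: real)"
  have q_m[measurable]: "q \<in> borel_measurable borel" unfolding q_def by measurable
  have q: "0 \<le> q v" "q v \<le> 1" for v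
    unfolding q_def by (auto intro!: prod_nonneg prod_le_1 simp: indicator_def)
  have IH: "(\<integral>v. q v * cos (\<xi> \<bullet> v + \<theta>) \<partial>\<mu>) = (\<integral>v. q v * cos (\<xi> \<bullet> v + \<theta>) \<partial>\<nu>)" for \<xi> \<theta>
    using insert.IH by (simp add: q_def)
  have int: "integrable \<rho> (\<lambda>v. q v * cos (\<xi> \<bullet> v + \<theta>))" if "\<rho> \<in> prob_measures" for \<rho> \<xi> \<theta>
    using q by (intro prob_integrable_bounded[OF that, where B=1]) (auto simp: abs_mult intro!: mult_le_one)
  have half_sum: "(\<integral>v. q v * cos (\<xi> \<bullet> v + \<theta>) * cos (t * (v \<bullet> c) + s) \<partial>\<rho>) =
     ((\<integral>v. q v * cos ((\<xi> + t *\<^sub>R c) \<bullet> v + (\<theta> + s)) \<partial>\<rho>) +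
     (\<integral>v. q v * cos ((\<xi> - t *\<^sub>R c) \<bullet> v + (\<theta> - s)) \<partial>\<rho>)) / 2"
    if "\<rho> \<in> prob_measures" for \<rho> t s
  proof -
    have product: "q v * cos (\<xi> \<bullet> v + \<theta>) * cos (t * (v \<bullet> c) + s) =
        (q v * cos ((\<xi> + t *\<^sub>R c) \<bullet> v + (\<theta> + s)) + q v * cos ((\<xi> - t *\<^sub>R c) \<bullet> v + (\<theta> - s))) / 2" for v
    proof -
      have "cos (\<xi> \<bullet> v + \<theta>) * cos (t * (v \<bullet> c) + s) =
        (cos ((\<xi> \<bullet> v + \<theta>) - (t * (v \<bullet> c) + s)) + cos ((\<xi> \<bullet> v + \<theta>) + (t * (v \<bullet> c) + s))) / 2"
        by (rule cos_times_cos)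
      then show ?thesis
        by (simp add: inner_add_left inner_diff_left inner_commute[of c] algebra_simps)
    qed
    show ?thesis unfolding product by (simp add: int[OF that])
  qed
  have "(\<integral>v. q v * cos (\<xi> \<bullet> v + \<theta>) * indicator (A c) (v \<bullet> c) \<partial>\<mu>) =
    (\<integral>v. q v * cos (\<xi> \<bullet> v + \<theta>) * indicator (A c) (v \<bullet> c) \<partial>\<nu>)"
  proof (rule weighted_marginal_eq[OF P])
    show "\<bar>q v * cos (\<xi> \<bullet> v + \<theta>)\<bar> \<le> 1" for v
      using q[of v] by (auto simp: abs_mult intro!: mult_le_one)
    \<comment> \<open>The sine is a cosine with shifted phase, so that \<open>half_sum\<close> covers both cases.\<close>
    have sc: "sin x = cos (x + - (pi / 2))" for x :: real
      by (simp add: cos_diff)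
    fix t
    show "(\<integral>v. cos (t * (v \<bullet> c)) \<partial>\<mu>) = (\<integral>v. cos (t * (v \<bullet> c)) \<partial>\<nu>)"
      using fourier_eq_imp_integral_cos_eq[OF P eq, of "t *\<^sub>R c" 0] by (simp add: inner_commute)
    show "(\<integral>v. sin (t * (v \<bullet> c)) \<partial>\<mu>) = (\<integral>v. sin (t * (v \<bullet> c)) \<partial>\<nu>)"
      unfolding sc using fourier_eq_imp_integral_cos_eq[OF P eq, of "t *\<^sub>R c" "- (pi / 2)"] by (simp add: inner_commute)
    show "(\<integral>v. q v * cos (\<xi> \<bullet> v + \<theta>) * cos (t * (v \<bullet> c)) \<partial>\<mu>) = (\<integral>v. q v * cos (\<xi> \<bullet> v + \<theta>) * cos (t * (v \<bullet> c)) \<partial>\<nu>)"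
      using half_sum[OF P(1), of t 0] half_sum[OF P(2), of t 0] by (simp add: IH)
    show "(\<integral>v. q v * cos (\<xi> \<bullet> v + \<theta>) * sin (t * (v \<bullet> c)) \<partial>\<mu>) = (\<integral>v. q v * cos (\<xi> \<bullet> v + \<theta>) * sin (t * (v \<bullet> c)) \<partial>\<nu>)"
      unfolding sc using half_sum[OF P(1), of t "- (pi / 2)"] half_sum[OF P(2), of t "- (pi / 2)"] by (simp only: IH)
  qed (auto simp: A)
  then show ?case
    using insert.hyps by (simp add: q_def mult_ac)
qed

theorem fourier_unique:
  fixes \<mu> \<nu> :: "'a::euclidean_space measure"
  assumes P: "\<mu> \<in> prob_measures" "\<nu> \<in> prob_measures" and eq: "\<And>\<xi>. fourier \<mu> \<xi> = fourier \<nu> \<xi>"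
  shows "\<mu> = \<nu>"
proof (rule measure_eqI_generator_eq)
  let ?E = "range (\<lambda>(a, b). box a b :: 'a set)"
  have box: "emeasure \<rho> (box a b) = ennreal (\<integral>v. (\<Prod>i\<in>Basis. indicator {a \<bullet> i<..<b \<bullet> i} (v \<bullet> i)) * cos (0 \<bullet> v + 0) \<partial>\<rho>)"
    if \<rho>: "\<rho> \<in> prob_measures" for \<rho> and a b :: 'a
  proof -
    interpret prob_space \<rho> using \<rho> by (rule prob_measuresD)
    have s: "sets \<rho> = sets borel" using \<rho> by (rule prob_measuresD)
    have "(\<Prod>i\<in>Basis. indicator {a \<bullet> i<..<b \<bullet> i} (v \<bullet> i) :: real) = indicator (box a b) v" for v
      by (cases "v \<in> box a b") (auto simp: box_def indicator_def intro!: prod.neutral prod_zero)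
    then show ?thesis
      using s by (simp add: emeasure_eq_measure)
  qed
  show "emeasure \<mu> X = emeasure \<nu> X" if "X \<in> ?E" for X
    using that fourier_eq_imp_integral_rectangle_eq[OF P eq finite_Basis, of _ 0 0] by (auto simp: box P)
  show "Int_stable ?E"
    by (force simp: Int_stable_def box_Int_box)
  show "sets \<mu> = sigma_sets UNIV ?E" "sets \<nu> = sigma_sets UNIV ?E"
    using P by (simp_all add: prob_measuresD(2) borel_eq_box)
  let ?A = "\<lambda>n::nat. box (- (real n *\<^sub>R One)) (real n *\<^sub>R One) :: 'a set"
  show "range ?A \<subseteq> ?E" "(\<Union>i. ?A i) = UNIV"
    unfolding UN_box_eq_UNIV by auto
  fix i
  interpret prob_space \<mu> using P(1) by (rule prob_measuresD)
  show "emeasure \<mu> (?A i) \<noteq> \<infinity>" by simp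
qed auto

section \<open>Lower semicontinuous seminorms and completeness\<close>

text \<open>
  What the completeness argument uses of a norm of differences of Fourier transforms: it is a symmetric,
  subadditive functional with values in \<open>[0, \<infinity>]\<close> that obeys Fatou's lemma under pointwise convergence.
  The property passes to sums, so the two parts of a distance can be treated separately.
\<close>

definition fatou_seminorm :: "(('a::euclidean_space \<Rightarrow> complex) \<Rightarrow> ennreal) \<Rightarrow> bool"
  where "fatou_seminorm E \<longleftrightarrow>
    E (\<lambda>_. 0) = 0 \<and> (\<forall>f. E (\<lambda>\<xi>. - f \<xi>) = E f) \<and>
    (\<forall>f\<in>borel_measurable borel. \<forall>g\<in>borel_measurable borel. E (\<lambda>\<xi>. f \<xi> + g \<xi>) \<le> E f + E g) \<and>
    (\<forall>f F. (\<forall>j. F j \<in> borel_measurable borel) \<longrightarrow> (\<forall>\<xi>. (\<lambda>j. F j \<xi>) \<longlonglongrightarrow> f \<xi>) \<longrightarrow>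
      E f \<le> liminf (\<lambda>j. E (F j)))"

lemma
  assumes "fatou_seminorm E"
  shows fatou_seminorm_zero: "E (\<lambda>_. 0) = 0"
    and fatou_seminorm_minus: "E (\<lambda>\<xi>. - f \<xi>) = E f"
    and fatou_seminorm_triangle: "f \<in> borel_measurable borel \<Longrightarrow> g \<in> borel_measurable borel \<Longrightarrow>
      E (\<lambda>\<xi>. f \<xi> + g \<xi>) \<le> E f + E g"
    and fatou_seminorm_liminf: "(\<And>j. F j \<in> borel_measurable borel) \<Longrightarrow>
      (\<And>\<xi>. (\<lambda>j. F j \<xi>) \<longlonglongrightarrow> f \<xi>) \<Longrightarrow> E f \<le> liminf (\<lambda>j. E (F j))"
  using assms unfolding fatou_seminorm_def by blast+

lemma ennreal_liminf_add_le:
  fixes a b :: "nat \<Rightarrow> ennreal"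
  shows "liminf a + liminf b \<le> liminf (\<lambda>j. a j + b j)"
proof -
  have "liminf a + liminf b = (SUP n. (INF m\<in>{n..}. a m) + (INF m\<in>{n..}. b m))"
    unfolding liminf_SUP_INF
    by (intro ennreal_SUP_add[symmetric] monoI INF_superset_mono) auto
  also have "\<dots> \<le> liminf (\<lambda>j. a j + b j)"
    unfolding liminf_SUP_INF
  proof (rule SUP_mono)
    fix n :: nat
    show "\<exists>i\<in>UNIV. (INF m\<in>{n..}. a m) + (INF m\<in>{n..}. b m) \<le> (INF m\<in>{i..}. a m + b m)"
      by (intro bexI[of _ n] INF_greatest add_mono INF_lower) auto
  qed
  finally show ?thesis .
qed

lemma fatou_seminorm_add:
  assumes "fatou_seminorm E1" "fatou_seminorm E2"
  shows "fatou_seminorm (\<lambda>f. E1 f + E2 f)"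
  unfolding fatou_seminorm_def
proof (intro conjI allI ballI impI)
  fix f g :: "'a \<Rightarrow> complex" assume "f \<in> borel_measurable borel" "g \<in> borel_measurable borel"
  then have "E1 (\<lambda>\<xi>. f \<xi> + g \<xi>) + E2 (\<lambda>\<xi>. f \<xi> + g \<xi>) \<le> (E1 f + E1 g) + (E2 f + E2 g)"
    by (intro add_mono fatou_seminorm_triangle assms)
  then show "E1 (\<lambda>\<xi>. f \<xi> + g \<xi>) + E2 (\<lambda>\<xi>. f \<xi> + g \<xi>) \<le> E1 f + E2 f + (E1 g + E2 g)"
    by (simp add: add_ac)
next
  fix f and F :: "nat \<Rightarrow> 'a \<Rightarrow> complex"
  assume "\<forall>j. F j \<in> borel_measurable borel" "\<forall>\<xi>. (\<lambda>j. F j \<xi>) \<longlonglongrightarrow> f \<xi>"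
  then have "E1 f + E2 f \<le> liminf (\<lambda>j. E1 (F j)) + liminf (\<lambda>j. E2 (F j))"
    using assms by (intro add_mono fatou_seminorm_liminf) blast+
  also note ennreal_liminf_add_le
  finally show "E1 f + E2 f \<le> liminf (\<lambda>j. E1 (F j) + E2 (F j))" .
qed (simp_all add: fatou_seminorm_zero[OF assms(1)] fatou_seminorm_zero[OF assms(2)]
    fatou_seminorm_minus[OF assms(1)] fatou_seminorm_minus[OF assms(2)])

lemma fatou_seminorm_weighted_SUP:
  fixes w :: "'a::euclidean_space \<Rightarrow> real"
  assumes w: "\<And>\<xi>. 0 \<le> w \<xi>" and X: "X \<noteq> {}"
  shows "fatou_seminorm (\<lambda>f. SUP \<xi>\<in>X. ennreal (norm (f \<xi>) / w \<xi>))"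
  unfolding fatou_seminorm_def
proof (intro conjI allI ballI impI)
  fix f g :: "'a \<Rightarrow> complex"
  show "(SUP \<xi>\<in>X. ennreal (norm (f \<xi> + g \<xi>) / w \<xi>)) \<le>
      (SUP \<xi>\<in>X. ennreal (norm (f \<xi>) / w \<xi>)) + (SUP \<xi>\<in>X. ennreal (norm (g \<xi>) / w \<xi>))"
  proof (rule SUP_least)
    fix \<xi> assume \<xi>: "\<xi> \<in> X"
    have "norm (f \<xi> + g \<xi>) / w \<xi> \<le> norm (f \<xi>) / w \<xi> + norm (g \<xi>) / w \<xi>"
      unfolding add_divide_distrib[symmetric] using w by (intro divide_right_mono norm_triangle_ineq)
    then have "ennreal (norm (f \<xi> + g \<xi>) / w \<xi>) \<le> ennreal (norm (f \<xi>) / w \<xi>) + ennreal (norm (g \<xi>) / w \<xi>)"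
      using w by (subst ennreal_plus[symmetric]) (simp_all add: ennreal_leI del: ennreal_plus)
    also have "\<dots> \<le> (SUP \<xi>\<in>X. ennreal (norm (f \<xi>) / w \<xi>)) + (SUP \<xi>\<in>X. ennreal (norm (g \<xi>) / w \<xi>))"
      using \<xi> by (intro add_mono SUP_upper)
    finally show "ennreal (norm (f \<xi> + g \<xi>) / w \<xi>) \<le>
      (SUP \<xi>\<in>X. ennreal (norm (f \<xi>) / w \<xi>)) + (SUP \<xi>\<in>X. ennreal (norm (g \<xi>) / w \<xi>))" .
  qed
next
  fix f and F :: "nat \<Rightarrow> 'a \<Rightarrow> complex"
  assume lim: "\<forall>\<xi>. (\<lambda>j. F j \<xi>) \<longlonglongrightarrow> f \<xi>"
  show "(SUP \<xi>\<in>X. ennreal (norm (f \<xi>) / w \<xi>)) \<le> liminf (\<lambda>j. SUP \<xi>\<in>X. ennreal (norm (F j \<xi>) / w \<xi>))"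
  proof (rule SUP_least)
    fix \<xi> assume \<xi>: "\<xi> \<in> X"
    have "(\<lambda>j. ennreal (norm (F j \<xi>) / w \<xi>)) \<longlonglongrightarrow> ennreal (norm (f \<xi>) / w \<xi>)"
      unfolding divide_inverse using lim by (intro tendsto_ennrealI tendsto_intros) auto
    then have "ennreal (norm (f \<xi>) / w \<xi>) = liminf (\<lambda>j. ennreal (norm (F j \<xi>) / w \<xi>))"
      by (intro lim_imp_Liminf[symmetric]) auto
    also have "\<dots> \<le> liminf (\<lambda>j. SUP \<xi>\<in>X. ennreal (norm (F j \<xi>) / w \<xi>))"
      using \<xi> by (intro Liminf_mono always_eventually allI SUP_upper)
    finally show "ennreal (norm (f \<xi>) / w \<xi>) \<le> liminf (\<lambda>j. SUP \<xi>\<in>X. ennreal (norm (F j \<xi>) / w \<xi>))" .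
  qed
qed (simp_all add: X)

lemma fatou_seminorm_diff_norm:
  fixes T :: "complex \<Rightarrow> 'b::{real_normed_field, second_countable_topology}"
  assumes T: "bounded_linear T"
  shows "fatou_seminorm (\<lambda>f::'a::euclidean_space \<Rightarrow> complex. diff_norm \<alpha> k (\<lambda>\<xi>. T (f \<xi>)))"
proof -
  interpret bounded_linear T by (rule T)
  have T_m[measurable]: "T \<in> borel_measurable borel"
    by (intro borel_measurable_continuous_onI continuous_on) auto
  show ?thesis
    unfolding fatou_seminorm_def
  proof (intro conjI allI ballI impI)
    have fd0: "fin_diff k (\<lambda>_. 0 :: 'b) \<xi> = 0" for \<xi> :: 'a by (simp add: fin_diff_def)
    have minus: "fin_diff k (\<lambda>\<xi>. - \<phi> \<xi>) \<xi> = - fin_diff k \<phi> \<xi>" for \<phi> :: "'a \<Rightarrow> 'b" and \<xi>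
      by (simp add: fin_diff_def sum_negf)
    show "diff_norm \<alpha> k (\<lambda>\<xi>::'a. T 0) = 0"
      by (simp add: diff_norm_def fd0 zero)
    fix f g :: "'a \<Rightarrow> complex"
    show "diff_norm \<alpha> k (\<lambda>\<xi>. T (- f \<xi>)) = diff_norm \<alpha> k (\<lambda>\<xi>. T (f \<xi>))"
      by (simp add: diff_norm_def minus neg)
    assume [measurable]: "f \<in> borel_measurable borel" "g \<in> borel_measurable borel"
    have "diff_norm \<alpha> k (\<lambda>\<xi>. T (f \<xi>) - T (- g \<xi>)) \<le>
        diff_norm \<alpha> k (\<lambda>\<xi>. T (f \<xi>)) + diff_norm \<alpha> k (\<lambda>\<xi>. T (- g \<xi>))"
      by (intro diff_norm_diff_le) measurable
    then show "diff_norm \<alpha> k (\<lambda>\<xi>. T (f \<xi> + g \<xi>)) \<le>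
        diff_norm \<alpha> k (\<lambda>\<xi>. T (f \<xi>)) + diff_norm \<alpha> k (\<lambda>\<xi>. T (g \<xi>))"
      by (simp add: diff_norm_def minus neg add)
  next
    fix f and F :: "nat \<Rightarrow> 'a \<Rightarrow> complex"
    assume F: "\<forall>j. F j \<in> borel_measurable borel" and lim: "\<forall>\<xi>. (\<lambda>j. F j \<xi>) \<longlonglongrightarrow> f \<xi>"
    have [measurable]: "F j \<in> borel_measurable borel" for j using F by blast
    let ?w = "\<lambda>\<xi>::'a. norm \<xi> powr (real DIM('a) + \<alpha>)"
    let ?u = "\<lambda>j \<xi>. ennreal (norm (fin_diff k (\<lambda>\<xi>. T (F j \<xi>)) \<xi>) / ?w \<xi>)"
    have "(\<lambda>j. ?u j \<xi>) \<longlonglongrightarrow> ennreal (norm (fin_diff k (\<lambda>\<xi>. T (f \<xi>)) \<xi>) / ?w \<xi>)" for \<xi>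
      unfolding divide_inverse fin_diff_def
      using lim by (intro tendsto_ennrealI tendsto_intros tendsto) auto
    then have "ennreal (norm (fin_diff k (\<lambda>\<xi>. T (f \<xi>)) \<xi>) / ?w \<xi>) = liminf (\<lambda>j. ?u j \<xi>)" for \<xi>
      by (intro lim_imp_Liminf[symmetric]) auto
    then have "diff_norm \<alpha> k (\<lambda>\<xi>. T (f \<xi>)) = (\<integral>\<^sup>+\<xi>. liminf (\<lambda>j. ?u j \<xi>) \<partial>lborel)"
      unfolding diff_norm_def by simp
    also have "\<dots> \<le> liminf (\<lambda>j. \<integral>\<^sup>+\<xi>. ?u j \<xi> \<partial>lborel)"
      by (rule nn_integral_liminf) measurable
    finally show "diff_norm \<alpha> k (\<lambda>\<xi>. T (f \<xi>)) \<le> liminf (\<lambda>j. diff_norm \<alpha> k (\<lambda>\<xi>. T (F j \<xi>)))"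
      unfolding diff_norm_def .
  qed
qed

text \<open>
  Lower semicontinuity of the distance along a subsequence suffices to pass from a Cauchy sequence to a
  limit. Symmetry is assumed for all points of the type, since \<^locale>\<open>Metric_space\<close> demands it outside
  the carrier, too.
\<close>

lemma complete_metric_onI:
  fixes S :: "'m set"
  assumes fin: "\<And>x y. x \<in> S \<Longrightarrow> y \<in> S \<Longrightarrow> d x y < \<infinity>"
    and sym: "\<And>x y. d x y = d y x"
    and refl: "\<And>x. x \<in> S \<Longrightarrow> d x x = 0"
    and sep: "\<And>x y. x \<in> S \<Longrightarrow> y \<in> S \<Longrightarrow> d x y = 0 \<Longrightarrow> x = y"
    and tri: "\<And>x y z. x \<in> S \<Longrightarrow> y \<in> S \<Longrightarrow> z \<in> S \<Longrightarrow> d x z \<le> d x y + d y z"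
    and lim: "\<And>\<sigma> :: nat \<Rightarrow> 'm. range \<sigma> \<subseteq> S \<Longrightarrow>
      (\<And>\<epsilon>. 0 < \<epsilon> \<Longrightarrow> \<exists>N. \<forall>m\<ge>N. \<forall>n\<ge>N. d (\<sigma> m) (\<sigma> n) < ennreal \<epsilon>) \<Longrightarrow>
      \<exists>l\<in>S. \<exists>r. strict_mono r \<and> (\<forall>n. d (\<sigma> n) l \<le> liminf (\<lambda>j. d (\<sigma> n) (\<sigma> (r j))))"
  shows "complete_metric_on S d"
proof -
  let ?d = "\<lambda>x y. enn2real (d x y)"
  have ed: "ennreal (?d x y) = d x y" if "x \<in> S" "y \<in> S" for x y
    using fin[OF that] by simp
  have M: "Metric_space S ?d"
  proof
    fix x y z
    show "0 \<le> ?d x y" by simp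
    show "?d x y = ?d y x" by (simp add: sym[of x y])
    show "?d x y = 0 \<longleftrightarrow> x = y" if "x \<in> S" "y \<in> S"
    proof
      assume "?d x y = 0"
      then show "x = y" using ed[OF that] sep[OF that] by simp
    qed (use refl that in auto)
    show "?d x z \<le> ?d x y + ?d y z" if "x \<in> S" "y \<in> S" "z \<in> S"
    proof -
      have "ennreal (?d x z) \<le> ennreal (?d x y + ?d y z)"
        using tri[OF that] that by (simp add: ed ennreal_plus)
      then show ?thesis by (subst (asm) ennreal_le_iff) auto
    qed
  qed
  interpret Metric_space S ?d by (rule M)
  have "mcomplete"
    unfolding mcomplete_def
  proof (intro allI impI)
    fix \<sigma> assume C: "MCauchy \<sigma>"
    then have S: "range \<sigma> \<subseteq> S" by (simp add: MCauchy_def)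
    then have S': "\<sigma> n \<in> S" for n by auto
    have cauchy: "\<exists>N. \<forall>m\<ge>N. \<forall>n\<ge>N. d (\<sigma> m) (\<sigma> n) < ennreal \<epsilon>" if "0 < \<epsilon>" for \<epsilon>
    proof -
      have "\<exists>N. \<forall>n n'. N \<le> n \<longrightarrow> N \<le> n' \<longrightarrow> ?d (\<sigma> n) (\<sigma> n') < \<epsilon>"
        using C[unfolded MCauchy_def, THEN conjunct2] that by simp
      then obtain N where N: "\<forall>n n'. N \<le> n \<longrightarrow> N \<le> n' \<longrightarrow> ?d (\<sigma> n) (\<sigma> n') < \<epsilon>" ..
      have "d (\<sigma> m) (\<sigma> n) < ennreal \<epsilon>" if "N \<le> m" "N \<le> n" for m n
        using ennreal_lessI[OF \<open>0 < \<epsilon>\<close> N[rule_format, OF that]] unfolding ed[OF S' S'] .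
      then show ?thesis by (intro exI[of _ N]) simp
    qed
    have "\<exists>l\<in>S. \<exists>r. strict_mono r \<and> (\<forall>n. d (\<sigma> n) l \<le> liminf (\<lambda>j. d (\<sigma> n) (\<sigma> (r j))))"
      using S by (rule lim) (rule cauchy)
    then obtain l r where l: "l \<in> S" and r: "strict_mono r"
      and lsc: "\<And>n. d (\<sigma> n) l \<le> liminf (\<lambda>j. d (\<sigma> n) (\<sigma> (r j)))"
      by blast
    have "\<exists>N. \<forall>n\<ge>N. \<sigma> n \<in> S \<and> ?d (\<sigma> n) l < \<epsilon>" if \<epsilon>: "0 < \<epsilon>" for \<epsilon>
    proof -
      obtain N where N: "\<And>m n. N \<le> m \<Longrightarrow> N \<le> n \<Longrightarrow> d (\<sigma> m) (\<sigma> n) < ennreal (\<epsilon> / 2)"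
        using cauchy[of "\<epsilon> / 2"] \<epsilon> by auto
      have "?d (\<sigma> n) l < \<epsilon>" if "N \<le> n" for n
      proof -
        have "liminf (\<lambda>j. d (\<sigma> n) (\<sigma> (r j))) \<le> liminf (\<lambda>j. ennreal (\<epsilon> / 2))"
        proof (rule Liminf_mono)
          show "\<forall>\<^sub>F j in sequentially. d (\<sigma> n) (\<sigma> (r j)) \<le> ennreal (\<epsilon> / 2)"
          proof (rule eventually_sequentiallyI)
            fix j assume "N \<le> j"
            also have "j \<le> r j" using r by (rule seq_suble)
            finally show "d (\<sigma> n) (\<sigma> (r j)) \<le> ennreal (\<epsilon> / 2)"
              by (intro less_imp_le[OF N] that)
          qed
        qed
        also have "\<dots> = ennreal (\<epsilon> / 2)" by (rule Liminf_const) simp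
        finally have "ennreal (?d (\<sigma> n) l) \<le> ennreal (\<epsilon> / 2)"
          using lsc[of n] unfolding ed[OF S' l, of n] by simp
        then show ?thesis using \<epsilon> by (subst (asm) ennreal_le_iff) auto
      qed
      then show ?thesis using S' by blast
    qed
    then show "\<exists>x. limitin mtopology \<sigma> x sequentially"
      using l unfolding limit_metric_sequentially by blast
  qed
  then show ?thesis using M fin by (simp add: complete_metric_on_def)
qed

lemma moment_bounded_imp_tight:
  assumes P: "\<And>n. M n \<in> prob_measures" and \<alpha>: "0 < \<alpha>"
    and K: "\<And>n. moment \<alpha> (M n) \<le> ennreal K" "0 \<le> K" and \<epsilon>: "0 < \<epsilon>"
  shows "\<exists>R. \<forall>n. measure (M n) {v::'a::euclidean_space. R < norm v} < \<epsilon>"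
proof -
  \<comment> \<open>Markov's inequality bounds the mass outside this radius by \<open>K * \<epsilon> / (K + 1) < \<epsilon>\<close>.\<close>
  define R where "R = ((K + 1) / \<epsilon>) powr (1 / \<alpha>)"
  have R: "R powr \<alpha> = (K + 1) / \<epsilon>" "0 < R" using K(2) \<epsilon> \<alpha> by (auto simp: R_def powr_powr)
  have "measure (M n) {v. R < norm v} < \<epsilon>" for n
  proof -
    interpret prob_space "M n" using P by (rule prob_measuresD)
    have [measurable_cong]: "sets (M n) = sets borel" using P by (rule prob_measuresD)
    have sp: "space (M n) = UNIV" using P by (rule prob_measuresD)
    have s: "{v. R < norm v} \<in> sets (M n)"
    proof -
      have "{v \<in> space (M n). R < norm v} \<in> sets (M n)" by measurable
      then show ?thesis by (simp add: sp)
    qed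
    have "ennreal (R powr \<alpha>) * emeasure (M n) {v. R < norm v} =
        (\<integral>\<^sup>+v. ennreal (R powr \<alpha>) * indicator {v. R < norm v} v \<partial>M n)"
      by (rule nn_integral_cmult_indicator[symmetric]) (rule s)
    also have "\<dots> \<le> moment \<alpha> (M n)"
      unfolding moment_def
    proof (rule nn_integral_mono)
      fix v :: 'a
      have "R powr \<alpha> \<le> norm v powr \<alpha>" if "R < norm v"
        using that R \<alpha> by (intro powr_mono2) auto
      then show "ennreal (R powr \<alpha>) * indicator {v. R < norm v} v \<le> ennreal (norm v powr \<alpha>)"
        by (auto simp: indicator_def ennreal_leI)
    qed
    also note K(1)
    finally have "ennreal ((K + 1) / \<epsilon>) * ennreal (prob {v. R < norm v}) \<le> ennreal K"
      unfolding R(1) emeasure_eq_measure .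
    then have "ennreal ((K + 1) / \<epsilon> * prob {v. R < norm v}) \<le> ennreal K"
      using K(2) \<epsilon> by (subst ennreal_mult) auto
    then have "(K + 1) * prob {v. R < norm v} \<le> \<epsilon> * K"
      using K(2) \<epsilon> by (subst (asm) ennreal_le_iff) (auto simp: field_simps)
    also have "\<dots> < (K + 1) * \<epsilon>" using \<epsilon> by (simp add: algebra_simps)
    finally show ?thesis using K(2) by (simp add: mult_less_cancel_left_pos)
  qed
  then show ?thesis by blast
qed

text \<open>
  The truncations \<open>min (norm v powr \<alpha>) N\<close> are bounded and continuous, so weak convergence applies to them;
  Fatou's lemma lets \<open>N\<close> tend to infinity.
\<close>

lemma moment_le_of_weak_limit:
  fixes M :: "nat \<Rightarrow> 'a::euclidean_space measure"
  assumes P: "\<And>n. M n \<in> prob_measures" and l: "l \<in> prob_measures" and \<alpha>: "0 < \<alpha>"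
    and K: "\<And>n. moment \<alpha> (M n) \<le> ennreal K" "0 \<le> K"
    and conv: "\<And>(f::'a \<Rightarrow> complex) B. continuous_on UNIV f \<Longrightarrow> (\<And>v. norm (f v) \<le> B) \<Longrightarrow>
      (\<lambda>j. \<integral>v. f v \<partial>M j) \<longlonglongrightarrow> (\<integral>v. f v \<partial>l)"
  shows "moment \<alpha> l \<le> ennreal K"
proof -
  let ?f = "\<lambda>N (v::'a). min (norm v powr \<alpha>) (real N)"
  have [measurable_cong]: "sets l = sets borel" "sets (M n) = sets borel" for n
    using P l by (simp_all add: prob_measuresD(2))
  have "(\<integral>\<^sup>+v. ennreal (?f N v) \<partial>l) \<le> ennreal K" for N
  proof -
    have int: "integrable \<rho> (?f N)" if "\<rho> \<in> prob_measures" for \<rho>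
      by (rule prob_integrable_bounded[OF that, where B="real N"]) (auto simp: abs_of_nonneg)
    have nn: "(\<integral>\<^sup>+v. ennreal (?f N v) \<partial>\<rho>) = ennreal (\<integral>v. ?f N v \<partial>\<rho>)" if "\<rho> \<in> prob_measures" for \<rho>
      using int[OF that] by (intro nn_integral_eq_integral) auto
    have "(\<lambda>j. \<integral>v. complex_of_real (?f N v) \<partial>M j) \<longlonglongrightarrow> (\<integral>v. complex_of_real (?f N v) \<partial>l)"
    proof (rule conv)
      show "continuous_on UNIV (\<lambda>v::'a. complex_of_real (?f N v))"
        using \<alpha> by (intro continuous_intros continuous_on_powr') auto
      show "norm (complex_of_real (?f N v)) \<le> real N" for v by simp
    qed
    then have "(\<lambda>j. \<integral>v. ?f N v \<partial>M j) \<longlonglongrightarrow> (\<integral>v. ?f N v \<partial>l)"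
      unfolding integral_complex_of_real tendsto_of_real_iff .
    moreover have "(\<integral>v. ?f N v \<partial>M j) \<le> K" for j
    proof -
      have "ennreal (\<integral>v. ?f N v \<partial>M j) \<le> moment \<alpha> (M j)"
        unfolding nn[OF P, symmetric] moment_def by (intro nn_integral_mono ennreal_leI) simp
      also note K(1)
      finally show ?thesis using K(2) by (subst (asm) ennreal_le_iff) auto
    qed
    ultimately have "(\<integral>v. ?f N v \<partial>l) \<le> K" by (intro LIMSEQ_le_const2) auto
    then show ?thesis unfolding nn[OF l] by (rule ennreal_leI)
  qed
  moreover have "moment \<alpha> l \<le> liminf (\<lambda>N. \<integral>\<^sup>+v. ennreal (?f N v) \<partial>l)"
  proof -
    have "(\<lambda>N. ennreal (?f N v)) \<longlonglongrightarrow> ennreal (norm v powr \<alpha>)" for v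
    proof (rule tendsto_eventually)
      obtain N0 where "norm v powr \<alpha> \<le> real N0" using real_arch_simple by blast
      then show "\<forall>\<^sub>F N in sequentially. ennreal (?f N v) = ennreal (norm v powr \<alpha>)"
        by (intro eventually_sequentiallyI[of N0]) (simp add: min_absorb1)
    qed
    then have "ennreal (norm v powr \<alpha>) = liminf (\<lambda>N. ennreal (?f N v))" for v
      by (intro lim_imp_Liminf[symmetric]) auto
    then have "moment \<alpha> l = (\<integral>\<^sup>+v. liminf (\<lambda>N. ennreal (?f N v)) \<partial>l)" by (simp add: moment_def)
    also have "\<dots> \<le> liminf (\<lambda>N. \<integral>\<^sup>+v. ennreal (?f N v) \<partial>l)"
      by (rule nn_integral_liminf) measurable
    finally show ?thesis .
  qed
  ultimately show ?thesis
    by (metis (no_types, lifting) Liminf_le always_eventually order_trans trivial_limit_sequentially)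
qed

text \<open>
  From some index on, the members of a Cauchy sequence have distance less than \<open>1\<close> from a fixed one, so
  \<open>moment_bound\<close> bounds their moments. This gives tightness, hence a weakly convergent subsequence. Its
  limit has a finite moment, and the Fourier transforms converge pointwise, so that the Fatou property
  of \<open>E\<close> yields the lower semicontinuity required by \<open>complete_metric_onI\<close>.
\<close>

lemma complete_metric_on_fourier_seminorm:
  fixes E :: "('a::euclidean_space \<Rightarrow> complex) \<Rightarrow> ennreal"
  assumes p: "0 < p" and \<alpha>: "0 < \<alpha>" "2 * (real p - 1) < \<alpha>" "\<alpha> < 2 * real p" and k: "\<And>i. i < p \<Longrightarrow> 2 * i < k"
    and nz: "\<And>i. i < k \<Longrightarrow> \<alpha> \<noteq> real i"
    and E: "fatou_seminorm E"
    and fin: "\<And>\<mu> \<nu>. \<mu> \<in> prob_measures_moment \<alpha> \<Longrightarrow> \<nu> \<in> prob_measures_moment \<alpha> \<Longrightarrow>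
      E (\<lambda>\<xi>. fourier \<mu> \<xi> - fourier \<nu> \<xi>) < \<infinity>"
    and sep: "\<And>f \<xi>. E f = 0 \<Longrightarrow> \<xi> \<noteq> 0 \<Longrightarrow> f \<xi> = 0"
    and dom: "\<And>f. diff_norm \<alpha> k (\<lambda>\<xi>. Re (f \<xi>)) \<le> E f"
  shows "complete_metric_on (prob_measures_moment \<alpha>) (\<lambda>\<mu> \<nu>. E (\<lambda>\<xi>. fourier \<mu> \<xi> - fourier \<nu> \<xi>))"
proof (rule complete_metric_onI)
  let ?S = "prob_measures_moment \<alpha> :: 'a measure set"
  fix \<mu> \<nu> \<rho> :: "'a measure"
  note E0 = fatou_seminorm_zero[OF E] and E_minus = fatou_seminorm_minus[OF E]
  show "E (\<lambda>\<xi>. fourier \<mu> \<xi> - fourier \<nu> \<xi>) = E (\<lambda>\<xi>. fourier \<nu> \<xi> - fourier \<mu> \<xi>)"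
    using E_minus[of "\<lambda>\<xi>. fourier \<mu> \<xi> - fourier \<nu> \<xi>"] by simp
  show "E (\<lambda>\<xi>. fourier \<mu> \<xi> - fourier \<mu> \<xi>) = 0" by (simp add: E0)
  assume \<mu>: "\<mu> \<in> ?S" and \<nu>: "\<nu> \<in> ?S"
  note P = prob_measures_momentD(1)[OF \<mu>] prob_measures_momentD(1)[OF \<nu>]
  show "E (\<lambda>\<xi>. fourier \<mu> \<xi> - fourier \<nu> \<xi>) < \<infinity>" using \<mu> \<nu> by (rule fin)
  show "\<mu> = \<nu>" if "E (\<lambda>\<xi>. fourier \<mu> \<xi> - fourier \<nu> \<xi>) = 0"
  proof (rule fourier_unique[OF P])
    show "fourier \<mu> \<xi> = fourier \<nu> \<xi>" for \<xi>
      using sep[OF that, of \<xi>] P by (cases "\<xi> = 0") (simp_all add: fourier_0)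
  qed
  assume \<rho>: "\<rho> \<in> ?S"
  have m: "(\<lambda>\<xi>. fourier \<mu> \<xi> - fourier \<nu> \<xi>) \<in> borel_measurable borel"
      "(\<lambda>\<xi>. fourier \<nu> \<xi> - fourier \<rho> \<xi>) \<in> borel_measurable borel"
    using P prob_measures_momentD(1)[OF \<rho>] by measurable
  have "E (\<lambda>\<xi>. (fourier \<mu> \<xi> - fourier \<nu> \<xi>) + (fourier \<nu> \<xi> - fourier \<rho> \<xi>)) \<le>
      E (\<lambda>\<xi>. fourier \<mu> \<xi> - fourier \<nu> \<xi>) + E (\<lambda>\<xi>. fourier \<nu> \<xi> - fourier \<rho> \<xi>)"
    by (rule fatou_seminorm_triangle[OF E m])
  then show "E (\<lambda>\<xi>. fourier \<mu> \<xi> - fourier \<rho> \<xi>) \<le>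
      E (\<lambda>\<xi>. fourier \<mu> \<xi> - fourier \<nu> \<xi>) + E (\<lambda>\<xi>. fourier \<nu> \<xi> - fourier \<rho> \<xi>)" by simp
next
  let ?S = "prob_measures_moment \<alpha> :: 'a measure set"
  let ?d = "\<lambda>\<mu> \<nu>. E (\<lambda>\<xi>. fourier \<mu> \<xi> - fourier \<nu> \<xi>)"
  fix \<sigma> :: "nat \<Rightarrow> 'a measure"
  assume "range \<sigma> \<subseteq> ?S" and cauchy: "\<And>\<epsilon>. 0 < \<epsilon> \<Longrightarrow> \<exists>N. \<forall>m\<ge>N. \<forall>n\<ge>N. ?d (\<sigma> m) (\<sigma> n) < ennreal \<epsilon>"
  then have S: "\<sigma> n \<in> ?S" for n by auto
  then have P: "\<sigma> n \<in> prob_measures" for n by (rule prob_measures_momentD)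
  obtain N where N: "\<And>n. N \<le> n \<Longrightarrow> ?d (\<sigma> n) (\<sigma> N) < 1"
    using cauchy[of 1] by auto
  obtain A B where A: "0 < A" and B: "0 \<le> B" and AB: "\<And>\<mu> \<nu>. \<mu> \<in> ?S \<Longrightarrow> \<nu> \<in> ?S \<Longrightarrow>
      ennreal A * moment \<alpha> \<mu> \<le> ennreal B * (moment \<alpha> \<nu> + diff_norm \<alpha> k (\<lambda>\<xi>. Re (fourier \<mu> \<xi>) - Re (fourier \<nu> \<xi>)))"
    using moment_bound[OF p \<alpha> k nz, where 'a='a] by metis
  define m where "m = enn2real (moment \<alpha> (\<sigma> N))"
  have m: "moment \<alpha> (\<sigma> N) = ennreal m" "0 \<le> m"
    using prob_measures_momentD(2)[OF S, of N] by (auto simp: m_def)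
  define K where "K = B * (m + 1) / A"
  have K0: "0 \<le> K" using A B m by (simp add: K_def)
  have K: "moment \<alpha> (\<sigma> (N + n)) \<le> ennreal K" for n
  proof -
    have "ennreal A * moment \<alpha> (\<sigma> (N + n)) \<le> ennreal B * (moment \<alpha> (\<sigma> N) +
        diff_norm \<alpha> k (\<lambda>\<xi>. Re (fourier (\<sigma> (N + n)) \<xi>) - Re (fourier (\<sigma> N) \<xi>)))"
      by (rule AB[OF S S])
    also have "\<dots> \<le> ennreal B * (moment \<alpha> (\<sigma> N) + 1)"
    proof (intro mult_left_mono add_left_mono)
      have "diff_norm \<alpha> k (\<lambda>\<xi>. Re (fourier (\<sigma> (N + n)) \<xi> - fourier (\<sigma> N) \<xi>)) \<le> 1"
        using order_trans[OF dom less_imp_le[OF N[of "N + n"]]] by simp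
      then show "diff_norm \<alpha> k (\<lambda>\<xi>. Re (fourier (\<sigma> (N + n)) \<xi>) - Re (fourier (\<sigma> N) \<xi>)) \<le> 1" by simp
    qed simp
    also have "\<dots> = ennreal A * ennreal K"
      using A B m by (simp add: K_def ennreal_mult[symmetric] flip: ennreal_plus ennreal_1)
    finally show ?thesis using A by (simp add: ennreal_mult_le_mult_iff)
  qed
  define \<tau> where "\<tau> = (\<lambda>n. \<sigma> (N + n))"
  have \<tau>: "\<tau> n \<in> prob_measures" "moment \<alpha> (\<tau> n) \<le> ennreal K" for n
    using P K by (auto simp: \<tau>_def)
  obtain r l where r: "strict_mono r" and l: "l \<in> prob_measures"
    and conv: "\<And>(f::'a \<Rightarrow> complex) B. continuous_on UNIV f \<Longrightarrow> (\<And>v. norm (f v) \<le> B) \<Longrightarrow>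
      (\<lambda>j. \<integral>v. f v \<partial>\<tau> (r j)) \<longlonglongrightarrow> (\<integral>v. f v \<partial>l)"
    using tight_imp_weakly_convergent_subsequence[of \<tau>, OF \<tau>(1) moment_bounded_imp_tight[of \<tau>, OF \<tau>(1) \<alpha>(1) \<tau>(2) K0]]
    by blast
  have "moment \<alpha> l \<le> ennreal K"
    by (rule moment_le_of_weak_limit[of "\<lambda>j. \<tau> (r j)", OF \<tau>(1) l \<alpha>(1) \<tau>(2) K0 conv])
  then have lS: "l \<in> ?S"
    using l le_less_trans by (fastforce simp: prob_measures_moment_def moment_def)
  have fconv: "(\<lambda>j. fourier (\<tau> (r j)) \<xi>) \<longlonglongrightarrow> fourier l \<xi>" for \<xi>
    unfolding fourier_def
    by (rule conv[where B=1]) (auto intro!: continuous_intros simp: norm_exp_eq_Re)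
  have "?d (\<sigma> n) l \<le> liminf (\<lambda>j. ?d (\<sigma> n) (\<sigma> (N + r j)))" for n
  proof -
    have "(\<lambda>\<xi>. fourier (\<sigma> n) \<xi> - fourier (\<tau> (r j)) \<xi>) \<in> borel_measurable borel" for j
      using P \<tau>(1) by measurable
    moreover have "(\<lambda>j. fourier (\<sigma> n) \<xi> - fourier (\<tau> (r j)) \<xi>) \<longlonglongrightarrow> fourier (\<sigma> n) \<xi> - fourier l \<xi>" for \<xi>
      by (intro tendsto_diff tendsto_const fconv)
    ultimately have "E (\<lambda>\<xi>. fourier (\<sigma> n) \<xi> - fourier l \<xi>) \<le>
        liminf (\<lambda>j. E (\<lambda>\<xi>. fourier (\<sigma> n) \<xi> - fourier (\<tau> (r j)) \<xi>))"
      by (rule fatou_seminorm_liminf[OF E])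
    then show ?thesis unfolding \<tau>_def .
  qed
  moreover have "strict_mono (\<lambda>j. N + r j)" using r by (auto simp: strict_mono_def)
  ultimately show "\<exists>l\<in>?S. \<exists>r. strict_mono r \<and> (\<forall>n. ?d (\<sigma> n) l \<le> liminf (\<lambda>j. ?d (\<sigma> n) (\<sigma> (r j))))"
    using lS by blast
qed

lemma sup_norm_fourier_finite:
  assumes "\<mu> \<in> prob_measures" "\<nu> \<in> prob_measures"
  shows "sup_norm (\<lambda>\<xi>. fourier \<mu> \<xi> - fourier \<nu> \<xi>) < \<infinity>"
proof -
  have "sup_norm (\<lambda>\<xi>. fourier \<mu> \<xi> - fourier \<nu> \<xi>) \<le> ennreal 2"
    unfolding sup_norm_def
  proof (intro SUP_least ennreal_leI)
    fix \<xi>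
    show "norm (fourier \<mu> \<xi> - fourier \<nu> \<xi>) \<le> 2"
      using norm_triangle_ineq4[of "fourier \<mu> \<xi>" "fourier \<nu> \<xi>"] norm_fourier_le_1[OF assms(1), of \<xi>]
        norm_fourier_le_1[OF assms(2), of \<xi>] by linarith
  qed
  then show ?thesis using le_less_trans ennreal_less_top by (metis infinity_ennreal_def)
qed

lemma diff_norm_Re_le:
  fixes f :: "'a::euclidean_space \<Rightarrow> complex"
  shows "diff_norm \<alpha> k (\<lambda>\<xi>. Re (f \<xi>)) \<le> diff_norm \<alpha> k f"
  unfolding diff_norm_def
proof (intro nn_integral_mono ennreal_leI divide_right_mono)
  fix \<xi> :: 'a
  have "Re (of_nat (k choose m) * (- 1) ^ (k - m) * z) = of_nat (k choose m) * (- 1) ^ (k - m) * Re z" for m z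
  proof -
    have "of_nat (k choose m) * (- 1) ^ (k - m) * z = complex_of_real (of_nat (k choose m) * (- 1) ^ (k - m)) * z" by simp
    then show ?thesis by (simp only: times_complex.sel) simp
  qed
  then have "fin_diff k (\<lambda>\<xi>. Re (f \<xi>)) \<xi> = Re (fin_diff k f \<xi>)"
    by (simp add: fin_diff_def)
  then show "norm (fin_diff k (\<lambda>\<xi>. Re (f \<xi>)) \<xi>) \<le> norm (fin_diff k f \<xi>)"
    by (simp add: abs_Re_le_cmod)
qed simp

lemma sup_and_fourier_dist_seminorm:
  fixes N :: "('a::euclidean_space \<Rightarrow> complex) \<Rightarrow> ennreal"
  assumes "N = sup_norm \<or> N = (\<lambda>f. SUP \<xi>\<in>{\<xi>. \<xi> \<noteq> 0}. ennreal (norm (f \<xi>) / norm \<xi> powr \<beta>))"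
  shows "fatou_seminorm N" "N f = 0 \<Longrightarrow> \<xi> \<noteq> 0 \<Longrightarrow> f \<xi> = 0"
proof -
  obtain b :: 'a where "b \<in> Basis" using nonempty_Basis by blast
  then have "b \<noteq> 0" by auto
  then have ne: "{\<xi>::'a. \<xi> \<noteq> 0} \<noteq> {}" by blast
  have "sup_norm = (\<lambda>f::'a \<Rightarrow> complex. SUP \<xi>\<in>UNIV. ennreal (norm (f \<xi>) / 1))"
    by (simp add: sup_norm_def[abs_def])
  then show "fatou_seminorm N"
    using assms fatou_seminorm_weighted_SUP[of "\<lambda>_::'a. 1" UNIV]
      fatou_seminorm_weighted_SUP[of "\<lambda>\<xi>::'a. norm \<xi> powr \<beta>" "{\<xi>. \<xi> \<noteq> 0}"] ne by auto
  show "f \<xi> = 0" if z: "N f = 0" and \<xi>: "\<xi> \<noteq> 0"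
    using assms
  proof
    assume "N = sup_norm"
    then have "ennreal (norm (f \<xi>)) \<le> 0"
      unfolding z[symmetric] by (auto simp: sup_norm_def intro!: SUP_upper)
    then show ?thesis by (simp add: ennreal_eq_0_iff)
  next
    assume "N = (\<lambda>f. SUP \<xi>\<in>{\<xi>. \<xi> \<noteq> 0}. ennreal (norm (f \<xi>) / norm \<xi> powr \<beta>))"
    then have "ennreal (norm (f \<xi>) / norm \<xi> powr \<beta>) \<le> 0"
      unfolding z[symmetric] using \<xi> by (auto intro!: SUP_upper)
    then show ?thesis using \<xi> by (simp add: ennreal_eq_0_iff divide_le_0_iff)
  qed
qed

lemma complete_metric_on_fourier_distances:
  fixes \<alpha> \<beta> :: real and D :: "('a::euclidean_space \<Rightarrow> complex) \<Rightarrow> ennreal"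
  assumes p: "0 < p" and \<alpha>: "0 < \<alpha>" "2 * (real p - 1) < \<alpha>" "\<alpha> < 2 * real p" and k: "\<And>i. i < p \<Longrightarrow> 2 * i < k"
    and nz: "\<And>i. i < k \<Longrightarrow> \<alpha> \<noteq> real i" and \<beta>: "0 < \<beta>" "\<beta> \<le> min \<alpha> 1"
    and D: "fatou_seminorm D" and dom: "\<And>f. diff_norm \<alpha> k (\<lambda>\<xi>. Re (f \<xi>)) \<le> D f"
    and fin: "\<And>\<mu>. \<mu> \<in> prob_measures_moment \<alpha> \<Longrightarrow> D (fourier \<mu>) < \<infinity>"
  shows "complete_metric_on (prob_measures_moment \<alpha>)
      (\<lambda>\<mu> \<nu>. sup_norm (\<lambda>\<xi>. fourier \<mu> \<xi> - fourier \<nu> \<xi>) + D (\<lambda>\<xi>. fourier \<mu> \<xi> - fourier \<nu> \<xi>))"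
    and "complete_metric_on (prob_measures_moment \<alpha>)
      (\<lambda>\<mu> \<nu>. fourier_dist \<beta> \<mu> \<nu> + D (\<lambda>\<xi>. fourier \<mu> \<xi> - fourier \<nu> \<xi>))"
proof -
  have D_fin: "D (\<lambda>\<xi>. fourier \<mu> \<xi> - fourier \<nu> \<xi>) < \<infinity>"
    if \<mu>: "\<mu> \<in> prob_measures_moment \<alpha>" and \<nu>: "\<nu> \<in> prob_measures_moment \<alpha>" for \<mu> \<nu> :: "'a measure"
  proof -
    have [measurable]: "fourier \<mu> \<in> borel_measurable borel" "fourier \<nu> \<in> borel_measurable borel"
      using prob_measures_momentD(1)[OF \<mu>] prob_measures_momentD(1)[OF \<nu>] by measurable
    have "(\<lambda>\<xi>. - fourier \<nu> \<xi>) \<in> borel_measurable borel" by measurable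
    then have "D (\<lambda>\<xi>. fourier \<mu> \<xi> + - fourier \<nu> \<xi>) \<le> D (fourier \<mu>) + D (\<lambda>\<xi>. - fourier \<nu> \<xi>)"
      by (intro fatou_seminorm_triangle[OF D]) measurable
    also have "D (\<lambda>\<xi>. - fourier \<nu> \<xi>) = D (fourier \<nu>)"
      by (rule fatou_seminorm_minus[OF D])
    finally show ?thesis using fin[OF \<mu>] fin[OF \<nu>] by (simp add: le_less_trans)
  qed
  have *: "complete_metric_on (prob_measures_moment \<alpha>)
      (\<lambda>\<mu> \<nu>::'a measure. N (\<lambda>\<xi>. fourier \<mu> \<xi> - fourier \<nu> \<xi>) + D (\<lambda>\<xi>. fourier \<mu> \<xi> - fourier \<nu> \<xi>))"
    if N: "N = sup_norm \<or> N = (\<lambda>f. SUP \<xi>\<in>{\<xi>. \<xi> \<noteq> 0}. ennreal (norm (f \<xi>) / norm \<xi> powr \<beta>))" for N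
  proof (rule complete_metric_on_fourier_seminorm[OF p \<alpha> k nz])
    show "fatou_seminorm (\<lambda>f. N f + D f)"
      by (intro fatou_seminorm_add sup_and_fourier_dist_seminorm(1)[OF N] D)
    show "f \<xi> = 0" if "N f + D f = 0" "\<xi> \<noteq> 0" for f \<xi>
      using sup_and_fourier_dist_seminorm(2)[OF N, of f \<xi>] that by simp
    show "diff_norm \<alpha> k (\<lambda>\<xi>. Re (f \<xi>)) \<le> N f + D f" for f
      using dom[of f] by (simp add: add_increasing)
    fix \<mu> \<nu> :: "'a measure" assume \<mu>: "\<mu> \<in> prob_measures_moment \<alpha>" and \<nu>: "\<nu> \<in> prob_measures_moment \<alpha>"
    have "fourier_dist \<beta> \<mu> \<nu> < \<infinity>" using \<beta> by (intro fourier_dist_finite[OF _ _ _ \<mu> \<nu>]) auto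
    then have "N (\<lambda>\<xi>. fourier \<mu> \<xi> - fourier \<nu> \<xi>) < \<infinity>"
      using N sup_norm_fourier_finite[OF prob_measures_momentD(1)[OF \<mu>] prob_measures_momentD(1)[OF \<nu>]]
      unfolding fourier_dist_def by blast
    then show "N (\<lambda>\<xi>. fourier \<mu> \<xi> - fourier \<nu> \<xi>) + D (\<lambda>\<xi>. fourier \<mu> \<xi> - fourier \<nu> \<xi>) < \<infinity>"
      using D_fin[OF \<mu> \<nu>] by simp
  qed auto
  show "complete_metric_on (prob_measures_moment \<alpha>)
      (\<lambda>\<mu> \<nu>. sup_norm (\<lambda>\<xi>. fourier \<mu> \<xi> - fourier \<nu> \<xi>) + D (\<lambda>\<xi>. fourier \<mu> \<xi> - fourier \<nu> \<xi>))"
    by (rule *) simp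
  show "complete_metric_on (prob_measures_moment \<alpha>)
      (\<lambda>\<mu> \<nu>. fourier_dist \<beta> \<mu> \<nu> + D (\<lambda>\<xi>. fourier \<mu> \<xi> - fourier \<nu> \<xi>))"
    unfolding fourier_dist_def by (rule *) simp
qed

text \<open>
  Take \<open>p - 1\<close> to be the integer part of \<open>\<alpha> / 2\<close>; the strict lower bound holds as \<open>\<alpha>\<close> is not an even integer,
  an integral \<open>\<alpha>\<close> being the odd number \<open>k\<close>. If \<open>k\<close> is odd, the even number \<open>2 * (p - 1) < \<alpha>\<close>, being less than
  \<open>k + 1\<close>, is less than \<open>k\<close>.
\<close>

lemma exists_taylor_order:
  fixes \<alpha> :: real and k :: nat
  assumes "0 < \<alpha>" and "\<alpha> \<notin> \<int> \<and> \<alpha> < real k \<or> odd k \<and> (\<alpha> \<notin> \<int> \<and> \<alpha> < real k + 1 \<or> \<alpha> = real k)"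
  obtains p where "0 < p" "2 * (real p - 1) < \<alpha>" "\<alpha> < 2 * real p" "\<And>i. i < p \<Longrightarrow> 2 * i < k"
    and "\<And>i. i < k \<Longrightarrow> \<alpha> \<noteq> real i"
proof
  define n where "n = nat \<lfloor>\<alpha> / 2\<rfloor>"
  have n: "real n = of_int \<lfloor>\<alpha> / 2\<rfloor>" using assms(1) by (simp add: n_def)
  have not_even: "\<alpha> \<noteq> 2 * real n"
  proof
    assume e: "\<alpha> = 2 * real n"
    then have "\<alpha> = of_int (2 * int n)" by simp
    then have "\<alpha> \<in> \<int>" by (metis Ints_of_int)
    then have "odd k" "real k = real (2 * n)" using assms(2) e by auto
    then show False by (metis dvd_triv_left of_nat_eq_iff)
  qed
  show "0 < Suc n" by simp
  have lower: "2 * real n < \<alpha>" using not_even n of_int_floor_le[of "\<alpha> / 2"] by linarith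
  then show "2 * (real (Suc n) - 1) < \<alpha>" by simp
  have "\<alpha> / 2 < real n + 1" unfolding n by (rule real_of_int_floor_add_one_gt)
  then show "\<alpha> < 2 * real (Suc n)" by simp
  show "2 * i < k" if "i < Suc n" for i
  proof -
    have "real (2 * n) < real k + 1" "even k \<Longrightarrow> real (2 * n) < real k" using lower assms(2) by auto
    then have "2 * n < k + 1" "even k \<Longrightarrow> 2 * n < k" by linarith+
    then have "2 * n < k" by (cases "2 * n = k") auto
    then show ?thesis using that by simp
  qed
  show "\<alpha> \<noteq> real i" if "i < k" for i
    using assms(2) that by auto
qed

theorem theorem5:
  fixes k :: nat and \<alpha> \<beta> :: real
  assumes "0 < \<alpha>" and "0 < \<beta>" and "\<beta> \<le> min \<alpha> 1"
  shows
    "(\<alpha> \<notin> \<int> \<and> 0 < \<alpha> \<and> \<alpha> < real k \<longrightarrow>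
        complete_metric_on (prob_measures_moment \<alpha> :: 'a::euclidean_space measure set) (D_dist k \<alpha>) \<and>
        complete_metric_on (prob_measures_moment \<alpha> :: 'a measure set) (F_dist k \<alpha> \<beta>) \<and>
        complete_metric_on (prob_measures_moment \<alpha> :: 'a measure set) (G_dist k \<alpha>) \<and>
        complete_metric_on (prob_measures_moment \<alpha> :: 'a measure set) (H_dist k \<alpha> \<beta>))
     \<and>
     (odd k \<and> ((\<alpha> \<notin> \<int> \<and> 0 < \<alpha> \<and> \<alpha> < real k + 1) \<or> \<alpha> = real k) \<longrightarrow>
        complete_metric_on (prob_measures_moment \<alpha> :: 'a measure set) (G_dist k \<alpha>) \<and>
        complete_metric_on (prob_measures_moment \<alpha> :: 'a measure set) (H_dist k \<alpha> \<beta>))"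
proof -
  let ?M = "prob_measures_moment \<alpha> :: 'a measure set"
  have GH: "complete_metric_on ?M (G_dist k \<alpha>) \<and> complete_metric_on ?M (H_dist k \<alpha> \<beta>)"
    if range: "\<alpha> \<notin> \<int> \<and> \<alpha> < real k \<or> odd k \<and> (\<alpha> \<notin> \<int> \<and> \<alpha> < real k + 1 \<or> \<alpha> = real k)"
  proof -
    obtain p where p: "0 < p" "2 * (real p - 1) < \<alpha>" "\<alpha> < 2 * real p" "\<And>i. i < p \<Longrightarrow> 2 * i < k"
      and nz: "\<And>i. i < k \<Longrightarrow> \<alpha> \<noteq> real i"
      using exists_taylor_order[OF assms(1) range] by blast
    let ?D = "\<lambda>f::'a \<Rightarrow> complex. diff_norm \<alpha> k (\<lambda>\<xi>. Re (f \<xi>))"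
    have D: "fatou_seminorm ?D" by (intro fatou_seminorm_diff_norm bounded_linear_Re)
    have fin: "?D (fourier \<mu>) < \<infinity>" if "\<mu> \<in> ?M" for \<mu>
      using p that by (intro diff_norm_Re_fourier_finite[of p] assms(1))
    note complete = complete_metric_on_fourier_distances[of p \<alpha> k \<beta> ?D,
        OF p(1) assms(1) p(2,3) p(4) nz assms(2,3) D order_refl fin]
    show ?thesis using complete by (simp add: G_dist_def[abs_def] H_dist_def[abs_def])
  qed
  have DF: "complete_metric_on ?M (D_dist k \<alpha>) \<and> complete_metric_on ?M (F_dist k \<alpha> \<beta>)"
    if range: "\<alpha> \<notin> \<int>" "\<alpha> < real k"
  proof -
    obtain p where p: "0 < p" "2 * (real p - 1) < \<alpha>" "\<alpha> < 2 * real p" "\<And>i. i < p \<Longrightarrow> 2 * i < k"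
      and nz: "\<And>i. i < k \<Longrightarrow> \<alpha> \<noteq> real i"
      using exists_taylor_order[OF assms(1), of k] range by blast
    let ?D = "diff_norm \<alpha> k :: ('a \<Rightarrow> complex) \<Rightarrow> ennreal"
    have D: "fatou_seminorm ?D"
      using fatou_seminorm_diff_norm[OF bounded_linear_ident, of \<alpha> k] by simp
    have fin: "?D (fourier \<mu>) < \<infinity>" if "\<mu> \<in> ?M" for \<mu>
      using assms(1) range(2) that by (rule diff_norm_fourier_finite)
    note complete = complete_metric_on_fourier_distances[of p \<alpha> k \<beta> ?D,
        OF p(1) assms(1) p(2,3) p(4) nz assms(2,3) D diff_norm_Re_le fin]
    show ?thesis using complete by (simp add: D_dist_def[abs_def] F_dist_def[abs_def])
  qed
  show ?thesis using GH DF by blast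
qed

end
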